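(* Let $n\ge 2$ be an integer and let $q$ be a prime power such that $q\ge 3$ if $n=2$. Let $T$ be an $n$-vertex bypass transition graph. Then the graph $G(n,q,T)$ is Hamilton connected.
   Context: $GL(n,q)$ is the group of invertible $n\times n$ matrices over the finite field $\mathbb{F}_q$, and $[n]=\{1,\dots,n\}$. Fix a generator $\alpha$ of the multiplicative group of $\mathbb{F}_q$. A transition graph is a directed graph $T$ (without loops) on the vertex set $[n]$, with edge set $E(T)$. A transition graph $T$ on $[n]$ is a bypass transition graph if either $n=1$, or $n\ge 2$ and (i) there exist an edge $(i,n)$ and an edge $(n,j)$ of $T$ for some $i,j\in[n-1]$, and (ii) the graph $T-n$ obtained by removing the vertex $n$ from $T$ is a bypass transition graph on $[n-1]$. For distinct $x,y\in[n]$ let $A_{xy}$ be the $n\times n$ matrix with entry $1$ at position $(i,j)$ if $i=j$ or ($i=y$ and $j=x$), and $0$ elsewhere (left multiplication by $A_{xy}$ adds row $x$ to row $y$). For $x\in[n]$ let $M_x$ be the diagonal matrix with $\alpha$ at position $(x,x)$ and $1$ at the other diagonal positions. Define $\mathrm{ops}(T)=\{A_{ij},A_{ij}^{-1}:(i,j)\in E(T)\}\cup\{M_i,M_i^{-1}:i\in[n]\}$ if $q>2$, and $\mathrm{ops}(T)=\{A_{ij},A_{ij}^{-1}:(i,j)\in E(T)\}$ if $q=2$. $G(n,q,T)$ is the undirected simple graph with vertex set $GL(n,q)$ and edges $\{X,SX\}$ for $X\in GL(n,q)$, $S\in\mathrm{ops}(T)$ (the Cayley graph with generators acting on the left). A graph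 is Hamilton connected if for any two distinct vertices there is a Hamilton path between them. *)

theory Defs
  imports "Jordan_Normal_Form.Gauss_Jordan_Elimination" "HOL-Algebra.Group"
    "HOL-Library.Cardinality"
begin

section \<open>Transition graphs\<close>

text \<open>
  Vertices (and, below, row and column indices of matrices) are numbered from 0, as in the matrix
  library: the vertex set with \<open>n\<close> elements is \<open>{..<n}\<close>, and its last vertex is \<open>n - 1\<close>.
  A transition graph is given by \<open>n\<close> and its set of directed edges.
\<close>

definition transition_graph :: "nat \<Rightarrow> nat rel \<Rightarrow> bool" where
  "transition_graph n T \<longleftrightarrow> T \<subseteq> {..<n} \<times> {..<n} \<and> irrefl T"

text \<open>\<open>Restr T {..<n}\<close> is the edge set of the graph obtained by removing the last vertex \<open>n\<close>
  from a graph on \<open>{..<Suc n}\<close>.\<close>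

primrec bypass_transition_graph :: "nat \<Rightarrow> nat rel \<Rightarrow> bool" where
  "bypass_transition_graph 0 T \<longleftrightarrow> False"
| "bypass_transition_graph (Suc n) T \<longleftrightarrow>
     transition_graph (Suc n) T \<and>
     (n = 0 \<or>
      (\<exists>i\<in>{..<n}. (i, n) \<in> T) \<and> (\<exists>j\<in>{..<n}. (n, j) \<in> T) \<and>
      bypass_transition_graph n (Restr T {..<n}))"


section \<open>Simple graphs and Hamilton connectedness\<close>

text \<open>A simple graph is given by its vertex set and its set of (two-element) edges.\<close>

definition hamilton_path :: "'v set \<Rightarrow> 'v set set \<Rightarrow> 'v \<Rightarrow> 'v \<Rightarrow> 'v list \<Rightarrow> bool" where
  "hamilton_path V E u v p \<longleftrightarrow>
     p \<noteq> [] \<and> hd p = u \<and> last p = v \<and> distinct p \<and> set p = V \<and>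
     successively (\<lambda>x y. {x, y} \<in> E) p"

definition hamilton_connected :: "'v set \<Rightarrow> 'v set set \<Rightarrow> bool" where
  "hamilton_connected V E \<longleftrightarrow> (\<forall>u\<in>V. \<forall>v\<in>V. u \<noteq> v \<longrightarrow> (\<exists>p. hamilton_path V E u v p))"

definition left_cayley_edges :: "('g, 'b) monoid_scheme \<Rightarrow> 'g set \<Rightarrow> 'g set set" where
  "left_cayley_edges G S =
     {{x, s \<otimes>\<^bsub>G\<^esub> x} | x s. x \<in> carrier G \<and> s \<in> S \<and> s \<otimes>\<^bsub>G\<^esub> x \<noteq> x}"


section \<open>The general linear group and the allowed row operations\<close>

definition GL :: "nat \<Rightarrow> 'a::field mat monoid" where
  "GL n = units_of (ring_mat TYPE('a) n ())"

lemma carrier_GL: "carrier (GL n) = {A \<in> carrier_mat n n. invertible_mat A}"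
  by (auto simp: GL_def units_of_def Units_def ring_mat_def invertible_mat_def inverts_mat_def)
     (metis carrier_matD carrier_matI index_mult_mat(2,3) index_one_mat(2,3))+

lemma mult_GL [simp]: "A \<otimes>\<^bsub>GL n\<^esub> B = A * B"
  and one_GL [simp]: "\<one>\<^bsub>GL n\<^esub> = 1\<^sub>m n"
  by (simp_all add: GL_def units_of_def ring_mat_def)

lemma group_GL: "group (GL n :: 'a::field mat monoid)"
proof -
  interpret ring "ring_mat TYPE('a) n ()" by (rule ring_mat)
  show ?thesis unfolding GL_def by (rule units_group)
qed

text \<open>\<open>\<alpha>\<close> generates the multiplicative group of the field. For \<open>\<alpha> = 0\<close> this is false, since
  \<open>0 powi 1 = 0\<close>.\<close>

definition mult_generator :: "'a::field \<Rightarrow> bool" where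
  "mult_generator \<alpha> \<longleftrightarrow> range (\<lambda>k::int. \<alpha> powi k) = - {0}"

text \<open>Left multiplication by \<open>addrow_mat n 1 y x\<close> adds row \<open>x\<close> to row \<open>y\<close>, and
  \<open>multrow_mat n x \<alpha>\<close> is the diagonal matrix with \<open>\<alpha>\<close> at position \<open>(x, x)\<close> and 1 elsewhere on
  the diagonal.\<close>

lemma addrow_mat_entries:
  "x \<noteq> y \<Longrightarrow> addrow_mat n (1::'a::semiring_1) y x =
     mat n n (\<lambda>(i, j). if i = j \<or> (i = y \<and> j = x) then 1 else 0)"
  by (auto simp: addrow_mat_def)

definition basic_ops :: "'a::{finite,field} \<Rightarrow> nat \<Rightarrow> nat rel \<Rightarrow> 'a mat set" where
  "basic_ops \<alpha> n T =
     {addrow_mat n 1 y x | x y. (x, y) \<in> T} \<union>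
     (if CARD('a) > 2 then {multrow_mat n x \<alpha> | x. x < n} else {})"

definition ops :: "'a::{finite,field} \<Rightarrow> nat \<Rightarrow> nat rel \<Rightarrow> 'a mat set" where
  "ops \<alpha> n T = basic_ops \<alpha> n T \<union> (\<lambda>S. inv\<^bsub>GL n\<^esub> S) ` basic_ops \<alpha> n T"

lemma addrow_mat_in_GL:
  assumes "x \<noteq> y" "x < n" "y < n"
  shows "addrow_mat n (1::'a::field) y x \<in> carrier (GL n)"
proof -
  have "addrow_mat n (1::'a) y x * addrow_mat n (-1) y x = 1\<^sub>m n"
    "addrow_mat n (-1) y x * addrow_mat n (1::'a) y x = 1\<^sub>m n"
    using assms addrow_mat_inv[of y n x 1] addrow_mat_inv[of y n x "-1"] by auto
  then show ?thesis
    unfolding carrier_GL invertible_mat_def inverts_mat_def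
    by (auto intro!: exI[of _ "addrow_mat n (-1) y x"])
qed

lemma multrow_mat_in_GL:
  assumes "x < n" "\<alpha> \<noteq> (0::'a::field)"
  shows "multrow_mat n x \<alpha> \<in> carrier (GL n)"
proof -
  have "multrow_mat n x \<alpha> * multrow_mat n x (inverse \<alpha>) = 1\<^sub>m n"
    "multrow_mat n x (inverse \<alpha>) * multrow_mat n x \<alpha> = 1\<^sub>m n"
    using assms multrow_mat_inv[of x n \<alpha>] multrow_mat_inv[of x n "inverse \<alpha>"] by auto
  then show ?thesis
    unfolding carrier_GL invertible_mat_def inverts_mat_def
    by (auto intro!: exI[of _ "multrow_mat n x (inverse \<alpha>)"])
qed

end

theory Submission
  imports Defs "Jordan_Normal_Form.Determinant"
begin

text \<open>
  Induction on \<open>n\<close> along a chain \<open>K0 < K1 < K2 < GL n\<close> of subgroups: \<open>K0\<close> is \<open>GL (n - 1)\<close>, in \<open>K1\<close>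
  the last corner is free as well, and \<open>K2\<close> is the stabiliser of the line of the last row. Right
  translations are automorphisms of the graph, so all right cosets of a Hamilton connected subgroup
  are Hamilton connected. From \<open>K0\<close> to \<open>K1\<close> the cosets form layers joined by perfect matchings. In the
  other two steps the larger group is \<open>K \<union> K s K\<close> for one of the generators \<open>s\<close>, so any two cosets of
  \<open>K\<close> are joined by edges, and in fact by at least three disjoint ones. This suffices to chain
  Hamilton paths of the cosets together; if both ends lie in one coset, its Hamilton path is cut open
  at an edge whose ends have their \<open>s\<close>-neighbours in two different cosets.

  The base case is \<open>n = 2\<close>, where the diagonal matrices form a torus \<open>C \<times> C\<close> with \<open>C\<close> a cycle of length
  \<open>q - 1\<close>. For even \<open>q\<close> it is Hamilton connected and the same quotient argument applies twice. For odd
  \<open>q\<close> it is bipartite, the colour of a matrix being the quadratic character of its determinant, and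
  only vertices of opposite colours are joined by Hamilton paths. For \<open>q \<ge> 7\<close> the paths then have to
  alternate the colours at which they leave the successive cosets of the torus; inside \<open>K2\<close> the order
  of these cosets is dictated by a geometric progression, and a wrong parity is repaired by visiting
  one coset of \<open>K2\<close> twice. For \<open>q = 3\<close> and \<open>q = 5\<close>, and for \<open>K2\<close> with \<open>n = 3\<close> and \<open>q = 2\<close>, explicit paths
  are checked.
\<close>

text \<open>What shapes the base case is a parity count. Row additions keep the determinant and
  scalings multiply it by \<alpha> or its inverse, so for odd q a Hamilton path of a torus changes
  the colour, while the step to the next torus keeps it. A coset of \<open>K2\<close> consists of q
  tori, an odd number, and so changes the colour too; there are q + 1 such cosets, an even number.
  Running through them one after the other therefore only joins vertices of equal colour in
  different cosets, and each of the three other combinations needs a detour. Exits of a prescribed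
  colour between two cosets of \<open>K2\<close> are indexed, up to a common scalar, by (q - 1)/2
  field elements. Three of them are wanted, which leaves q = 3 and q = 5 to explicit paths. Over the
  field with two elements the obstacle is another one: GL(2, 2) with its two row additions is a
  hexagon, which is not Hamilton connected, so for q = 2 the induction has to begin above it, with
  \<open>K2\<close> in dimension three.\<close>

section \<open>Hamilton paths\<close>

text \<open>A path is kept only as its vertex set and its two ends, so that gluing and cutting
  become statements about disjoint unions. Lists of vertices return only for the explicit paths and
  in \<open>hp_imp_hamilton_path\<close>.\<close>

inductive hp :: "('v \<Rightarrow> 'v \<Rightarrow> bool) \<Rightarrow> 'v set \<Rightarrow> 'v \<Rightarrow> 'v \<Rightarrow> bool" for R where
  hp_single: "hp R {u} u u"
| hp_step: "R u v \<Longrightarrow> u \<notin> S \<Longrightarrow> hp R S v w \<Longrightarrow> hp R (insert u S) u w"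

definition HC :: "('v \<Rightarrow> 'v \<Rightarrow> bool) \<Rightarrow> 'v set \<Rightarrow> bool" where
  "HC R S \<longleftrightarrow> (\<forall>u\<in>S. \<forall>v\<in>S. u \<noteq> v \<longrightarrow> hp R S u v)"

lemma hp_start: "hp R S u v \<Longrightarrow> u \<in> S"
  by (induction rule: hp.induct) auto

lemma hp_end: "hp R S u v \<Longrightarrow> v \<in> S"
  by (induction rule: hp.induct) auto

lemma hp_append:
  assumes "hp R S u v" "R v v'" "hp R S' v' w" "S \<inter> S' = {}"
  shows "hp R (S \<union> S') u w"
  using assms by (induction rule: hp.induct) (auto intro: hp_step)

lemma hp_snoc: "hp R S u v \<Longrightarrow> R v w \<Longrightarrow> w \<notin> S \<Longrightarrow> hp R (insert w S) u w"
  using hp_append[of R S u v w "{w}" w] hp_single[of R w] by auto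

lemma hp_rev:
  assumes "symp R" "hp R S u v"
  shows "hp R S v u"
  using assms(2)
proof (induction rule: hp.induct)
  case (hp_step u v S w)
  then show ?case using assms(1) by (auto intro: hp_snoc dest: sympD)
qed (rule hp_single)

lemma hp_image:
  assumes "hp R S u v" "inj_on f S" "\<And>x y. x \<in> S \<Longrightarrow> y \<in> S \<Longrightarrow> R x y \<Longrightarrow> R' (f x) (f y)"
  shows "hp R' (f ` S) (f u) (f v)"
  using assms
proof (induction rule: hp.induct)
  case (hp_single u)
  then show ?case by (simp add: hp.hp_single)
next
  case (hp_step u v S w)
  have "hp R' (f ` S) (f v) (f w)" using hp_step by (auto simp: inj_on_def)
  moreover have "f u \<notin> f ` S" using hp_step by (auto simp: inj_on_def)
  moreover have "R' (f u) (f v)" using hp_step by (auto intro: hp_start)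
  ultimately show ?case by (simp add: hp.hp_step)
qed

lemma hp_mono:
  assumes "hp R S u v" "\<And>x y. x \<in> S \<Longrightarrow> y \<in> S \<Longrightarrow> R x y \<Longrightarrow> R' x y"
  shows "hp R' S u v"
  using hp_image[OF assms(1), of "\<lambda>x. x" R'] assms(2) by simp

lemma HC_image:
  assumes "HC R S" "inj_on f S" "\<And>x y. x \<in> S \<Longrightarrow> y \<in> S \<Longrightarrow> R x y \<Longrightarrow> R' (f x) (f y)"
  shows "HC R' (f ` S)"
  unfolding HC_def using assms by (auto simp: HC_def intro!: hp_image[where R = R])

lemma HC_mono:
  assumes "HC R S" "\<And>x y. x \<in> S \<Longrightarrow> y \<in> S \<Longrightarrow> R x y \<Longrightarrow> R' x y"
  shows "HC R' S"
  using HC_image[OF assms(1), of "\<lambda>x. x" R'] assms(2) by simp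

text \<open>The cut lies just before \<open>b\<close>, so the second piece, run backwards, ends in
  \<open>b\<close>. In this way a path that has to finish at an inner vertex of a coset can leave
  the coset after the first piece and come back at the end of the second.\<close>

lemma hp_split_pred:
  assumes "hp R S u v" "b \<in> S" "b \<noteq> u"
  obtains S1 S2 w where "hp R S1 u w" "R w b" "hp R S2 b v" "S = S1 \<union> S2" "S1 \<inter> S2 = {}"
proof -
  have "\<exists>S1 S2 w. hp R S1 u w \<and> R w b \<and> hp R S2 b v \<and> S = S1 \<union> S2 \<and> S1 \<inter> S2 = {}"
    using assms
  proof (induction rule: hp.induct)
    case (hp_step u v S w)
    show ?case
    proof (cases "b = v")
      case True
      then show ?thesis using hp_step
        by (intro exI[of _ "{u}"] exI[of _ S] exI[of _ u]) (auto intro: hp_single)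
    next
      case False
      then obtain S1 S2 w' where "hp R S1 v w'" "R w' b" "hp R S2 b w" "S = S1 \<union> S2" "S1 \<inter> S2 = {}"
        using hp_step by auto
      then show ?thesis using hp_step
        by (intro exI[of _ "insert u S1"] exI[of _ S2] exI[of _ w']) (auto intro: hp.hp_step)
    qed
  qed auto
  then show thesis using that by blast
qed

lemma hp_split_first:
  assumes "hp R S u v" "u \<noteq> v"
  obtains y where "R u y" "hp R (S - {u}) y v"
  using assms by (cases rule: hp.cases) auto

text \<open>A function that kept its value along every edge of the path would be constant on
  \<open>S\<close>. With \<open>f x\<close> the coset of \<open>s x\<close>, this finds the edge at
  which a path is opened for a detour.\<close>

lemma hp_split_change:
  assumes "hp R S u v" "x \<in> S" "y \<in> S" "f x \<noteq> f y"
  obtains S1 S2 x' y' where "hp R S1 u x'" "R x' y'" "hp R S2 y' v" "S = S1 \<union> S2" "S1 \<inter> S2 = {}"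
    "f x' \<noteq> f y'"
proof -
  have "\<exists>S1 S2 x' y'. hp R S1 u x' \<and> R x' y' \<and> hp R S2 y' v \<and> S = S1 \<union> S2 \<and> S1 \<inter> S2 = {} \<and> f x' \<noteq> f y'"
    using assms
  proof (induction arbitrary: x y rule: hp.induct)
    case (hp_step u v S w)
    show ?case
    proof (cases "f u = f v")
      case False
      then show ?thesis using hp_step
        by (intro exI[of _ "{u}"] exI[of _ S] exI[of _ u] exI[of _ v]) (auto intro: hp_single)
    next
      case True
      then obtain x1 y1 where "x1 \<in> S" "y1 \<in> S" "f x1 \<noteq> f y1"
        using hp_step hp_start[of R S v w] by (metis insert_iff)
      from hp_step.IH[OF this] obtain S1 S2 x' y' where
        "hp R S1 v x'" "R x' y'" "hp R S2 y' w" "S = S1 \<union> S2" "S1 \<inter> S2 = {}" "f x' \<noteq> f y'"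
        by blast
      then show ?thesis using hp_step
        by (intro exI[of _ "insert u S1"] exI[of _ S2] exI[of _ x'] exI[of _ y']) (auto intro: hp.hp_step)
    qed
  qed auto
  then show thesis using that by blast
qed

text \<open>An interior vertex of \<open>L\<close> on the path has two path neighbours, of which at most one lies
  outside \<open>L\<close>.\<close>

lemma hp_split_inside:
  assumes hp: "hp R S u v" and sym: "symp R"
    and x: "x \<in> S" "x \<in> L" "x \<noteq> u" "x \<noteq> v"
    and out: "\<forall>y\<in>S - L. \<forall>z\<in>S - L. R x y \<longrightarrow> R x z \<longrightarrow> y = z"
  obtains S1 S2 x' y' where "hp R S1 u x'" "R x' y'" "hp R S2 y' v" "S = S1 \<union> S2" "S1 \<inter> S2 = {}"
    "x' \<in> L" "y' \<in> L"
proof -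
  obtain S1 S2 w where s: "hp R S1 u w" "R w x" "hp R S2 x v" "S = S1 \<union> S2" "S1 \<inter> S2 = {}"
    using hp_split_pred[OF hp x(1,3)] by metis
  show thesis
  proof (cases "w \<in> L")
    case True
    then show ?thesis using that s x by blast
  next
    case False
    obtain y where y: "R x y" "hp R (S2 - {x}) y v" using hp_split_first[OF s(3) x(4)] by blast
    have "w \<in> S1" "y \<in> S2" "x \<in> S2" using hp_end[OF s(1)] hp_start[OF y(2)] hp_start[OF s(3)] by auto
    moreover have "R x w" using s(2) sym by (auto dest: sympD)
    ultimately have "y \<in> L" using out False s y by blast
    moreover have "hp R (insert x S1) u x" using hp_snoc[OF s(1,2)] s hp_start[OF s(3)] by blast
    moreover have "S = insert x S1 \<union> (S2 - {x})" "insert x S1 \<inter> (S2 - {x}) = {}"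
      using s \<open>x \<in> S2\<close> by auto
    ultimately show ?thesis using that y x by blast
  qed
qed

lemma hp_imp_hamilton_path:
  assumes "hp R S u v" "\<And>x y. x \<in> S \<Longrightarrow> y \<in> S \<Longrightarrow> R x y \<Longrightarrow> x \<noteq> y \<Longrightarrow> {x, y} \<in> E"
  shows "\<exists>p. hamilton_path S E u v p"
  using assms
proof (induction rule: hp.induct)
  case (hp_single u)
  then show ?case by (intro exI[of _ "[u]"]) (auto simp: hamilton_path_def)
next
  case (hp_step u v S w)
  obtain p where p: "hamilton_path S E v w p" using hp_step by blast
  have "v \<in> S" using hp_step by (auto dest: hp_start)
  then show ?case using p hp_step
    by (intro exI[of _ "u # p"]) (auto simp: hamilton_path_def successively_Cons)
qed

subsection \<open>Quotients\<close>

text \<open>Each of the two conditions excludes at most one element, the second by injectivity of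
  \<open>s\<close>; so three elements suffice. This is the origin of the number 3 in the hypotheses
  on exits.\<close>

lemma obtain_avoiding:
  assumes "\<exists>C \<subseteq> A. card C = 3" "inj_on s A"
  obtains f where "f \<in> A" "f \<noteq> a" "s f \<noteq> b"
proof -
  obtain C where C: "C \<subseteq> A" "card C = 3" using assms by blast
  obtain x y z where "C = {x,y,z}" "x \<noteq> y" "x \<noteq> z" "y \<noteq> z" using C(2) by (auto simp: card_3_iff)
  moreover have "s x \<noteq> s y" "s x \<noteq> s z" "s y \<noteq> s z"
    using calculation C assms(2) by (auto simp: inj_on_def)
  ultimately show thesis using that[of x] that[of y] that[of z] C(1) by force
qed

text \<open>The blocks are the fibres of \<open>\<beta>\<close>, and \<open>s\<close> stands for one
  generator. Since \<open>exits\<close> holds for every ordered pair of blocks, the blocks can be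
  visited in any order.\<close>

locale complete_quotient =
  fixes R :: "'v \<Rightarrow> 'v \<Rightarrow> bool" and V :: "'v set" and \<beta> :: "'v \<Rightarrow> 'b" and s :: "'v \<Rightarrow> 'v"
  assumes sym: "symp R"
    and fin: "finite (\<beta> ` V)"
    and s_inj: "inj_on s V"
    and s_edge: "\<And>x. x \<in> V \<Longrightarrow> R x (s x)"
    and s_closed: "\<And>x. x \<in> V \<Longrightarrow> s x \<in> V"
    and s_leaves: "\<And>x. x \<in> V \<Longrightarrow> \<beta> (s x) \<noteq> \<beta> x"
    and blocks: "\<And>i. i \<in> \<beta> ` V \<Longrightarrow> HC R {x \<in> V. \<beta> x = i}"
    and exits: "\<And>i j. i \<in> \<beta> ` V \<Longrightarrow> j \<in> \<beta> ` V \<Longrightarrow> i \<noteq> j \<Longrightarrow>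
      \<exists>C \<subseteq> {x \<in> V. \<beta> x = i \<and> \<beta> (s x) = j}. card C = 3"
begin

lemma chain:
  assumes "distinct (i # is)" "set (i # is) \<subseteq> \<beta> ` V" "a \<in> V" "\<beta> a = i"
    "b \<in> V" "\<beta> b = last (i # is)" "a \<noteq> b"
  shows "hp R {x \<in> V. \<beta> x \<in> set (i # is)} a b"
  using assms
proof (induction "is" arbitrary: i a)
  case Nil
  then show ?case using blocks[of i] by (auto simp: HC_def)
next
  case (Cons j js)
  have "\<exists>C \<subseteq> {x \<in> V. \<beta> x = i \<and> \<beta> (s x) = j}. card C = 3" using Cons.prems by (intro exits) auto
  moreover have "inj_on s {x \<in> V. \<beta> x = i \<and> \<beta> (s x) = j}"
    using s_inj by (rule inj_on_subset) auto
  \<comment> \<open>\<open>f\<close> must differ from \<open>a\<close> to be the other end of a path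
    of its block; \<open>s f\<close> must differ from \<open>b\<close> in case the next block is the
    last one.\<close>
  ultimately obtain f where f: "f \<in> V" "\<beta> f = i" "\<beta> (s f) = j" "f \<noteq> a" "s f \<noteq> b"
    by (rule obtain_avoiding[where a = a and b = b]) auto
  have 1: "hp R {x \<in> V. \<beta> x = i} a f" using blocks[of i] Cons.prems f by (auto simp: HC_def)
  have 2: "hp R {x \<in> V. \<beta> x \<in> set (j # js)} (s f) b"
    using Cons.prems f by (intro Cons.IH) (auto intro: s_closed)
  have "hp R ({x \<in> V. \<beta> x = i} \<union> {x \<in> V. \<beta> x \<in> set (j # js)}) a b"
    using Cons.prems(1) by (intro hp_append[OF 1 _ 2] s_edge f) auto
  moreover have "{x \<in> V. \<beta> x = i} \<union> {x \<in> V. \<beta> x \<in> set (j # js)} = {x \<in> V. \<beta> x \<in> set (i # j # js)}"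
    by auto
  ultimately show ?case by simp
qed

lemma chain_set:
  assumes "I \<subseteq> \<beta> ` V" "a \<in> V" "\<beta> a \<in> I" "b \<in> V" "\<beta> b \<in> I" "\<beta> a \<noteq> \<beta> b"
  shows "hp R {x \<in> V. \<beta> x \<in> I} a b"
proof -
  have "finite (I - {\<beta> a, \<beta> b})" using assms(1) fin by (blast intro: finite_subset)
  then obtain xs where xs: "distinct xs" "set xs = I - {\<beta> a, \<beta> b}"
    using finite_distinct_list by metis
  have "hp R {x \<in> V. \<beta> x \<in> set (\<beta> a # xs @ [\<beta> b])} a b"
    using assms xs by (intro chain) auto
  moreover have "set (\<beta> a # xs @ [\<beta> b]) = I" using xs assms by auto
  ultimately show ?thesis by (simp only:)
qed

theorem HC:
  assumes "\<exists>C \<subseteq> \<beta> ` V. card C = 3"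
  shows "HC R V"
  unfolding HC_def
proof (intro ballI impI)
  fix a b assume ab: "a \<in> V" "b \<in> V" "a \<noteq> b"
  show "hp R V a b"
  proof (cases "\<beta> a = \<beta> b")
    case False
    then have "hp R {x \<in> V. \<beta> x \<in> \<beta> ` V} a b" using ab by (intro chain_set) auto
    moreover have "{x \<in> V. \<beta> x \<in> \<beta> ` V} = V" by auto
    ultimately show ?thesis by (simp only:)
  next
    case True
    \<comment> \<open>Two blocks besides that of \<open>a\<close>: they show that the block reached
      by \<open>s\<close> is not constant on the block of \<open>a\<close>.\<close>
    obtain j k where jk: "j \<in> \<beta> ` V" "k \<in> \<beta> ` V" "j \<noteq> k" "j \<noteq> \<beta> a" "k \<noteq> \<beta> a"
    proof -
      obtain x y z where "{x,y,z} \<subseteq> \<beta> ` V" "x \<noteq> y" "x \<noteq> z" "y \<noteq> z"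
        using assms by (auto simp: card_3_iff)
      then show thesis using that[of x y] that[of x z] that[of y z] by (metis insert_subset)
    qed
    have "\<exists>C \<subseteq> {x \<in> V. \<beta> x = \<beta> a \<and> \<beta> (s x) = j'}. card C = 3" if "j' \<in> {j,k}" for j'
      using jk ab that by (intro exits) auto
    then have "\<exists>x. x \<in> V \<and> \<beta> x = \<beta> a \<and> \<beta> (s x) = j'" if "j' \<in> {j,k}" for j'
      using that by (fastforce simp: card_3_iff)
    then obtain x y where xy: "x \<in> V" "\<beta> x = \<beta> a" "\<beta> (s x) = j" "y \<in> V" "\<beta> y = \<beta> a" "\<beta> (s y) = k"
      by blast
    have "hp R {x \<in> V. \<beta> x = \<beta> a} a b" using blocks[of "\<beta> a"] ab True by (auto simp: HC_def)
    then obtain S1 S2 x' y' where s: "hp R S1 a x'" "R x' y'" "hp R S2 y' b"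
      "{x \<in> V. \<beta> x = \<beta> a} = S1 \<union> S2" "S1 \<inter> S2 = {}" "\<beta> (s x') \<noteq> \<beta> (s y')"
      using hp_split_change[where f = "\<lambda>x. \<beta> (s x)" and x = x and y = y] xy jk by force
    have x'y': "x' \<in> V" "\<beta> x' = \<beta> a" "y' \<in> V" "\<beta> y' = \<beta> a"
      using hp_end[OF s(1)] hp_start[OF s(3)] s(4) by auto
    \<comment> \<open>All the other blocks, entered at \<open>s x'\<close> and left at
      \<open>s y'\<close>; these two vertices lie in different blocks, as \<open>chain_set\<close>
      demands.\<close>
    define W where "W = {x \<in> V. \<beta> x \<in> \<beta> ` V - {\<beta> a}}"
    have W: "hp R W (s x') (s y')" unfolding W_def
      using x'y' s(6) s_leaves[of x'] s_leaves[of y'] s_closed by (intro chain_set) auto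
    have V: "V = S1 \<union> (W \<union> S2)" "W \<inter> S2 = {}" "S1 \<inter> (W \<union> S2) = {}"
      using s(4,5) by (auto simp: W_def)
    have "hp R (W \<union> S2) (s x') b"
      using s_edge[OF x'y'(3)] sym V by (intro hp_append[OF W _ s(3)]) (auto dest: sympD)
    then have "hp R (S1 \<union> (W \<union> S2)) a b"
      using s_edge[OF x'y'(1)] V by (intro hp_append[OF s(1)])
    then show ?thesis using V by simp
  qed
qed

end

text \<open>Induction on the number of layers. A path in the lower layers makes a detour through the
  new layer at one of its edges inside the layer just below; a path in the new layer makes one
  through all the lower layers. In \<open>only\<close> the upper layer \<open>j\<close> is never the
  last one, because in the applications multiplication by \<alpha> leads from the last layer back to
  the first.\<close>

lemma HC_layers:
  fixes L :: "nat \<Rightarrow> 'v set"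
  assumes sym: "symp R"
    and HC: "\<And>i. i < m \<Longrightarrow> HC R (L i)"
    and disj: "\<And>i j. i < m \<Longrightarrow> j < m \<Longrightarrow> i \<noteq> j \<Longrightarrow> L i \<inter> L j = {}"
    and bij: "\<And>i. Suc i < m \<Longrightarrow> bij_betw s (L i) (L (Suc i))"
    and edge: "\<And>i x. Suc i < m \<Longrightarrow> x \<in> L i \<Longrightarrow> R x (s x)"
    and only: "\<And>i j x y. i < j \<Longrightarrow> j < m \<Longrightarrow> x \<in> L i \<Longrightarrow> y \<in> L j \<Longrightarrow> Suc j < m \<Longrightarrow> R x y \<Longrightarrow> y = s x \<and> j = Suc i"
    and card: "\<And>i. i < m \<Longrightarrow> card (L i) \<ge> 3"
    and m: "m > 0"
  shows "HC R (\<Union>i<m. L i)"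
proof -
  have "k < m \<Longrightarrow> HC R (\<Union>i<Suc k. L i)" for k
  proof (induction k)
    case 0
    then show ?case using HC[of 0] by (simp add: lessThan_Suc)
  next
    case (Suc k)
    let ?U = "\<Union>i<Suc k. L i"
    let ?W = "L (Suc k)"
    have U: "HC R ?U" using Suc by simp
    have un: "(\<Union>i<Suc (Suc k). L i) = ?U \<union> ?W" by (auto simp: lessThan_Suc)
    have dis: "?U \<inter> ?W = {}"
    proof -
      have "L i \<inter> L (Suc k) = {}" if "i < Suc k" for i using disj[of i "Suc k"] that Suc.prems by auto
      then show ?thesis by blast
    qed
    have W: "HC R ?W" using HC Suc.prems by blast
    have b: "bij_betw s (L k) ?W" using bij Suc.prems by blast
    have sW: "s x \<in> ?W" if "x \<in> L k" for x using b that by (auto simp: bij_betw_def)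
    have sne: "s x \<noteq> s y" if "x \<in> L k" "y \<in> L k" "x \<noteq> y" for x y
      using b that by (auto simp: bij_betw_def inj_on_def)
    have e: "R x (s x)" "R (s x) x" if "x \<in> L k" for x
      using edge[OF Suc.prems that] sym by (auto dest: sympD)
    have cross: "hp R (?U \<union> ?W) u v" if uv: "u \<in> ?U" "v \<in> ?W" for u v
    proof -
      have c: "card (L k) \<ge> 3" using card Suc.prems by auto
      have "inj_on s (L k)" using b by (auto simp: bij_betw_def)
      moreover have "\<exists>C \<subseteq> L k. card C = 3" using c by (metis obtain_subset_with_card_n)
      ultimately obtain f where f: "f \<in> L k" "f \<noteq> u" "s f \<noteq> v"
        using obtain_avoiding[of "L k" s u v] by metis
      have "hp R ?U u f" using U uv f unfolding HC_def by (metis UN_iff lessThan_iff lessI)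
      moreover have "hp R ?W (s f) v" using W uv f sW unfolding HC_def by blast
      ultimately show ?thesis using hp_append dis e f by metis
    qed
    have bottom: "hp R (?U \<union> ?W) u v" if uv: "u \<in> ?U" "v \<in> ?U" "u \<noteq> v" for u v
    proof -
      have huv: "hp R ?U u v" using U uv unfolding HC_def by blast
      \<comment> \<open>At an inner vertex of the path that lies in \<open>L k\<close>, the only
        possible neighbour in the layers below is its \<open>s\<close>-predecessor; hence one of the
        two path edges at it stays inside \<open>L k\<close>.\<close>
      obtain x where x: "x \<in> L k" "x \<noteq> u" "x \<noteq> v"
      proof -
        have "\<exists>C \<subseteq> L k. card C = 3" using card[of k] Suc.prems by (metis Suc_lessD obtain_subset_with_card_n)
        then obtain f where "f \<in> L k" "f \<noteq> u" "f \<noteq> v" using obtain_avoiding[of "L k" "\<lambda>x. x" u v] by auto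
        then show thesis using that by blast
      qed
      have out1: "y = z" if yz: "y \<in> ?U - L k" "z \<in> ?U - L k" "R x y" "R x z" for y z
      proof -
        have *: "x = s y \<and> y \<in> L (k - 1) \<and> k > 0" if y: "y \<in> ?U - L k" "R x y" for y
        proof -
          obtain i where i: "i < Suc k" "y \<in> L i" using y by blast
          then have "i < k" using y by (metis Diff_iff less_antisym)
          moreover have "R y x" using y sym by (auto dest: sympD)
          ultimately have "x = s y \<and> k = Suc i" using only[of i k y x] i x Suc.prems by auto
          then show ?thesis using i by auto
        qed
        have k: "k > 0" using *[OF yz(1,3)] by blast
        then have "inj_on s (L (k - 1))" using bij[of "k - 1"] Suc.prems by (auto simp: bij_betw_def)
        then show ?thesis using *[OF yz(1,3)] *[OF yz(2,4)] by (auto simp: inj_on_def)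
      qed
      have out: "\<forall>y\<in>?U - L k. \<forall>z\<in>?U - L k. R x y \<longrightarrow> R x z \<longrightarrow> y = z" using out1 by blast
      have xU: "x \<in> ?U" using x(1) by blast
      obtain S1 S2 x' y' where s: "hp R S1 u x'" "R x' y'" "hp R S2 y' v" "?U = S1 \<union> S2" "S1 \<inter> S2 = {}"
        "x' \<in> L k" "y' \<in> L k"
        by (rule hp_split_inside[OF huv sym xU x(1) x(2) x(3) out])
      have "x' \<noteq> y'" using hp_end[OF s(1)] hp_start[OF s(3)] s by blast
      then have w: "hp R ?W (s x') (s y')" using W sW sne s unfolding HC_def by blast
      have "hp R (?W \<union> S2) (s x') v" using dis s e by (intro hp_append[OF w _ s(3)]) auto
      then have "hp R (S1 \<union> (?W \<union> S2)) u v" using dis s e by (intro hp_append[OF s(1)]) auto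
      then show ?thesis using s by (simp add: Un_ac)
    qed
    have top: "hp R (?U \<union> ?W) u v" if uv: "u \<in> ?W" "v \<in> ?W" "u \<noteq> v" for u v
    proof -
      have "hp R ?W u v" using W uv unfolding HC_def by blast
      \<comment> \<open>\<open>f\<close> is the identity here: any edge with distinct ends can be
        opened, since the matching from \<open>L k\<close> is onto the new layer.\<close>
      then obtain S1 S2 x' y' where s: "hp R S1 u x'" "R x' y'" "hp R S2 y' v" "?W = S1 \<union> S2" "S1 \<inter> S2 = {}"
        "x' \<noteq> y'" using hp_split_change[where f = "\<lambda>x. x" and x = u and y = v] uv by metis
      have "x' \<in> ?W" "y' \<in> ?W" using hp_end[OF s(1)] hp_start[OF s(3)] s(4) by auto
      then obtain x y where xy: "x \<in> L k" "y \<in> L k" "x' = s x" "y' = s y"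
        using b unfolding bij_betw_def by (metis imageE)
      then have "x \<noteq> y" using s by auto
      then have w: "hp R ?U x y" using U xy unfolding HC_def by (metis UN_iff lessThan_iff lessI)
      have "hp R (?U \<union> S2) x v" using dis s e xy by (intro hp_append[OF w _ s(3)]) auto
      then have "hp R (S1 \<union> (?U \<union> S2)) u v" using dis s e xy by (intro hp_append[OF s(1)]) auto
      then show ?thesis using s by (simp add: Un_ac)
    qed
    show ?case unfolding un HC_def
    proof (intro ballI impI)
      fix u v assume uv: "u \<in> ?U \<union> ?W" "v \<in> ?U \<union> ?W" "u \<noteq> v"
      show "hp R (?U \<union> ?W) u v"
      proof (cases "u \<in> ?U")
        case True
        show ?thesis
        proof (cases "v \<in> ?U")
          case False
          then have "v \<in> ?W" using uv(2) by (simp only: Un_iff) simp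
          then show ?thesis by (rule cross[OF True])
        qed (rule bottom[OF True _ uv(3)])
      next
        case False
        then have u: "u \<in> ?W" using uv(1) by (simp only: Un_iff) simp
        show ?thesis
        proof (cases "v \<in> ?U")
          case True
          show ?thesis by (rule hp_rev[OF sym cross[OF True u]])
        next
          case False
          then have "v \<in> ?W" using uv(2) by (simp only: Un_iff) simp
          then show ?thesis by (rule top[OF u _ uv(3)])
        qed
      qed
    qed
  qed
  from this[of "m - 1"] show ?thesis using m by simp
qed

section \<open>Cylinders\<close>

text \<open>The product of a cycle of length \<open>m\<close> and a path with \<open>k\<close>
  vertices. The cyclic index is an integer with period \<open>m\<close>, so that rotations and
  reflections are plain substitutions and equality of vertices becomes a divisibility.\<close>

definition cylinder :: "nat \<Rightarrow> nat \<Rightarrow> (int \<Rightarrow> nat \<Rightarrow> 'v) \<Rightarrow> bool" where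
  "cylinder m k X \<longleftrightarrow> (\<forall>i j. X (i + int m) j = X i j) \<and>
     (\<forall>i i' j j'. j < k \<longrightarrow> j' < k \<longrightarrow> X i j = X i' j' \<longrightarrow> int m dvd i - i' \<and> j = j')"

definition cyl_edge :: "nat \<Rightarrow> (int \<Rightarrow> nat \<Rightarrow> 'v) \<Rightarrow> 'v \<Rightarrow> 'v \<Rightarrow> bool" where
  "cyl_edge k X x y \<longleftrightarrow> (\<exists>i j. j < k \<and>
     (x = X i j \<and> y = X (i + 1) j \<or> y = X i j \<and> x = X (i + 1) j \<or>
      Suc j < k \<and> (x = X i j \<and> y = X i (Suc j) \<or> y = X i j \<and> x = X i (Suc j))))"

definition cyl_verts :: "nat \<Rightarrow> (int \<Rightarrow> nat \<Rightarrow> 'v) \<Rightarrow> 'v set" where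
  "cyl_verts k X = {X i j | i j. j < k}"

lemma symp_cyl_edge: "symp (cyl_edge k X)"
  unfolding symp_def cyl_edge_def by blast

lemma cyl_edge_horizontal: "j < k \<Longrightarrow> cyl_edge k X (X i j) (X (i + 1) j)"
  unfolding cyl_edge_def by blast

lemma cyl_edge_vertical: "Suc j < k \<Longrightarrow> cyl_edge k X (X i j) (X i (Suc j))"
  unfolding cyl_edge_def using Suc_lessD by blast

lemma cylinder_periodic: "cylinder m k X \<Longrightarrow> X (i + int m) j = X i j"
  by (auto simp: cylinder_def)

lemma cylinder_period_mult:
  assumes "cylinder m k X"
  shows "X (i + int m * c) j = X i j"
proof -
  have *: "X (i + int m * int n) j = X i j" for n i
  proof (induction n)
    case (Suc n)
    have "X (i + int m * int (Suc n)) j = X ((i + int m * int n) + int m) j" by (simp add: algebra_simps)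
    then show ?case using Suc cylinder_periodic[OF assms] by metis
  qed simp
  show ?thesis
  proof (cases "c \<ge> 0")
    case True
    then show ?thesis using *[of i "nat c"] by simp
  next
    case False
    then show ?thesis using *[of "i + int m * c" "nat (- c)"] by (simp add: algebra_simps)
  qed
qed

lemma cylinder_eq_iff:
  assumes "cylinder m k X" "j < k" "j' < k"
  shows "X i j = X i' j' \<longleftrightarrow> int m dvd i - i' \<and> j = j'"
proof
  assume "int m dvd i - i' \<and> j = j'"
  then obtain c where "i = i' + int m * c" "j = j'" by (auto simp: dvd_def algebra_simps)
  then show "X i j = X i' j'" using cylinder_period_mult[OF assms(1)] by simp
qed (use assms in \<open>auto simp: cylinder_def\<close>)

lemma cylinder_shift:
  assumes "cylinder m k X"
  shows "cylinder m k (\<lambda>i j. X (c + i) j)"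
    "cyl_edge k (\<lambda>i j. X (c + i) j) x y \<Longrightarrow> cyl_edge k X x y"
    "cyl_verts k (\<lambda>i j. X (c + i) j) = cyl_verts k X"
proof -
  show "cylinder m k (\<lambda>i j. X (c + i) j)"
    unfolding cylinder_def using cylinder_eq_iff[OF assms] cylinder_periodic[OF assms]
    by (auto simp: add.assoc[symmetric])
  show "cyl_edge k (\<lambda>i j. X (c + i) j) x y \<Longrightarrow> cyl_edge k X x y"
    unfolding cyl_edge_def by (metis add.assoc)
  show "cyl_verts k (\<lambda>i j. X (c + i) j) = cyl_verts k X"
    unfolding cyl_verts_def by (auto, metis add_diff_cancel_left' diff_add_cancel add.commute)
qed

lemma cylinder_reflect:
  assumes "cylinder m k X"
  shows "cylinder m k (\<lambda>i j. X (c - i) j)"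
    "cyl_edge k (\<lambda>i j. X (c - i) j) x y \<Longrightarrow> cyl_edge k X x y"
    "cyl_verts k (\<lambda>i j. X (c - i) j) = cyl_verts k X"
proof -
  have 1: "X (c - (i + int m)) j = X (c - i) j" for i j
    using cylinder_period_mult[OF assms, of "c - i" "-1" j] by (simp add: algebra_simps)
  show "cylinder m k (\<lambda>i j. X (c - i) j)"
    unfolding cylinder_def using cylinder_eq_iff[OF assms] 1
    by (auto simp: dvd_diff_commute)
  show "cyl_edge k (\<lambda>i j. X (c - i) j) x y \<Longrightarrow> cyl_edge k X x y"
  proof -
    assume "cyl_edge k (\<lambda>i j. X (c - i) j) x y"
    moreover have "X (c - i) j = X (c - (i + 1) + 1) j" for i j by simp
    ultimately show ?thesis unfolding cyl_edge_def by metis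
  qed
  show "cyl_verts k (\<lambda>i j. X (c - i) j) = cyl_verts k X"
    unfolding cyl_verts_def by (auto, metis diff_diff_eq2 add_diff_cancel_left')
qed

lemma cylinder_flip:
  assumes "cylinder m k X"
  shows "cylinder m k (\<lambda>i j. X i (k - 1 - j))"
    "cyl_edge k (\<lambda>i j. X i (k - 1 - j)) x y \<Longrightarrow> cyl_edge k X x y"
    "cyl_verts k (\<lambda>i j. X i (k - 1 - j)) = cyl_verts k X"
proof -
  show "cylinder m k (\<lambda>i j. X i (k - 1 - j))"
    unfolding cylinder_def using cylinder_eq_iff[OF assms] cylinder_periodic[OF assms] by auto
  show "cyl_edge k (\<lambda>i j. X i (k - 1 - j)) x y \<Longrightarrow> cyl_edge k X x y"
  proof -
    assume "cyl_edge k (\<lambda>i j. X i (k - 1 - j)) x y"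
    then obtain i j where j: "j < k" and "x = X i (k - 1 - j) \<and> y = X (i + 1) (k - 1 - j) \<or>
      y = X i (k - 1 - j) \<and> x = X (i + 1) (k - 1 - j) \<or>
      Suc j < k \<and> (x = X i (k - 1 - j) \<and> y = X i (k - 1 - Suc j) \<or> y = X i (k - 1 - j) \<and> x = X i (k - 1 - Suc j))"
      unfolding cyl_edge_def by blast
    moreover have "k - 1 - j = Suc (k - 1 - Suc j)" if "Suc j < k" using that by simp
    moreover have "k - 1 - j < k" "k - 1 - Suc j < k" using j by auto
    ultimately show ?thesis
      using cyl_edge_horizontal[of "k - 1 - j" k X i] cyl_edge_vertical[of "k - 1 - Suc j" k X i]
        symp_cyl_edge[of k X] by (metis sympD)
  qed
  show "cyl_verts k (\<lambda>i j. X i (k - 1 - j)) = cyl_verts k X"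
  proof -
    have "X i j \<in> cyl_verts k (\<lambda>i j. X i (k - 1 - j))" if "j < k" for i j
      unfolding cyl_verts_def using that
      by (intro CollectI exI[of _ i] exI[of _ "k - 1 - j"] conjI) auto
    moreover have "X i (k - 1 - j) \<in> cyl_verts k X" if "j < k" for i j
      unfolding cyl_verts_def using that
      by (intro CollectI exI[of _ i] exI[of _ "k - 1 - j"] conjI) auto
    ultimately show ?thesis unfolding cyl_verts_def by blast
  qed
qed

subsection \<open>Two layers\<close>

text \<open>Two layers with the columns cut open to 1, ..., \<open>m\<close>. The closing edge is
  listed only from column \<open>m\<close> to column 1, the direction in which
  \<open>ladder_path\<close> uses it.\<close>

definition ladder_edge :: "nat \<Rightarrow> int \<times> nat \<Rightarrow> int \<times> nat \<Rightarrow> bool" where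
  "ladder_edge m p q \<longleftrightarrow> snd p = snd q \<and> (fst q = fst p + 1 \<or> fst p = fst q + 1 \<or> fst p = int m \<and> fst q = 1)
     \<or> fst p = fst q \<and> (snd q = 1 - snd p)"

text \<open>A U-turn: along the bottom layer to column \<open>d\<close> and back along the top
  layer.\<close>

lemma ladder_turn:
  "hp (ladder_edge m) ({d..d + int n} \<times> {..<2}) (d + int n, 0) (d + int n, 1)"
proof (induction n)
  case 0
  have "{d..d} \<times> {..<2::nat} = {(d,0),(d,1)}" by (auto simp: less_2_cases_iff)
  moreover have "hp (ladder_edge m) (insert (d,0) {(d,1)}) (d,0) (d,1)"
    by (rule hp_step) (auto simp: ladder_edge_def intro: hp_single)
  ultimately show ?case by simp
next
  case (Suc n)
  let ?S = "{d..d + int n} \<times> {..<2::nat}"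
  let ?e = "d + int (Suc n)"
  have "hp (ladder_edge m) (insert (?e, 1) ?S) (d + int n, 0) (?e, 1)"
    by (rule hp_snoc[OF Suc]) (auto simp: ladder_edge_def)
  then have "hp (ladder_edge m) (insert (?e, 0) (insert (?e, 1) ?S)) (?e, 0) (?e, 1)"
    by (rule hp_step[rotated 2]) (auto simp: ladder_edge_def)
  moreover have "insert (?e, 0) (insert (?e, 1) ?S) = {d..d + int (Suc n)} \<times> {..<2}"
    by (auto simp: less_2_cases_iff)
  ultimately show ?case by simp
qed

text \<open>Column after column, each traversed vertically, so that the layer of the end alternates
  with the number of columns.\<close>

lemma ladder_zigzag:
  "hp (ladder_edge m) ({1..1 + int n} \<times> {..<2}) (1, 1) (1 + int n, n mod 2)"
proof (induction n)
  case 0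
  have "{1..1} \<times> {..<2::nat} = {(1::int,0),(1,1)}" by (auto simp: less_2_cases_iff)
  moreover have "hp (ladder_edge m) (insert (1,1) {(1,0)}) (1,1) (1,0)"
    by (rule hp_step) (auto simp: ladder_edge_def intro: hp_single)
  ultimately show ?case by (simp add: insert_commute)
next
  case (Suc n)
  let ?S = "{1..1 + int n} \<times> {..<2::nat}"
  let ?e = "1 + int (Suc n)"
  have "hp (ladder_edge m) (insert (?e, n mod 2) ?S) (1, 1) (?e, n mod 2)"
    by (rule hp_snoc[OF Suc]) (auto simp: ladder_edge_def)
  then have "hp (ladder_edge m) (insert (?e, Suc n mod 2) (insert (?e, n mod 2) ?S)) (1, 1) (?e, Suc n mod 2)"
    by (rule hp_snoc) (auto simp: ladder_edge_def, presburger+)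
  moreover have "insert (?e, Suc n mod 2) (insert (?e, n mod 2) ?S) = {1..1 + int (Suc n)} \<times> {..<2}"
  proof -
    have "{..<2::nat} = {n mod 2, Suc n mod 2}" by (auto simp: less_2_cases_iff) presburger+
    moreover have "{1..1 + int (Suc n)} = insert ?e {1..1 + int n}" by auto
    ultimately show ?thesis by auto
  qed
  ultimately show ?case by simp
qed

text \<open>Column \<open>m\<close> plays the part of column 0. A U-turn through the columns n + 1,
  ..., m returns to column \<open>m\<close>, the closing edge leads to column 1, and a zigzag fills
  the rest; the parity of its length decides the layer of the end.\<close>

lemma ladder_path:
  assumes "n < m"
  shows "hp (ladder_edge m) ({1..int m} \<times> {..<2}) (int m, 0) (int (if n = 0 then m else n), if odd n then 0 else 1)"
proof (cases "n = 0")
  case True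
  then show ?thesis using ladder_turn[of m 1 "m - 1"] assms by (simp add: of_nat_diff)
next
  case False
  have 1: "hp (ladder_edge m) ({int n + 1..int m} \<times> {..<2}) (int m, 0) (int m, 1)"
    using ladder_turn[of m "int n + 1" "m - n - 1"] assms by (simp add: of_nat_diff)
  have 2: "hp (ladder_edge m) ({1..int n} \<times> {..<2}) (1, 1) (int n, (n - 1) mod 2)"
    using ladder_zigzag[of m "n - 1"] False by (simp add: of_nat_diff)
  have "hp (ladder_edge m) ({int n + 1..int m} \<times> {..<2} \<union> {1..int n} \<times> {..<2}) (int m, 0) (int n, (n - 1) mod 2)"
    by (rule hp_append[OF 1 _ 2]) (auto simp: ladder_edge_def)
  moreover have "{int n + 1..int m} \<times> {..<2} \<union> {1..int n} \<times> {..<2::nat} = {1..int m} \<times> {..<2}"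
    using assms by auto
  moreover have "(n - 1) mod 2 = (if odd n then 0 else 1)" using False by presburger
  ultimately show ?thesis using False by simp
qed

lemma cyl2_from_origin:
  assumes X: "cylinder m 2 X" and n: "n < m"
  shows "hp (cyl_edge 2 X) (cyl_verts 2 X) (X 0 0) (X (int n) (if odd n then 0 else 1))"
proof -
  define f where "f = (\<lambda>(i, j). X i j)"
  have "inj_on f ({1..int m} \<times> {..<2})"
  proof (rule inj_onI)
    fix p q assume pq: "p \<in> {1..int m} \<times> {..<2::nat}" "q \<in> {1..int m} \<times> {..<2::nat}" "f p = f q"
    obtain i j i' j' where p: "p = (i,j)" "q = (i',j')" by fastforce
    have *: "i \<in> {1..int m}" "i' \<in> {1..int m}" "j \<in> {..<2}" "j' \<in> {..<2}" "f (i,j) = f (i',j')"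
      using pq p by auto
    then have "int m dvd i - i'" "j = j'" using cylinder_eq_iff[OF X, of j j' i i'] by (auto simp: f_def)
    moreover have "\<bar>i - i'\<bar> < int m" using * by auto
    ultimately show "p = q" using dvd_imp_le_int[of "i - i'" "int m"] p by auto
  qed
  moreover have "cyl_edge 2 X (f p) (f q)"
    if pq: "p \<in> {1..int m} \<times> {..<2}" "q \<in> {1..int m} \<times> {..<2}" "ladder_edge m p q" for p q
  proof -
    obtain i j i' j' where p: "p = (i,j)" "q = (i',j')" by fastforce
    have j: "j < 2" "j' < 2" using pq p by auto
    have "X (int m) j = X 0 j" using cylinder_periodic[OF X, of 0 j] by simp
    then have w: "cyl_edge 2 X (X (int m) j) (X 1 j)" using cyl_edge_horizontal[of j 2 X 0] j by simp
    have v: "cyl_edge 2 X (X i 0) (X i 1)" for i using cyl_edge_vertical[of 0 2 X i] by simp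
    consider "i' = i + 1" "j' = j" | "i = i' + 1" "j' = j" | "i = int m" "i' = 1" "j' = j" | "i = i'" "j' = 1 - j"
      using pq(3) p by (auto simp: ladder_edge_def)
    then show ?thesis
    proof cases
      case 1
      then show ?thesis using cyl_edge_horizontal[OF j(1), of X i] p by (simp add: f_def)
    next
      case 2
      then show ?thesis using sympD[OF symp_cyl_edge cyl_edge_horizontal[OF j(1), of X i']] p by (simp add: f_def)
    next
      case 3
      then show ?thesis using w p by (simp add: f_def)
    next
      case 4
      then show ?thesis using v[of i] sympD[OF symp_cyl_edge v[of i]] p j(1)
        by (auto simp: f_def less_2_cases_iff)
    qed
  qed
  ultimately have "hp (cyl_edge 2 X) (f ` ({1..int m} \<times> {..<2})) (f (int m, 0))
      (f (int (if n = 0 then m else n), if odd n then 0 else 1))"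
    by (rule hp_image[OF ladder_path[OF n]])
  moreover have "f ` ({1..int m} \<times> {..<2}) = cyl_verts 2 X"
  proof -
    have "X i j \<in> f ` ({1..int m} \<times> {..<2})" if "j < 2" for i j
    proof -
      define i' where "i' = 1 + (i - 1) mod int m"
      have "0 \<le> (i - 1) mod int m" "(i - 1) mod int m < int m" using n by auto
      then have "i' \<in> {1..int m}" by (simp add: i'_def)
      moreover have "i - i' = (i - 1) - (i - 1) mod int m" by (simp add: i'_def)
      then have "int m dvd i - i'" by (simp only: dvd_minus_mod)
      then have "f (i', j) = X i j" using cylinder_eq_iff[OF X that that, of i i'] by (simp add: f_def)
      ultimately show ?thesis using that by (intro rev_image_eqI[of "(i', j)"]) auto
    qed
    then have "cyl_verts 2 X \<subseteq> f ` ({1..int m} \<times> {..<2})" unfolding cyl_verts_def by blast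
    moreover have "f ` ({1..int m} \<times> {..<2}) \<subseteq> cyl_verts 2 X" unfolding cyl_verts_def f_def by fastforce
    ultimately show ?thesis by blast
  qed
  moreover have "X (int m) j = X 0 j" for j using cylinder_periodic[OF X, of 0 j] by simp
  then have "f (int m, 0) = X 0 0" "f (int (if n = 0 then m else n), j) = X (int n) j" for j
    unfolding f_def by (cases "n = 0", simp_all)
  ultimately show ?thesis by (simp only:)
qed

text \<open>Going round in one direction reaches the targets for which \<open>n + j\<close> is odd,
  \<open>n\<close> being the number of columns to the target. If this sum is even, then
  \<open>m\<close> is odd, and in the other direction \<open>m - n + j\<close> is odd.\<close>

lemma cyl2_from_bottom:
  assumes X: "cylinder m 2 X" and j: "j < 2" and m: "m > 0"
    and par: "odd m \<or> odd (i + i' + int j)" and ne: "X i 0 \<noteq> X i' j"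
  shows "hp (cyl_edge 2 X) (cyl_verts 2 X) (X i 0) (X i' j)"
proof -
  define n where "n = nat ((i' - i) mod int m)"
  have n: "int n = (i' - i) mod int m" "n < m" using m by (auto simp: n_def nat_less_iff)
  have "i' - (i + int n) = (i' - i) - (i' - i) mod int m" using n(1) by simp
  then have dn: "int m dvd i' - (i + int n)" by (simp only: dvd_minus_mod)
  then have e: "X i' j = X (i + int n) j" using cylinder_eq_iff[OF X j j] by blast
  show ?thesis
  proof (cases "odd (n + j)")
    case True
    have "hp (cyl_edge 2 (\<lambda>t s. X (i + t) s)) (cyl_verts 2 (\<lambda>t s. X (i + t) s))
        (X (i + 0) 0) (X (i + int n) (if odd n then 0 else 1))"
      by (rule cyl2_from_origin[OF cylinder_shift(1)[OF X] n(2)])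
    moreover have "(if odd n then 0 else 1) = j" using True j by (auto simp: less_2_cases_iff)
    ultimately have "hp (cyl_edge 2 (\<lambda>t s. X (i + t) s)) (cyl_verts 2 X) (X i 0) (X i' j)"
      using e cylinder_shift(3)[OF X, of i] by simp
    then show ?thesis using cylinder_shift(2)[OF X] by (rule hp_mono)
  next
    case False
    have "odd m"
    proof (rule ccontr)
      assume "\<not> odd m"
      moreover have "even (i' - (i + int n))" if "even m"
        using dn that by (meson dvd_trans even_of_nat)
      ultimately show False using par False by (auto simp: even_of_nat[symmetric])
    qed
    have n0: "n \<noteq> 0"
    proof
      assume "n = 0"
      then have "j = 0" using False j by (auto simp: less_2_cases_iff)
      then show False using \<open>n = 0\<close> e ne by simp
    qed
    define n2 where "n2 = m - n"
    have n2: "n2 < m" "odd (n2 + j)" "int n2 = int m - int n"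
      using n0 n(2) False \<open>odd m\<close> by (auto simp: n2_def of_nat_diff)
    have e2: "X i' j = X (i - int n2) j"
      using e cylinder_periodic[OF X, of "i - int n2" j] n2(3) by simp
    have "hp (cyl_edge 2 (\<lambda>t s. X (i - t) s)) (cyl_verts 2 (\<lambda>t s. X (i - t) s))
        (X (i - 0) 0) (X (i - int n2) (if odd n2 then 0 else 1))"
      by (rule cyl2_from_origin[OF cylinder_reflect(1)[OF X] n2(1)])
    moreover have "(if odd n2 then 0 else 1) = j" using n2(2) j by (auto simp: less_2_cases_iff)
    ultimately have "hp (cyl_edge 2 (\<lambda>t s. X (i - t) s)) (cyl_verts 2 X) (X i 0) (X i' j)"
      using e2 cylinder_reflect(3)[OF X, of i] by simp
    then show ?thesis using cylinder_reflect(2)[OF X] by (rule hp_mono)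
  qed
qed

lemma cyl2:
  assumes X: "cylinder m 2 X" and j: "j < 2" "j' < 2" and m: "m > 0"
    and par: "odd m \<or> odd (i + i' + int (j + j'))" and ne: "X i j \<noteq> X i' j'"
  shows "hp (cyl_edge 2 X) (cyl_verts 2 X) (X i j) (X i' j')"
proof (cases "j = 0")
  case True
  then show ?thesis using cyl2_from_bottom[OF X j(2) m, of i i'] par ne by simp
next
  case False
  then have j1: "j = 1" using j by simp
  let ?Y = "\<lambda>t s. X t (2 - 1 - s)"
  have j': "2 - 1 - j' < 2" "2 - 1 - (2 - 1 - j') = j'" using j(2) by auto
  have "odd m \<or> odd (i + i' + int (2 - 1 - j'))"
    using par j(2) j1 by (auto simp: less_2_cases_iff)
  then have "hp (cyl_edge 2 ?Y) (cyl_verts 2 ?Y) (?Y i 0) (?Y i' (2 - 1 - j'))"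
    using ne j1 j' by (intro cyl2_from_bottom[OF cylinder_flip(1)[OF X]] m) auto
  then have "hp (cyl_edge 2 ?Y) (cyl_verts 2 X) (X i j) (X i' j')"
    using j1 j'(2) cylinder_flip(3)[OF X] by simp
  then show ?thesis using cylinder_flip(2)[OF X] by (rule hp_mono)
qed

lemma hp_int_interval: "hp (\<lambda>x y. y = x + 1) {a..a + int n} a (a + int n)"
proof (induction n)
  case 0
  show ?case using hp_single[of _ a] by simp
next
  case (Suc n)
  have "hp (\<lambda>x y. y = x + 1) (insert (a + int (Suc n)) {a..a + int n}) a (a + int (Suc n))"
    by (rule hp_snoc[OF Suc]) auto
  moreover have "insert (a + int (Suc n)) {a..a + int n} = {a..a + int (Suc n)}" by auto
  ultimately show ?case by simp
qed

text \<open>Once round the cycle, without its edge between the columns \<open>i\<close> and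
  \<open>i + d\<close>. This is the piece by which a path is prolonged when a layer is
  added.\<close>

lemma cyl_layer_path:
  assumes X: "cylinder m k X" and j: "j < k" and m: "m > 0" and d: "d = 1 \<or> d = -1"
  shows "hp (cyl_edge k X) (range (\<lambda>i. X i j)) (X (i + d) j) (X i j)"
proof -
  have inj: "inj_on (\<lambda>i. X i j) {i..i + int (m - 1)}" for i
  proof (rule inj_onI)
    fix x y assume *: "x \<in> {i..i + int (m - 1)}" "y \<in> {i..i + int (m - 1)}" "X x j = X y j"
    then have "int m dvd x - y" using cylinder_eq_iff[OF X j j] by blast
    moreover have "\<bar>x - y\<bar> < int m" using * m by auto
    ultimately show "x = y" using dvd_imp_le_int[of "x - y" "int m"] by auto
  qed
  have "hp (cyl_edge k X) ((\<lambda>i. X i j) ` {i..i + int (m - 1)}) (X i j) (X (i + int (m - 1)) j)" for i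
    using cyl_edge_horizontal[OF j] by (intro hp_image[OF hp_int_interval inj]) auto
  moreover have "(\<lambda>i. X i j) ` {i..i + int (m - 1)} = range (\<lambda>i. X i j)" for i
  proof -
    have "X t j \<in> (\<lambda>i. X i j) ` {i..i + int (m - 1)}" for t
    proof -
      define t' where "t' = i + (t - i) mod int m"
      have "0 \<le> (t - i) mod int m" "(t - i) mod int m < int m" using m by auto
      then have "t' \<in> {i..i + int (m - 1)}" using m by (simp add: t'_def)
      moreover have "t - t' = (t - i) - (t - i) mod int m" by (simp add: t'_def)
      then have "int m dvd t - t'" by (simp only: dvd_minus_mod)
      then have "X t j = X t' j" using cylinder_eq_iff[OF X j j] by blast
      ultimately show ?thesis by (rule rev_image_eqI)
    qed
    then show ?thesis by blast
  qed
  moreover have "X (i + int (m - 1)) j = X (i - 1) j" for i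
    using cylinder_periodic[OF X, of "i - 1" j] m by (simp add: of_nat_diff algebra_simps)
  ultimately have *: "hp (cyl_edge k X) (range (\<lambda>i. X i j)) (X i j) (X (i - 1) j)" for i
    by metis
  show ?thesis using d *[of "i + 1"] hp_rev[OF symp_cyl_edge *[of i]] by auto
qed

text \<open>Induction on \<open>k\<close>: a path in the lower layers is rerouted through the new top cycle at an
  edge of the layer below it.\<close>

theorem cyl_path:
  assumes "cylinder m k X" and m: "m \<ge> 3" and k: "k \<ge> 2" and "j < k" "j' < k"
    and "odd m \<or> odd (i + i' + int (j + j'))" and "X i j \<noteq> X i' j'"
  shows "hp (cyl_edge k X) (cyl_verts k X) (X i j) (X i' j')"
  using k assms(1,4-)
proof (induction k arbitrary: X i i' j j' rule: dec_induct)
  case base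
  show ?case by (rule cyl2[OF base.prems(1-3) _ base.prems(4,5)]) (use m in simp)
next
  case (step k)
  have k: "k \<ge> 2" using step by simp
  have X: "cylinder m (Suc k) Y \<Longrightarrow> cylinder m k Y" for Y :: "int \<Rightarrow> nat \<Rightarrow> 'a"
    unfolding cylinder_def by (meson less_SucI)
  have edge_mono: "cyl_edge k Y x y \<Longrightarrow> cyl_edge (Suc k) Y x y" for Y :: "int \<Rightarrow> nat \<Rightarrow> 'a" and x y
    unfolding cyl_edge_def by (elim ex_forward) auto
  have verts: "cyl_verts (Suc k) Y = cyl_verts k Y \<union> range (\<lambda>i. Y i k)" for Y :: "int \<Rightarrow> nat \<Rightarrow> 'a"
    unfolding cyl_verts_def less_Suc_eq by blast
  have disj: "cyl_verts k Y \<inter> range (\<lambda>i. Y i k) = {}" if "cylinder m (Suc k) Y" for Y :: "int \<Rightarrow> nat \<Rightarrow> 'a"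
  proof -
    have "Y i j \<noteq> Y i' k" if "j < k" for i i' j using cylinder_eq_iff[OF \<open>cylinder m (Suc k) Y\<close>, of j k i i'] that by auto
    then show ?thesis unfolding cyl_verts_def by blast
  qed
  have layer: "hp (cyl_edge (Suc k) Y) (range (\<lambda>i. Y i k)) (Y (i + d) k) (Y i k)"
    if "cylinder m (Suc k) Y" "d = 1 \<or> d = -1" for Y :: "int \<Rightarrow> nat \<Rightarrow> 'a" and i d
    using that m by (intro cyl_layer_path) auto
  have up: "cyl_edge (Suc k) Y (Y i (k - 1)) (Y i k)" for Y :: "int \<Rightarrow> nat \<Rightarrow> 'a" and i
    using cyl_edge_vertical[of "k - 1" "Suc k" Y i] k by simp
  have lower: "hp (cyl_edge (Suc k) Y) (cyl_verts (Suc k) Y) (Y i j) (Y i' j')"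
    if Y: "cylinder m (Suc k) Y" and j: "j < k" "j' < k"
      and par: "odd m \<or> odd (i + i' + int (j + j'))" and ne: "Y i j \<noteq> Y i' j'"
    for Y :: "int \<Rightarrow> nat \<Rightarrow> 'a" and i i' j j'
  proof -
    have H: "hp (cyl_edge k Y) (cyl_verts k Y) (Y i j) (Y i' j')"
      by (rule step.IH[OF X[OF Y] j par ne])
    let ?L = "range (\<lambda>i. Y i (k - 1))"
    have kk: "k - 1 < k" using k by simp
    have "\<exists>t. Y t (k - 1) \<noteq> Y i j \<and> Y t (k - 1) \<noteq> Y i' j'"
    proof -
      have "Y s (k - 1) \<noteq> Y t (k - 1)" if "s \<in> {0,1,2}" "t \<in> {0,1,2}" "s \<noteq> t" for s t
      proof
        assume "Y s (k - 1) = Y t (k - 1)"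
        then have "int m dvd s - t" using cylinder_eq_iff[OF X[OF Y] kk kk] by blast
        then show False using dvd_imp_le_int[of "s - t" "int m"] that m by auto
      qed
      from this[of 0 1] this[of 0 2] this[of 1 2] show ?thesis by simp metis
    qed
    then obtain t where t: "Y t (k - 1) \<noteq> Y i j" "Y t (k - 1) \<noteq> Y i' j'" by blast
    have tin: "Y t (k - 1) \<in> cyl_verts k Y" using kk unfolding cyl_verts_def by blast
    have down: "y = Y t (k - 2)" if y: "y \<in> cyl_verts k Y - ?L" "cyl_edge k Y (Y t (k - 1)) y" for y
    proof -
      obtain a b where ab: "b < k"
        "Y t (k - 1) = Y a b \<and> y = Y (a + 1) b \<or> y = Y a b \<and> Y t (k - 1) = Y (a + 1) b \<or>
          Suc b < k \<and> (Y t (k - 1) = Y a b \<and> y = Y a (Suc b) \<or> y = Y a b \<and> Y t (k - 1) = Y a (Suc b))"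
        using y(2) unfolding cyl_edge_def by blast
      have lev: "b' = k - 1" if "b' < k" "Y t (k - 1) = Y a' b'" for a' b'
        using cylinder_eq_iff[OF X[OF Y] kk that(1)] that(2) by blast
      have "y \<noteq> Y a' (k - 1)" for a' using y by blast
      then have "Suc b < k \<and> y = Y a b \<and> Y t (k - 1) = Y a (Suc b)"
        using ab(2) lev[OF ab(1), of a] lev[OF ab(1), of "a + 1"] by (elim disjE conjE) auto
      then have "Suc b < k" "y = Y a b" "Y t (k - 1) = Y a (Suc b)" by blast+
      moreover from this have b: "Suc b = k - 1" "int m dvd t - a"
        using lev[of "Suc b"] cylinder_eq_iff[OF X[OF Y] kk] by blast+
      moreover have "b = k - 2" using b by simp
      ultimately show ?thesis using cylinder_eq_iff[OF X[OF Y] ab(1) ab(1), of t a] by simp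
    qed
    have tL: "Y t (k - 1) \<in> ?L" by blast
    have out: "\<forall>y\<in>cyl_verts k Y - ?L. \<forall>z\<in>cyl_verts k Y - ?L.
      cyl_edge k Y (Y t (k - 1)) y \<longrightarrow> cyl_edge k Y (Y t (k - 1)) z \<longrightarrow> y = z"
      using down by metis
    obtain S1 S2 x y where s: "hp (cyl_edge k Y) S1 (Y i j) x" "cyl_edge k Y x y"
      "hp (cyl_edge k Y) S2 y (Y i' j')" "cyl_verts k Y = S1 \<union> S2" "S1 \<inter> S2 = {}" "x \<in> ?L" "y \<in> ?L"
      by (rule hp_split_inside[OF H symp_cyl_edge tin tL t out])
    have "\<exists>a d. (d = 1 \<or> d = -1) \<and> x = Y (a + d) (k - 1) \<and> y = Y a (k - 1)"
    proof -
      obtain p q where pq: "x = Y p (k - 1)" "y = Y q (k - 1)" using s(6,7) by blast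
      obtain a b where ab: "b < k" "x = Y a b \<and> y = Y (a + 1) b \<or> y = Y a b \<and> x = Y (a + 1) b \<or>
          Suc b < k \<and> (x = Y a b \<and> y = Y a (Suc b) \<or> y = Y a b \<and> x = Y a (Suc b))"
        using s(2) unfolding cyl_edge_def by blast
      have lev: "b' = k - 1" if "b' < k" "Y p' (k - 1) = Y a' b'" for a' b' p'
        using cylinder_eq_iff[OF X[OF Y] kk that(1)] that(2) by blast
      have "b = k - 1" using ab pq lev[OF ab(1)] by metis
      then have "x = Y a (k - 1) \<and> y = Y (a + 1) (k - 1) \<or> y = Y a (k - 1) \<and> x = Y (a + 1) (k - 1)"
        using ab(2) by auto
      moreover have "Y a (k - 1) = Y (a + 1 + - 1) (k - 1)" by simp
      ultimately show ?thesis by metis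
    qed
    then obtain a d where a: "d = 1 \<or> d = -1" "x = Y (a + d) (k - 1)" "y = Y a (k - 1)" by blast
    have 1: "hp (cyl_edge (Suc k) Y) S1 (Y i j) x" "hp (cyl_edge (Suc k) Y) S2 y (Y i' j')"
      using s(1,3) edge_mono by (auto intro: hp_mono)
    have d: "S1 \<inter> (range (\<lambda>i. Y i k) \<union> S2) = {}" "range (\<lambda>i. Y i k) \<inter> S2 = {}"
      using disj[OF Y] s(4,5) by auto
    have "hp (cyl_edge (Suc k) Y) (range (\<lambda>i. Y i k) \<union> S2) (Y (a + d) k) (Y i' j')"
      using up[of Y a] symp_cyl_edge[of "Suc k" Y] a d(2)
      by (intro hp_append[OF layer[OF Y a(1)] _ 1(2)]) (auto dest: sympD)
    then have "hp (cyl_edge (Suc k) Y) (S1 \<union> (range (\<lambda>i. Y i k) \<union> S2)) (Y i j) (Y i' j')"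
      using up[of Y "a + d"] a d(1) by (intro hp_append[OF 1(1)]) auto
    then show ?thesis using verts[of Y] s(4) by (simp add: Un_ac)
  qed
  have cross: "hp (cyl_edge (Suc k) X) (cyl_verts (Suc k) X) (X i j) (X i' k)"
    if j: "j < k" and par: "odd m \<or> odd (i + i' + int (j + k))" for i i' j
  proof -
    have Xk: "cylinder m k X" using X step by blast
    have kk: "k - 1 < k" using k by simp
    \<comment> \<open>Two candidates for the column next to \<open>i'\<close> from which the path
      ascends to layer \<open>k\<close>; as \<open>m\<close> is at least 3 they are different, so
      one of them is not the start.\<close>
    have "\<exists>d. (d = 1 \<or> d = -1) \<and> X i j \<noteq> X (i' + d) (k - 1)"
    proof (rule ccontr)
      assume "\<not> ?thesis"
      then have "X i j = X (i' + 1) (k - 1)" "X i j = X (i' + -1) (k - 1)" by blast+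
      then have "X (i' + 1) (k - 1) = X (i' + -1) (k - 1)" by simp
      then have "int m dvd 2" using cylinder_eq_iff[OF Xk kk kk, of "i' + 1" "i' + -1"] by simp
      then show False using m dvd_imp_le_int[of 2 "int m"] by auto
    qed
    then obtain d where d: "d = 1 \<or> d = -1" "X i j \<noteq> X (i' + d) (k - 1)" by blast
    have "odd m \<or> odd (i + (i' + d) + int (j + (k - 1)))" using par d(1) k by (auto simp: of_nat_diff)
    then have "hp (cyl_edge k X) (cyl_verts k X) (X i j) (X (i' + d) (k - 1))"
      using d by (intro step.IH[OF Xk j kk]) auto
    then have "hp (cyl_edge (Suc k) X) (cyl_verts k X) (X i j) (X (i' + d) (k - 1))"
      using edge_mono by (rule hp_mono)
    then have "hp (cyl_edge (Suc k) X) (cyl_verts k X \<union> range (\<lambda>i. X i k)) (X i j) (X i' k)"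
      using up layer[OF step.prems(1) d(1)] disj[OF step.prems(1)] by (rule hp_append)
    then show ?thesis using verts by simp
  qed
  show ?case
  proof (cases "j < k")
    case True
    show ?thesis
    proof (cases "j' < k")
      case False
      then have "j' = k" using step by simp
      then show ?thesis using cross[OF True] step by blast
    qed (use lower step True in blast)
  next
    case False
    then have jk: "j = k" using step by simp
    show ?thesis
    proof (cases "j' < k")
      case True
      have "hp (cyl_edge (Suc k) X) (cyl_verts (Suc k) X) (X i' j') (X i j)"
        using step.prems(4) jk by (auto simp: add_ac intro!: cross[OF True])
      then show ?thesis by (rule hp_rev[OF symp_cyl_edge])
    next
      case False
      then have j'k: "j' = k" using step by simp
      \<comment> \<open>Turned upside down, both ends lie in layer 0, hence below the top layer, and
        \<open>lower\<close> applies.\<close>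
      let ?Y = "\<lambda>t s. X t (Suc k - 1 - s)"
      have Y: "cylinder m (Suc k) ?Y" by (rule cylinder_flip(1)[OF step.prems(1)])
      have "odd m \<or> odd (i + i' + int (0 + 0))" using step.prems(4) jk j'k by auto
      then have "hp (cyl_edge (Suc k) ?Y) (cyl_verts (Suc k) ?Y) (?Y i 0) (?Y i' 0)"
        using k step.prems(5) jk j'k by (intro lower[OF Y]) auto
      then have "hp (cyl_edge (Suc k) ?Y) (cyl_verts (Suc k) X) (X i j) (X i' j')"
        unfolding cylinder_flip(3)[OF step.prems(1)] using jk j'k by simp
      then show ?thesis using cylinder_flip(2)[OF step.prems(1)] by (rule hp_mono)
    qed
  qed
qed

section \<open>Finite fields\<close>

lemma finite_field_power_card_minus_1:
  fixes x :: "'a::{finite,field}"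
  assumes "x \<noteq> 0"
  shows "x ^ (CARD('a) - 1) = 1"
proof -
  have "bij_betw ((*) x) (- {0}) (- {0})"
    by (rule bij_betw_byWitness[where f' = "\<lambda>y. y / x"]) (use assms in auto)
  then have "(\<Prod>y\<in>-{0}. y) = (\<Prod>y\<in>-{0}. x * y)"
    by (rule prod.reindex_bij_betw[symmetric])
  also have "\<dots> = x ^ card (- {0::'a}) * (\<Prod>y\<in>-{0}. y)"
    by (simp add: prod.distrib)
  finally have "x ^ card (- {0::'a}) = 1" by (simp add: prod_zero_iff)
  then show ?thesis by (simp add: card_Diff_subset Compl_eq_Diff_UNIV)
qed

locale finite_field_generator =
  fixes \<alpha> :: "'a::{finite,field}" and m :: nat
  assumes gen: "mult_generator \<alpha>" and m_def: "m = CARD('a) - 1"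
begin

lemma m_pos: "m > 0"
proof -
  have "card {0, 1::'a} \<le> CARD('a)" by (rule card_mono) auto
  then show ?thesis by (simp add: m_def)
qed

lemma card_field: "CARD('a) = Suc m"
  using m_pos by (simp add: m_def)

lemma alpha_nz [simp]: "\<alpha> \<noteq> 0"
proof
  assume "\<alpha> = 0"
  have "\<alpha> powi 1 \<in> range (\<lambda>k::int. \<alpha> powi k)" by blast
  then show False using gen \<open>\<alpha> = 0\<close> by (simp add: mult_generator_def)
qed

lemma alpha_m: "\<alpha> ^ m = 1"
  using finite_field_power_card_minus_1[OF alpha_nz] by (simp add: m_def)

lemma powi_period: "\<alpha> powi (i + int m * c) = \<alpha> powi i"
  using alpha_m by (simp add: power_int_add power_int_mult)

lemma powi_mod: "\<alpha> powi i = \<alpha> ^ nat (i mod int m)"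
proof -
  have "\<alpha> powi i = \<alpha> powi (i mod int m + int m * (i div int m))" by simp
  also have "\<dots> = \<alpha> powi (i mod int m)" by (rule powi_period)
  also have "\<dots> = \<alpha> ^ nat (i mod int m)" using m_pos by (simp add: power_int_def)
  finally show ?thesis .
qed

lemma powers_eq: "(\<lambda>k. \<alpha> ^ k) ` {..<m} = - {0}"
proof -
  have "x \<in> (\<lambda>k. \<alpha> ^ k) ` {..<m}" if "x \<noteq> 0" for x
  proof -
    have "x \<in> range (\<lambda>k::int. \<alpha> powi k)" using that gen by (simp add: mult_generator_def)
    then obtain k where "x = \<alpha> powi k" by blast
    then have "x = \<alpha> ^ nat (k mod int m)" using powi_mod by simp
    moreover have "nat (k mod int m) < m" using m_pos by (simp add: nat_less_iff)
    ultimately show ?thesis by blast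
  qed
  then show ?thesis by auto
qed

lemma inj_powers: "inj_on (\<lambda>k. \<alpha> ^ k) {..<m}"
proof (rule eq_card_imp_inj_on)
  have "card (- {0::'a}) = m" by (simp add: Compl_eq_Diff_UNIV card_Diff_subset m_def)
  then show "card ((\<lambda>k. \<alpha> ^ k) ` {..<m}) = card {..<m}" by (simp only: powers_eq card_lessThan)
qed simp

lemma ex_power: "x \<noteq> 0 \<Longrightarrow> \<exists>k<m. x = \<alpha> ^ k"
  using powers_eq by (auto simp: image_iff set_eq_iff)

lemma powi_eq_iff: "\<alpha> powi i = \<alpha> powi j \<longleftrightarrow> int m dvd i - j"
proof
  assume "\<alpha> powi i = \<alpha> powi j"
  then have "\<alpha> ^ nat (i mod int m) = \<alpha> ^ nat (j mod int m)" by (simp add: powi_mod)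
  moreover have "nat (i mod int m) \<in> {..<m}" "nat (j mod int m) \<in> {..<m}"
    using m_pos by (simp_all add: nat_less_iff)
  ultimately have "nat (i mod int m) = nat (j mod int m)" using inj_powers by (auto simp: inj_on_def)
  moreover have "0 \<le> i mod int m" "0 \<le> j mod int m" using m_pos by simp_all
  ultimately have "i mod int m = j mod int m" by (simp add: eq_nat_nat_iff)
  then show "int m dvd i - j" by (simp add: mod_eq_dvd_iff)
next
  assume "int m dvd i - j"
  then obtain c where "i = j + int m * c" by (auto simp: dvd_def algebra_simps)
  then show "\<alpha> powi i = \<alpha> powi j" by (simp add: powi_period)
qed

lemma power_eq_iff: "\<alpha> ^ i = \<alpha> ^ j \<longleftrightarrow> int m dvd int i - int j"
  using powi_eq_iff[of "int i" "int j"] by (simp add: power_int_of_nat)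

lemma power_neq_1: "0 < k \<Longrightarrow> k < m \<Longrightarrow> \<alpha> ^ k \<noteq> 1"
  using power_eq_iff[of k 0] by (auto dest: zdvd_imp_le)

text \<open>For odd \<open>q\<close> this is the quadratic character.\<close>

definition \<chi> :: "'a \<Rightarrow> 'a" where "\<chi> x = x ^ (m div 2)"

lemma chi_mult: "\<chi> (x * y) = \<chi> x * \<chi> y"
  by (simp add: \<chi>_def power_mult_distrib)

lemma chi_one [simp]: "\<chi> 1 = 1"
  by (simp add: \<chi>_def)

lemma chi_power: "\<chi> (x ^ k) = \<chi> x ^ k"
  by (induction k) (simp_all add: chi_mult)

context
  assumes even_m: "even m"
begin

lemma chi_cases: "x \<noteq> 0 \<Longrightarrow> \<chi> x = 1 \<or> \<chi> x = -1"
proof -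
  assume "x \<noteq> 0"
  have "\<chi> x * \<chi> x = x ^ (m div 2 + m div 2)" by (simp only: \<chi>_def power_add)
  also have "m div 2 + m div 2 = m" using even_m by presburger
  also have "x ^ m = 1" using finite_field_power_card_minus_1[OF \<open>x \<noteq> 0\<close>] by (simp only: m_def)
  finally have "\<chi> x * \<chi> x = 1" .
  then show ?thesis by (simp add: square_eq_1_iff)
qed

lemma chi_alpha_neq_1: "\<chi> \<alpha> \<noteq> 1"
  using even_m m_pos unfolding \<chi>_def by (intro power_neq_1) auto

lemma chi_alpha: "\<chi> \<alpha> = -1"
  using chi_cases[OF alpha_nz] chi_alpha_neq_1 by blast

lemma one_neq_minus_one: "(1::'a) \<noteq> -1"
  using chi_alpha chi_alpha_neq_1 by auto

lemma two_nz: "(2::'a) \<noteq> 0"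
  using one_neq_minus_one by (metis add_eq_0_iff one_add_one)

lemma chi_nz: "x \<noteq> 0 \<Longrightarrow> \<chi> x \<noteq> 0"
  using chi_cases[of x] by auto

end

end

section \<open>Dimension two\<close>

type_synonym 'a vec2 = "'a \<times> 'a"

definition scl :: "'a::field \<Rightarrow> 'a vec2 \<Rightarrow> 'a vec2" where
  "scl c v = (c * fst v, c * snd v)"

definition add2 :: "'a::field vec2 \<Rightarrow> 'a vec2 \<Rightarrow> 'a vec2" where
  "add2 v w = (fst v + fst w, snd v + snd w)"

definition det2 :: "'a::field vec2 \<Rightarrow> 'a vec2 \<Rightarrow> 'a" where
  "det2 v w = fst v * snd w - snd v * fst w"

definition line :: "'a::field vec2 \<Rightarrow> 'a vec2 set" where
  "line u = {w. det2 u w = 0}"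

abbreviation "zero2 \<equiv> (0, 0)"

lemma scl_simps [simp]: "fst (scl c v) = c * fst v" "snd (scl c v) = c * snd v"
  "scl 1 v = v" "scl a (scl b v) = scl (a * b) v"
  by (simp_all add: scl_def mult.assoc)

lemma add2_simps [simp]: "fst (add2 v w) = fst v + fst w" "snd (add2 v w) = snd v + snd w"
  by (simp_all add: add2_def)

lemma det2_scl [simp]: "det2 (scl c v) w = c * det2 v w" "det2 v (scl c w) = c * det2 v w"
  by (simp_all add: det2_def algebra_simps)

lemma det2_add2 [simp]: "det2 (add2 v v') w = det2 v w + det2 v' w" "det2 v (add2 w w') = det2 v w + det2 v w'"
  by (simp_all add: det2_def algebra_simps)

lemma det2_self [simp]: "det2 v v = 0" "det2 zero2 v = 0" "det2 v zero2 = 0"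
  by (simp_all add: det2_def)

lemma det2_anti: "det2 v w = - det2 w v"
  by (simp add: det2_def)

lemma det2_nz: "det2 v w \<noteq> 0 \<Longrightarrow> v \<noteq> zero2 \<and> w \<noteq> zero2"
  by auto

lemma scl_eq_zero_iff [simp]: "scl c v = zero2 \<longleftrightarrow> c = 0 \<or> v = zero2"
  by (cases v) (auto simp: scl_def)

lemma scl_eq_iff: "v \<noteq> zero2 \<Longrightarrow> scl c v = scl d v \<longleftrightarrow> c = d"
  by (cases v) (auto simp: scl_def)

lemma det2_zero_imp_scl:
  assumes "det2 u w = 0" "u \<noteq> zero2"
  shows "\<exists>c. w = scl c u"
proof (cases "fst u = 0")
  case True
  then have "snd u \<noteq> 0" using assms(2) by (cases u) auto
  then show ?thesis using assms True
    by (intro exI[of _ "snd w / snd u"]) (auto simp: det2_def scl_def prod_eq_iff)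
next
  case False
  then show ?thesis using assms
    by (intro exI[of _ "fst w / fst u"]) (auto simp: det2_def scl_def prod_eq_iff field_simps)
qed

lemma line_scl [simp]: "c \<noteq> 0 \<Longrightarrow> line (scl c u) = line u"
  by (auto simp: line_def)

lemma line_eq_iff:
  assumes "u \<noteq> zero2" "w \<noteq> zero2"
  shows "line u = line w \<longleftrightarrow> det2 u w = 0"
proof
  assume "line u = line w"
  moreover have "w \<in> line w" by (simp add: line_def)
  ultimately have "w \<in> line u" by simp
  then show "det2 u w = 0" unfolding line_def by simp
next
  assume "det2 u w = 0"
  then obtain c where c: "w = scl c u" using det2_zero_imp_scl assms by blast
  then have "c \<noteq> 0" using assms by auto
  then show "line u = line w" using c by simp
qed

lemma line_eqE:
  assumes "line u = line w" "u \<noteq> zero2" "w \<noteq> zero2"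
  obtains c where "c \<noteq> 0" "w = scl c u"
  using assms line_eq_iff[of u w] det2_zero_imp_scl[of u w] by auto

text \<open>Cramer's rule.\<close>

lemma basis2:
  assumes "det2 v u \<noteq> 0"
  obtains a b where "w = add2 (scl a v) (scl b u)" "a = det2 w u / det2 v u" "b = det2 v w / det2 v u"
proof -
  have "w = add2 (scl (det2 w u / det2 v u) v) (scl (det2 v w / det2 v u) u)"
    using assms by (simp add: prod_eq_iff field_simps) (simp add: det2_def algebra_simps)
  then show thesis using that by blast
qed

type_synonym 'a gl2 = "'a vec2 \<times> 'a vec2"

definition GL2 :: "'a::field gl2 set" where "GL2 = {x. det2 (fst x) (snd x) \<noteq> 0}"

definition opA :: "'a::field gl2 \<Rightarrow> 'a gl2" where "opA x = (add2 (fst x) (snd x), snd x)"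
definition opB :: "'a::field gl2 \<Rightarrow> 'a gl2" where "opB x = (fst x, add2 (snd x) (fst x))"

definition A_edge :: "'a::field gl2 \<Rightarrow> 'a gl2 \<Rightarrow> bool" where "A_edge x y \<longleftrightarrow> y = opA x \<or> x = opA y"
definition B_edge :: "'a::field gl2 \<Rightarrow> 'a gl2 \<Rightarrow> bool" where "B_edge x y \<longleftrightarrow> y = opB x \<or> x = opB y"
definition M_edge :: "'a::field \<Rightarrow> 'a gl2 \<Rightarrow> 'a gl2 \<Rightarrow> bool" where
  "M_edge \<alpha> x y \<longleftrightarrow> y = (scl \<alpha> (fst x), snd x) \<or> y = (fst x, scl \<alpha> (snd x)) \<or>
     x = (scl \<alpha> (fst y), snd y) \<or> x = (fst y, scl \<alpha> (snd y))"
definition E2 :: "'a::field \<Rightarrow> 'a gl2 \<Rightarrow> 'a gl2 \<Rightarrow> bool" where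
  "E2 \<alpha> x y \<longleftrightarrow> A_edge x y \<or> B_edge x y \<or> M_edge \<alpha> x y"

lemma symp_edges: "symp A_edge" "symp B_edge" "symp (M_edge \<alpha>)" "symp (E2 \<alpha>)"
  by (auto simp: symp_def A_edge_def B_edge_def M_edge_def E2_def)

lemma GL2_D: "x \<in> GL2 \<Longrightarrow> fst x \<noteq> zero2" "x \<in> GL2 \<Longrightarrow> snd x \<noteq> zero2"
  "x \<in> GL2 \<Longrightarrow> line (fst x) \<noteq> line (snd x)"
  by (auto simp: GL2_def dest: det2_nz) (metis det2_nz line_eq_iff)

lemma GL2_op [simp]: "opA x \<in> GL2 \<longleftrightarrow> x \<in> GL2" "opB x \<in> GL2 \<longleftrightarrow> x \<in> GL2"
  by (auto simp: GL2_def opA_def opB_def)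

text \<open>If nonempty, a right coset of the diagonal matrices: the lines of both rows are fixed,
  their scalars are free.\<close>

definition torus :: "'a::field vec2 set \<Rightarrow> 'a vec2 set \<Rightarrow> 'a gl2 set" where
  "torus P Q = {x \<in> GL2. line (snd x) = P \<and> line (fst x) = Q}"

text \<open>If nonempty, a right coset of the upper triangular matrices, which are \<open>K2\<close>
  in dimension two.\<close>

definition block :: "'a::field vec2 set \<Rightarrow> 'a gl2 set" where
  "block P = {x \<in> GL2. line (snd x) = P}"

context finite_field_generator
begin

text \<open>The colour. For even \<open>m\<close>, scaling a row by \<alpha> changes its sign; row
  additions leave it alone.\<close>

definition \<kappa> :: "'a gl2 \<Rightarrow> 'a" where "\<kappa> x = \<chi> (det2 (fst x) (snd x))"

lemma torus_eq:
  assumes "(v, u) \<in> GL2"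
  shows "torus (line u) (line v) = {(scl a v, scl c u) | a c. a \<noteq> 0 \<and> c \<noteq> 0}"
proof -
  have nz: "v \<noteq> zero2" "u \<noteq> zero2" using GL2_D[OF assms] by auto
  show ?thesis
  proof (intro Set.set_eqI iffI)
    fix x assume x: "x \<in> torus (line u) (line v)"
    then have "fst x \<noteq> zero2" "snd x \<noteq> zero2" "line v = line (fst x)" "line u = line (snd x)"
      using GL2_D[of x] by (auto simp: torus_def)
    note l = this
    obtain a where "a \<noteq> 0" "fst x = scl a v" by (rule line_eqE[OF l(3) nz(1) l(1)])
    moreover obtain c where "c \<noteq> 0" "snd x = scl c u" by (rule line_eqE[OF l(4) nz(2) l(2)])
    ultimately show "x \<in> {(scl a v, scl c u) | a c. a \<noteq> 0 \<and> c \<noteq> 0}" by (cases x) auto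
  next
    fix x assume "x \<in> {(scl a v, scl c u) | a c. a \<noteq> 0 \<and> c \<noteq> 0}"
    then show "x \<in> torus (line u) (line v)" using assms by (auto simp: torus_def GL2_def)
  qed
qed

text \<open>Multiplying the rows by powers of \<alpha> turns the torus into a product of two cycles
  of length \<open>m\<close>; cutting the second cycle open leaves the cylinder of
  \<open>cyl_path\<close>. For even \<open>m\<close> the colour is, up to a fixed sign, the parity
  of the sum of the two exponents, so different colours give the odd distance that is needed
  there.\<close>

lemma torus_path:
  assumes xy: "x \<in> torus P Q" "y \<in> torus P Q" "x \<noteq> y" and m: "m \<ge> 3" and par: "odd m \<or> \<kappa> x \<noteq> \<kappa> y"
  shows "hp (M_edge \<alpha>) (torus P Q) x y"
proof -
  obtain v u where x: "x = (v, u)" by (rule prod.exhaust)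
  have vu: "(v, u) \<in> GL2" "P = line u" "Q = line v" using xy(1) x by (auto simp: torus_def)
  have nz: "v \<noteq> zero2" "u \<noteq> zero2" using GL2_D[OF vu(1)] by auto
  define X where "X = (\<lambda>i (j::nat). (scl (\<alpha> powi i) v, scl (\<alpha> ^ j) u))"
  have cyl: "cylinder m m X"
    unfolding cylinder_def
  proof (intro conjI allI impI)
    show "X (i + int m) j = X i j" for i j using powi_period[of i 1] by (simp add: X_def)
    fix i i' j j' assume j: "j < m" "j' < m" and "X i j = X i' j'"
    then have e: "\<alpha> powi i = \<alpha> powi i'" "\<alpha> ^ j = \<alpha> ^ j'" using nz by (simp_all add: X_def scl_eq_iff)
    show "int m dvd i - i'" using e(1) powi_eq_iff by blast
    show "j = j'" using e(2) j inj_powers by (auto simp: inj_on_def)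
  qed
  have verts: "cyl_verts m X = torus P Q"
    unfolding vu torus_eq[OF vu(1)] cyl_verts_def
  proof (intro Set.set_eqI iffI)
    fix x assume "x \<in> {X i j |i j. j < m}"
    then obtain i j where "x = X i j" by blast
    then show "x \<in> {(scl a v, scl c u) |a c. a \<noteq> 0 \<and> c \<noteq> 0}"
      by (intro CollectI exI[of _ "\<alpha> powi i"] exI[of _ "\<alpha> ^ j"]) (simp add: X_def)
  next
    fix x assume "x \<in> {(scl a v, scl c u) |a c. a \<noteq> 0 \<and> c \<noteq> 0}"
    then obtain a c where ac: "x = (scl a v, scl c u)" "a \<noteq> 0" "c \<noteq> 0" by blast
    obtain i j where "a = \<alpha> ^ i" "j < m" "c = \<alpha> ^ j" using ex_power[OF ac(2)] ex_power[OF ac(3)] by blast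
    then have "x = X (int i) j" using ac by (simp add: X_def power_int_of_nat)
    then show "x \<in> {X i j |i j. j < m}" using \<open>j < m\<close> by blast
  qed
  have edge: "M_edge \<alpha> a b" if "cyl_edge m X a b" for a b
  proof -
    have "X (i + 1) j = (scl \<alpha> (fst (X i j)), snd (X i j))" "X i (Suc j) = (fst (X i j), scl \<alpha> (snd (X i j)))"
      for i j by (simp_all add: X_def power_int_add mult.commute)
    then show ?thesis using that unfolding cyl_edge_def M_edge_def by metis
  qed
  obtain i' j' where y: "y = X i' j'" "j' < m" using xy(2) unfolding verts[symmetric] cyl_verts_def by blast
  have x0: "x = X 0 0" using x by (simp add: X_def)
  have "odd m \<or> odd (0 + i' + int (0 + j'))"
  proof (rule ccontr)
    assume "\<not> ?thesis"
    then have ev: "even m" "even (i' + int j')" by auto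
    have "\<kappa> y = \<chi> (\<alpha> powi i' * \<alpha> powi int j' * det2 v u)" using y by (simp add: \<kappa>_def X_def mult_ac)
    also have "\<dots> = \<chi> (\<alpha> powi (i' + int j')) * \<chi> (det2 v u)" by (simp add: power_int_add chi_mult)
    also have "\<chi> (\<alpha> powi (i' + int j')) = \<chi> \<alpha> ^ nat ((i' + int j') mod int m)"
      by (simp only: powi_mod chi_power)
    also have "\<dots> = 1"
    proof -
      have "even ((i' + int j') mod int m)" using ev by (simp add: dvd_mod_iff)
      moreover have "(i' + int j') mod int m \<ge> 0" using m by simp
      ultimately have "even (nat ((i' + int j') mod int m))" by (simp only: even_nat_iff)
      then show ?thesis by (simp add: chi_alpha[OF ev(1)])
    qed
    finally have "\<kappa> y = \<kappa> x" using x by (simp add: \<kappa>_def)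
    then show False using par ev by auto
  qed
  note par' = this
  have m0: "0 < m" "2 \<le> m" using m by auto
  have "X 0 0 \<noteq> X i' j'" using xy(3) x0 y(1) by blast
  then have "hp (cyl_edge m X) (cyl_verts m X) (X 0 0) (X i' j')"
    by (rule cyl_path[OF cyl m m0(2) m0(1) y(2) par'])
  then have "hp (M_edge \<alpha>) (cyl_verts m X) (X 0 0) (X i' j')"
    by (rule hp_mono) (rule edge)
  then show ?thesis unfolding verts x0 y(1) .
qed

end

section \<open>From the blocks to the full group in dimension two, and the blocks for even
  order\<close>

lemma inj_opA: "inj opA" and inj_opB: "inj opB"
  by (auto simp: inj_def opA_def opB_def add2_def prod_eq_iff)

lemma card_3_distinct:
  assumes "x \<in> A" "y \<in> A" "z \<in> A" "x \<noteq> y" "x \<noteq> z" "y \<noteq> z"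
  shows "\<exists>C \<subseteq> A. card C = 3"
  using assms by (intro exI[of _ "{x, y, z}"]) auto

context finite_field_generator
begin

lemma E2_intros: "E2 \<alpha> x (opA x)" "E2 \<alpha> x (opB x)" "M_edge \<alpha> x y \<Longrightarrow> E2 \<alpha> x y" "A_edge x y \<Longrightarrow> E2 \<alpha> x y"
    "B_edge x y \<Longrightarrow> E2 \<alpha> x y"
  by (auto simp: E2_def A_edge_def B_edge_def)

lemma alpha_neq_1: "m \<ge> 2 \<Longrightarrow> \<alpha> \<noteq> 1"
  using power_neq_1[of 1] by auto

text \<open>A matrix with bottom row a u and top row l w - a u is sent by \<open>opB\<close> to one
  with bottom row l w. The two free nonzero scalars give (q - 1)^2 exits from the block of u to that
  of w, at least four.\<close>

lemma HC_GL2_if_HC_blocks: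
  assumes m: "m \<ge> 2" and HC: "\<And>P. HC (E2 \<alpha>) (block P)"
  shows "HC (E2 \<alpha>) (GL2 :: 'a gl2 set)"
proof -
  interpret complete_quotient "E2 \<alpha>" "GL2 :: 'a gl2 set" "\<lambda>x. line (snd x)" opB
  proof
    show "symp (E2 \<alpha>)" by (rule symp_edges)
    show "finite ((\<lambda>x. line (snd x)) ` (GL2 :: 'a gl2 set))" by simp
    show "inj_on opB GL2" using inj_opB by (rule inj_on_subset) simp
    fix x :: "'a gl2" assume x: "x \<in> GL2"
    show "E2 \<alpha> x (opB x)" by (rule E2_intros)
    show "opB x \<in> GL2" using x by simp
    have "opB x \<in> GL2" using x by simp
    then have "snd (opB x) \<noteq> zero2" by (rule GL2_D)
    moreover have "det2 (snd (opB x)) (snd x) \<noteq> 0" using x by (simp add: opB_def GL2_def)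
    ultimately show "line (snd (opB x)) \<noteq> line (snd x)" using GL2_D[OF x] by (simp add: line_eq_iff)
  next
    fix P assume "P \<in> (\<lambda>x. line (snd x)) ` (GL2 :: 'a gl2 set)"
    show "HC (E2 \<alpha>) {x \<in> GL2. line (snd x) = P}" using HC[of P] by (simp add: block_def)
  next
    fix P P' assume P: "P \<in> (\<lambda>x. line (snd x)) ` (GL2 :: 'a gl2 set)" "P' \<in> (\<lambda>x. line (snd x)) ` (GL2 :: 'a gl2 set)"
      "P \<noteq> P'"
    then obtain x x' :: "'a gl2" where x: "x \<in> GL2" "P = line (snd x)" "x' \<in> GL2" "P' = line (snd x')" by blast
    let ?u = "snd x" and ?w = "snd x'"
    have nz: "?u \<noteq> zero2" "?w \<noteq> zero2" using GL2_D(2) x by blast+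
    have d: "det2 ?u ?w \<noteq> 0" using P(3) x nz by (simp add: line_eq_iff)
    have d': "det2 ?w ?u \<noteq> 0" using d det2_anti[of ?u ?w] by (metis neg_equal_0_iff_equal)
    define f where "f l a = (add2 (scl l ?w) (scl (- a) ?u), scl a ?u)" for l a
    have f: "f l a \<in> {y \<in> GL2. line (snd y) = P \<and> line (snd (opB y)) = P'}" if "l \<noteq> 0" "a \<noteq> 0" for l a
    proof -
      have "add2 (scl a ?u) (add2 (scl l ?w) (scl (- a) ?u)) = scl l ?w"
        by (simp add: prod_eq_iff)
      then show ?thesis using that x d d' by (simp add: f_def GL2_def opB_def)
    qed
    have "f l a \<noteq> f l' a'" if "l \<noteq> l' \<or> a \<noteq> a'" for l a l' a'
    proof
      assume "f l a = f l' a'"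
      then have 1: "scl a ?u = scl a' ?u" "add2 (scl l ?w) (scl (- a) ?u) = add2 (scl l' ?w) (scl (- a') ?u)"
        by (auto simp: f_def)
      then have "a = a'" using nz by (simp add: scl_eq_iff)
      moreover have "scl l ?w = scl l' ?w" using 1(2) \<open>a = a'\<close> by (simp add: prod_eq_iff)
      then have "l = l'" using nz by (simp add: scl_eq_iff)
      ultimately show False using that by simp
    qed
    then show "\<exists>C \<subseteq> {y \<in> GL2. line (snd y) = P \<and> line (snd (opB y)) = P'}. card C = 3"
      using alpha_neq_1[OF m] by (intro card_3_distinct[of "f 1 1" _ "f \<alpha> 1" "f 1 \<alpha>"] f) auto
  qed
  show ?thesis
  proof (rule HC)
    let ?\<beta> = "\<lambda>x :: 'a gl2. line (snd x)"
    have "?\<beta> ((0,1),(1,0)) \<in> ?\<beta> ` GL2" "?\<beta> ((1,0),(0,1)) \<in> ?\<beta> ` GL2" "?\<beta> ((1,0),(1,1)) \<in> ?\<beta> ` GL2"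
      by (rule imageI, simp add: GL2_def det2_def)+
    then show "\<exists>C \<subseteq> ?\<beta> ` GL2. card C = 3"
      by (rule card_3_distinct) (auto simp: line_eq_iff det2_def)
  qed
qed

text \<open>With w = a v + b u, the rows c a v and c b u add up to c w, so \<open>opA\<close> leads
  from the torus of v to that of w. Only the factor c is free, and there are q - 1 exits of this
  kind.\<close>

lemma torus_exit:
  assumes x: "x \<in> GL2" "y \<in> GL2" "line (snd x) = line (snd y)" "line (fst x) \<noteq> line (fst y)" "c \<noteq> 0"
  shows "\<exists>a b. a \<noteq> 0 \<and> b \<noteq> 0 \<and> (\<forall>c. c \<noteq> 0 \<longrightarrow>
    (scl (c * a) (fst x), scl (c * b) (snd x)) \<in> torus (line (snd x)) (line (fst x)) \<and>
    opA (scl (c * a) (fst x), scl (c * b) (snd x)) \<in> torus (line (snd x)) (line (fst y)))"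
proof -
  let ?v = "fst x" and ?u = "snd x" and ?w = "fst y"
  have nz: "?v \<noteq> zero2" "?u \<noteq> zero2" "?w \<noteq> zero2" using GL2_D(1,2) x(1,2) by blast+
  have d: "det2 ?v ?u \<noteq> 0" using x by (simp add: GL2_def)
  obtain a b where ab: "?w = add2 (scl a ?v) (scl b ?u)" using basis2[OF d] by metis
  have "det2 ?w ?u \<noteq> 0"
    using x(3) nz line_eq_iff[of ?w ?u] GL2_D(3)[OF x(2)] by simp
  then have "a \<noteq> 0" using ab by auto
  moreover have "det2 ?v ?w \<noteq> 0" using x(4) line_eq_iff[of ?v ?w] nz by simp
  then have "b \<noteq> 0" using ab by auto
  moreover have "add2 (scl (c * a) ?v) (scl (c * b) ?u) = scl c ?w" for c
    unfolding ab by (simp add: prod_eq_iff algebra_simps)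
  ultimately show ?thesis
    using d \<open>det2 ?w ?u \<noteq> 0\<close> by (intro exI[of _ a] exI[of _ b]) (auto simp: torus_def GL2_def opA_def)
qed

text \<open>For odd \<open>m\<close> the tori are Hamilton connected without regard to colours.
  Three exits come from the factors 1, \<alpha> and \<open>\<alpha> ^ 2\<close> in
  \<open>torus_exit\<close>, which are distinct as \<open>m\<close> is at least 3.\<close>

lemma HC_block_even:
  assumes m: "m \<ge> 3" "odd m"
  shows "HC (E2 \<alpha>) (block P)"
proof (cases "block P = {}")
  case True
  then show ?thesis by (simp add: HC_def)
next
  case False
  then obtain v u where vu: "(v, u) \<in> block P" by auto
  interpret complete_quotient "E2 \<alpha>" "block P" "\<lambda>x. line (fst x)" opA
  proof
    show "symp (E2 \<alpha>)" by (rule symp_edges)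
    show "finite ((\<lambda>x. line (fst x)) ` block P)" by simp
    show "inj_on opA (block P)" using inj_opA by (rule inj_on_subset) simp
    fix x :: "'a gl2" assume x: "x \<in> block P"
    show "E2 \<alpha> x (opA x)" by (rule E2_intros)
    show "opA x \<in> block P" using x by (simp add: block_def opA_def GL2_def)
    have x': "x \<in> GL2" using x by (simp add: block_def)
    then have "opA x \<in> GL2" by simp
    then have "fst (opA x) \<noteq> zero2" by (rule GL2_D)
    moreover have "det2 (fst (opA x)) (fst x) \<noteq> 0"
      using x' det2_anti[of "snd x" "fst x"] by (simp add: opA_def GL2_def)
    ultimately show "line (fst (opA x)) \<noteq> line (fst x)" using GL2_D[OF x'] by (simp add: line_eq_iff)
  next
    fix Q
    have "{x \<in> block P. line (fst x) = Q} = torus P Q" by (auto simp: block_def torus_def)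
    moreover have "HC (E2 \<alpha>) (torus P Q)"
      unfolding HC_def using torus_path[OF _ _ _ m(1)] m(2) E2_intros(3) by (blast intro: hp_mono)
    ultimately show "HC (E2 \<alpha>) {x \<in> block P. line (fst x) = Q}" by simp
  next
    fix Q Q' assume "Q \<in> (\<lambda>x. line (fst x)) ` block P" "Q' \<in> (\<lambda>x. line (fst x)) ` block P" "Q \<noteq> Q'"
    then obtain x y where "x \<in> block P" "y \<in> block P" "line (fst x) = Q" "line (fst y) = Q'" "Q \<noteq> Q'"
      by blast
    then have x: "x \<in> GL2" "y \<in> GL2" "line (snd x) = P" "line (snd y) = P" "line (fst x) = Q"
      "line (fst y) = Q'" "Q \<noteq> Q'" unfolding block_def by blast+
    obtain a b where ab: "a \<noteq> 0" "b \<noteq> 0" "\<And>c. c \<noteq> 0 \<Longrightarrow>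
      (scl (c * a) (fst x), scl (c * b) (snd x)) \<in> torus P Q \<and>
      opA (scl (c * a) (fst x), scl (c * b) (snd x)) \<in> torus P Q'"
      using torus_exit[of x y 1] x by auto
    let ?f = "\<lambda>c. (scl (c * a) (fst x), scl (c * b) (snd x))"
    have f: "?f c \<in> {x \<in> block P. line (fst x) = Q \<and> line (fst (opA x)) = Q'}" if "c \<noteq> 0" for c
      using ab(3)[OF that] by (auto simp: block_def torus_def)
    have ne: "?f c \<noteq> ?f d" if "c \<noteq> d" for c d
      using that ab GL2_D(1)[OF x(1)] by (simp add: scl_eq_iff)
    have "\<alpha> \<noteq> 1" "\<alpha> ^ 2 \<noteq> 1" "\<alpha> \<noteq> \<alpha> ^ 2"
      using power_neq_1[of 1] power_neq_1[of 2] m by (auto simp: power2_eq_square)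
    then show "\<exists>C \<subseteq> {x \<in> block P. line (fst x) = Q \<and> line (fst (opA x)) = Q'}. card C = 3"
      by (intro card_3_distinct[of "?f 1" _ "?f \<alpha>" "?f (\<alpha> ^ 2)"] f ne) auto
  qed
  show ?thesis
  proof (rule HC)
    let ?\<beta> = "\<lambda>x :: 'a gl2. line (fst x)"
    have d: "det2 v u \<noteq> 0" "line u = P"
      using vu by (auto simp: block_def GL2_def)
    have uv: "det2 u v = - det2 v u" by (rule det2_anti)
    have "(add2 v (scl t u), u) \<in> block P" for t using d by (simp add: block_def GL2_def)
    then have "?\<beta> (add2 v (scl t u), u) \<in> ?\<beta> ` block P" for t by (rule imageI)
    then have img: "line (add2 v (scl t u)) \<in> ?\<beta> ` block P" for t by simp
    have ne: "line (add2 v (scl t u)) \<noteq> line (add2 v (scl s u))" if "t \<noteq> s" for s t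
    proof -
      have "det2 (add2 v (scl t u)) (add2 v (scl s u)) = (s - t) * det2 v u"
        using uv by (simp add: algebra_simps)
      moreover have "add2 v (scl t u) \<noteq> zero2" for t using d(1) det2_nz[of "add2 v (scl t u)" u] by simp
      ultimately show ?thesis using that d by (simp add: line_eq_iff)
    qed
    show "\<exists>C \<subseteq> ?\<beta> ` block P. card C = 3"
      by (rule card_3_distinct[OF img[of 0] img[of 1] img[of \<alpha>] ne ne ne]) (use alpha_neq_1 m in auto)
  qed
qed

end

subsection \<open>Odd order at least 7\<close>

context finite_field_generator
begin

text \<open>A step between tori whose parameters differ by \<open>x\<close> can be made by
  \<open>opA\<close> or by its inverse. The ratio of the factors of the two rows is then
  \<open>x\<close> or \<open>- x\<close>, and its quadratic character is the colour at which the
  step is taken, relative to the base point of the block.\<close>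

definition avail :: "'a \<Rightarrow> 'a \<Rightarrow> bool" where "avail x \<eta> \<longleftrightarrow> \<chi> x = \<eta> \<or> \<chi> (- x) = \<eta>"

lemma avail_uminus [simp]: "avail (- x) \<eta> = avail x \<eta>"
  by (auto simp: avail_def)

lemma avail_mult:
  assumes "avail x \<eta>" "avail y \<theta>"
  shows "avail (x * y) (\<eta> * \<theta>)"
proof -
  have "\<chi> (x * y) = \<chi> x * \<chi> y" "\<chi> (x * y) = \<chi> (- x) * \<chi> (- y)"
    "\<chi> (- (x * y)) = \<chi> (- x) * \<chi> y" "\<chi> (- (x * y)) = \<chi> x * \<chi> (- y)"
    using chi_mult[of x y] chi_mult[of "-x" "-y"] chi_mult[of "-x" y] chi_mult[of x "-y"] by simp_all
  then show ?thesis using assms unfolding avail_def by metis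
qed

text \<open>\<open>\<eta>\<close> is the relative colour at which the first torus is entered. The
  torus is left at the opposite colour, the row addition keeps that colour, and the next torus is
  entered with it.\<close>

fun alt :: "'a \<Rightarrow> 'a list \<Rightarrow> bool" where
  "alt \<eta> (t # t' # ts) \<longleftrightarrow> avail (t' - t) (- \<eta>) \<and> alt (- \<eta>) (t' # ts)"
| "alt \<eta> _ \<longleftrightarrow> True"

text \<open>The difference of two consecutive terms is
  \<open>x * \<beta> ^ k * (\<beta> - 1)\<close>. Every factor \<open>\<beta>\<close>, and likewise
  the factor \<open>\<beta> - 1\<close>, provides a change of sign.\<close>

lemma alt_geometric:
  assumes \<beta>: "avail \<beta> (-1)" "avail (\<beta> - 1) (-1)" and x: "avail x \<eta>"
  shows "alt \<eta> (map (\<lambda>k. t + x * \<beta> ^ k) [0..<n])"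
  using x
proof (induction n arbitrary: x \<eta>)
  case (Suc n)
  have *: "map (\<lambda>k. t + x * \<beta> ^ k) [0..<Suc n] = (t + x) # map (\<lambda>k. t + (x * \<beta>) * \<beta> ^ k) [0..<n]" for n x
    by (simp add: map_upt_Suc mult.assoc del: upt_Suc)
  show ?case
  proof (cases n)
    case (Suc n')
    have "avail (x * \<beta>) (- \<eta>)" using avail_mult[OF Suc.prems \<beta>(1)] by simp
    then have "alt (- \<eta>) (map (\<lambda>k. t + (x * \<beta>) * \<beta> ^ k) [0..<n])" by (rule Suc.IH)
    moreover have "t + x * \<beta> - (t + x) = x * (\<beta> - 1)" by (simp add: algebra_simps)
    then have "avail (t + x * \<beta> - (t + x)) (- \<eta>)" using avail_mult[OF Suc.prems \<beta>(2)] by simp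
    ultimately show ?thesis unfolding *[of x n] unfolding Suc unfolding *[of "x * \<beta>" n'] by simp
  qed simp
qed simp

end

locale odd_field = finite_field_generator +
  assumes even_m: "even m" and m6: "m \<ge> 6"
begin

lemmas chi_facts = chi_cases[OF even_m] chi_alpha[OF even_m] one_neq_minus_one[OF even_m]
  two_nz[OF even_m] chi_nz[OF even_m]

text \<open>If \<alpha> - 1 is a nonzero square, then the negative of \<alpha>^-1 - 1, which equals
  (\<alpha> - 1) \<alpha>^-1, is a non-square. As \<open>avail\<close> allows both signs, the
  inverse of \<alpha> then does what \<alpha> fails to do.\<close>

lemma ex_beta: "\<exists>\<beta> \<in> {\<alpha>, inverse \<alpha>}. avail \<beta> (-1) \<and> avail (\<beta> - 1) (-1)"
proof -
  have i: "\<chi> (inverse \<alpha>) = -1"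
    using chi_mult[of \<alpha> "inverse \<alpha>"] chi_facts(2) by (simp add: minus_equation_iff)
  have a1: "\<alpha> - 1 \<noteq> 0" using alpha_neq_1 m6 by simp
  show ?thesis
  proof (cases "\<chi> (\<alpha> - 1) = -1")
    case True
    then show ?thesis using chi_facts(2) by (auto simp: avail_def)
  next
    case False
    then have "\<chi> (\<alpha> - 1) = 1" using chi_facts(1)[OF a1] by blast
    moreover have "- (inverse \<alpha> - 1) = (\<alpha> - 1) * inverse \<alpha>" by (simp add: field_simps)
    ultimately have "\<chi> (- (inverse \<alpha> - 1)) = -1" by (simp only: chi_mult i) simp
    then show ?thesis using i by (auto simp: avail_def)
  qed
qed

lemma avail_cases: "x \<noteq> 0 \<Longrightarrow> avail x 1 \<or> avail x (-1)"
  using chi_facts(1) by (auto simp: avail_def)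

text \<open>The additive group ordered by a geometric progression, so that consecutive differences
  alternate between squares and non-squares.\<close>

lemma ex_alternating_order:
  assumes "t \<noteq> t'" "avail (t' - t) \<eta>"
  shows "\<exists>ts. distinct ts \<and> set ts = UNIV \<and> ts \<noteq> [] \<and> hd ts = t \<and> last ts = t' \<and> alt \<eta> ts \<and> odd (length ts)"
proof -
  obtain \<beta> where \<beta>: "\<beta> = \<alpha> \<or> \<beta> = inverse \<alpha>" "avail \<beta> (-1)" "avail (\<beta> - 1) (-1)" using ex_beta by auto
  \<comment> \<open>Since \<open>\<beta> ^ m\<close> is 1, this factor makes the last term
    \<open>t + x * \<beta> ^ (m - 1)\<close> of the progression equal to \<open>t'\<close>.\<close>
  define x where "x = \<beta> * (t' - t)"
  have nz: "\<beta> \<noteq> 0" "x \<noteq> 0" using \<beta>(1) assms(1) by (auto simp: x_def)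
  have x: "avail x (- \<eta>)" using avail_mult[OF \<beta>(2) assms(2)] by (simp add: x_def)
  have inj: "inj_on (\<lambda>k. \<beta> ^ k) {..<m}"
    using \<beta>(1) inj_powers by (auto simp: inj_on_def power_inverse)
  define l where "l = map (\<lambda>k. t + x * \<beta> ^ k) [0..<m]"
  have l: "distinct l" "t \<notin> set l" "length l = m" "l \<noteq> []"
    using inj nz m6 by (auto simp: l_def distinct_map inj_on_def)
  have "\<beta> * \<beta> ^ (m - 1) = 1"
    using \<beta>(1) alpha_m m6 by (auto simp: power_inverse simp flip: power_Suc)
  then have "x * \<beta> ^ (m - 1) = t' - t" by (simp add: x_def mult_ac)
  then have last: "last l = t'" using m6 by (simp add: l_def last_map)
  have hd: "hd l = t + x" using m6 by (simp add: l_def hd_map)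
  have "alt (- \<eta>) l" unfolding l_def using \<beta>(2,3) x by (rule alt_geometric)
  then have "alt \<eta> (t # l)" using l(4) hd x by (cases l) auto
  moreover have "set (t # l) = UNIV"
  proof -
    have "card (set (t # l)) = CARD('a)" using l distinct_card[of "t # l"] card_field by simp
    then show ?thesis by (intro card_eq_UNIV_imp_eq_UNIV) simp_all
  qed
  ultimately show ?thesis using l last even_m by (intro exI[of _ "t # l"]) auto
qed

text \<open>Row additions at vertices of \<open>F\<close> are forbidden. A path then reaches a
  vertex \<open>b\<close> of \<open>F\<close> only along a scaling, hence from a vertex with the
  same two lines and the opposite colour; this gives control over the vertex at which a path is cut
  before \<open>b\<close>.\<close>

definition EF :: "'a gl2 set \<Rightarrow> 'a gl2 \<Rightarrow> 'a gl2 \<Rightarrow> bool" where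
  "EF F x y \<longleftrightarrow> M_edge \<alpha> x y \<or> A_edge x y \<and> x \<notin> F \<and> y \<notin> F"

lemma symp_EF: "symp (EF F)"
  using symp_edges(1,3) unfolding symp_def EF_def by blast

lemma EF_E2: "EF F x y \<Longrightarrow> E2 \<alpha> x y"
  by (auto simp: EF_def E2_def)

lemma three_nonzero: "\<exists>a. a \<noteq> 0 \<and> a \<noteq> b \<and> a \<noteq> (c::'a)"
proof (rule ccontr)
  assume "\<not> ?thesis"
  then have "UNIV \<subseteq> {0, b, c}" by auto
  then have "CARD('a) \<le> card {0, b, c}" by (intro card_mono) auto
  also have "\<dots> \<le> 3" by (simp add: card_insert_if)
  finally show False using card_field m6 by simp
qed

lemma kappa_M_edge: "x \<in> GL2 \<Longrightarrow> M_edge \<alpha> x y \<Longrightarrow> \<kappa> y = - \<kappa> x"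
  using chi_facts(2) by (auto simp: M_edge_def \<kappa>_def chi_mult)

lemma line_M_edge:
  assumes "M_edge \<alpha> x y"
  shows "line (fst y) = line (fst x)" "line (snd y) = line (snd x)"
  using assms by (auto simp: M_edge_def)

lemma kappa_cases: "x \<in> GL2 \<Longrightarrow> \<kappa> x = 1 \<or> \<kappa> x = -1"
  unfolding \<kappa>_def GL2_def using chi_facts(1) by blast

lemma kappa_neq: "x \<in> GL2 \<Longrightarrow> - \<kappa> x \<noteq> \<kappa> x"
  using kappa_cases[of x] chi_facts(3) by (metis minus_minus)

lemma kappa_eq_or: "x \<in> GL2 \<Longrightarrow> y \<in> GL2 \<Longrightarrow> \<kappa> y = \<kappa> x \<or> \<kappa> y = - \<kappa> x"
  using kappa_cases[of x] kappa_cases[of y] by auto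

context
  fixes v u :: "'a vec2"
  assumes vu: "(v, u) \<in> GL2"
begin

text \<open>The top rows in the block of \<open>u\<close> span exactly the lines of v + t u. An
  ordering of the tori of the block is therefore an ordering of the field.\<close>

definition ray :: "'a \<Rightarrow> 'a vec2" where "ray t = add2 v (scl t u)"

lemma det_vu: "det2 v u \<noteq> 0" "u \<noteq> zero2"
  using vu GL2_D(2)[OF vu] by (auto simp: GL2_def)

lemma det_ray: "det2 (ray t) u = det2 v u" "ray t \<noteq> zero2"
  using det_vu det2_nz[of "ray t" u] by (auto simp: ray_def)

lemma line_ray_eq_iff: "line (ray t) = line (ray s) \<longleftrightarrow> t = s"
proof -
  have "det2 u v = - det2 v u" by (rule det2_anti)
  then have "det2 (ray t) (ray s) = (s - t) * det2 v u" by (simp add: ray_def algebra_simps)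
  then show ?thesis using det_vu det_ray by (auto simp: line_eq_iff)
qed

definition rtorus :: "'a \<Rightarrow> 'a gl2 set" where "rtorus t = torus (line u) (line (ray t))"

lemma rtorusI: "a \<noteq> 0 \<Longrightarrow> c \<noteq> 0 \<Longrightarrow> (scl a (ray t), scl c u) \<in> rtorus t"
  using det_ray det_vu by (auto simp: rtorus_def torus_def GL2_def)

lemma rtorus_disjoint: "x \<in> rtorus t \<Longrightarrow> x \<in> rtorus s \<Longrightarrow> t = s"
  using line_ray_eq_iff[of t s] by (simp add: rtorus_def torus_def)

lemma block_rtorus: "block (line u) = (\<Union>t. rtorus t)"
proof -
  have "\<exists>t. x \<in> rtorus t" if x: "x \<in> block (line u)" for x
  proof -
    obtain a b where ab: "fst x = add2 (scl a v) (scl b u)" using basis2[OF det_vu(1)] by metis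
    have xg: "x \<in> GL2" "line (snd x) = line u" using x by (auto simp: block_def)
    have "a \<noteq> 0"
    proof
      assume "a = 0"
      then have f: "fst x = scl b u" using ab by (simp add: prod_eq_iff)
      then have "b \<noteq> 0" using GL2_D(1)[OF xg(1)] by auto
      then show False using f xg GL2_D(3)[OF xg(1)] by simp
    qed
    then have "fst x = scl a (ray (b / a))" using ab by (simp add: ray_def prod_eq_iff algebra_simps)
    then have "line (fst x) = line (ray (b / a))" using \<open>a \<noteq> 0\<close> by simp
    then show ?thesis using xg by (auto simp: rtorus_def torus_def)
  qed
  moreover have "rtorus t \<subseteq> block (line u)" for t by (auto simp: rtorus_def torus_def block_def)
  ultimately show ?thesis by blast
qed

text \<open>The common factor \<open>a\<close> of the two rows changes the determinant by a
  square.\<close>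

lemma kappa_ray: "a \<noteq> 0 \<Longrightarrow> \<kappa> (scl a (ray t), scl (a * r) u) = \<chi> r * \<kappa> (v, u)"
  using chi_facts(1)[of a] det_ray by (auto simp: \<kappa>_def chi_mult)

lemma rtorus_exit:
  assumes t: "t \<noteq> t'" and av: "avail (t' - t) \<eta>"
  obtains x y where "x \<in> rtorus t" "y \<in> rtorus t'" "EF {f1, f2} x y"
    "\<kappa> x = \<eta> * \<kappa> (v, u)" "\<kappa> y = \<eta> * \<kappa> (v, u)"
proof -
  obtain r where r: "r = t' - t \<or> r = - (t' - t)" "\<chi> r = \<eta>" using av unfolding avail_def by blast
  then have r0: "r \<noteq> 0" using t by auto
  \<comment> \<open>Through its bottom row, each of \<open>f1\<close> and \<open>f2\<close> rules
    out at most one scalar \<open>a\<close>.\<close>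
  obtain b1 where b1: "\<And>a. a \<noteq> b1 \<Longrightarrow> scl (a * r) u \<noteq> snd f1"
    using r0 det_vu(2) by (metis scl_eq_iff mult_right_cancel)
  obtain b2 where b2: "\<And>a. a \<noteq> b2 \<Longrightarrow> scl (a * r) u \<noteq> snd f2"
    using r0 det_vu(2) by (metis scl_eq_iff mult_right_cancel)
  obtain a where a: "a \<noteq> 0" "a \<noteq> b1" "a \<noteq> b2" using three_nonzero by blast
  let ?x = "(scl a (ray t), scl (a * r) u)" and ?y = "(scl a (ray t'), scl (a * r) u)"
  have "A_edge ?x ?y"
    using r(1) by (auto simp: A_edge_def opA_def ray_def prod_eq_iff algebra_simps)
  moreover have "?x \<notin> {f1, f2}" "?y \<notin> {f1, f2}" using b1[OF a(2)] b2[OF a(3)] by auto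
  ultimately have "EF {f1, f2} ?x ?y" by (simp add: EF_def)
  then show thesis
    using that[of ?x ?y] rtorusI[of a "a * r"] kappa_ray[OF a(1)] a(1) r0 r(2) by simp
qed

text \<open>Inside a torus the path goes to the opposite colour, between two tori the colour stays.
  Hence the number of tori determines the colour of \<open>y\<close>.\<close>

lemma torus_chain:
  assumes "distinct ts" "ts \<noteq> []" "alt \<eta> ts" "x \<in> rtorus (hd ts)" "y \<in> rtorus (last ts)"
    "\<kappa> x = \<eta> * \<kappa> (v, u)" "\<kappa> y = (- 1) ^ length ts * \<kappa> x"
  shows "hp (EF {f1, f2}) (\<Union>t\<in>set ts. rtorus t) x y"
  using assms
proof (induction \<eta> ts arbitrary: x rule: alt.induct)
  case (1 \<eta> t t' ts)
  obtain x' y' where xy: "x' \<in> rtorus t" "y' \<in> rtorus t'" "EF {f1, f2} x' y'"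
    "\<kappa> x' = - \<eta> * \<kappa> (v, u)" "\<kappa> y' = - \<eta> * \<kappa> (v, u)"
    by (rule rtorus_exit[of t t' "- \<eta>" f1 f2]) (use 1(2,4) in auto)
  have xG: "x \<in> GL2" using 1(5) by (simp add: rtorus_def torus_def)
  have k: "\<kappa> x' = - \<kappa> x" "\<kappa> y' = - \<kappa> x" using xy 1 by simp_all
  then have "\<kappa> x \<noteq> \<kappa> x'" using kappa_neq[OF xG] by metis
  then have "hp (M_edge \<alpha>) (rtorus t) x x'"
    using xy(1) 1(5) m6 unfolding rtorus_def by (intro torus_path) auto
  then have p1: "hp (EF {f1, f2}) (rtorus t) x x'" by (rule hp_mono) (simp add: EF_def)
  have p2: "hp (EF {f1, f2}) (\<Union>t\<in>set (t' # ts). rtorus t) y' y"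
    using 1 xy k by (intro "1.IH") auto
  have "rtorus t \<inter> (\<Union>t\<in>set (t' # ts). rtorus t) = {}" using 1(2) rtorus_disjoint[of _ t] by fastforce
  then have "hp (EF {f1, f2}) (rtorus t \<union> (\<Union>t\<in>set (t' # ts). rtorus t)) x y"
    by (rule hp_append[OF p1 xy(3) p2])
  then show ?case by simp
next
  case ("2_1" \<eta>)
  then show ?case by simp
next
  case ("2_2" \<eta> t)
  have xG: "x \<in> GL2" using "2_2" by (simp add: rtorus_def torus_def)
  have "\<kappa> y = - \<kappa> x" using "2_2" by simp
  then have "\<kappa> x \<noteq> \<kappa> y" using kappa_neq[OF xG] by metis
  then have "hp (M_edge \<alpha>) (rtorus t) x y"
    using "2_2" m6 unfolding rtorus_def by (intro torus_path) auto
  then have "hp (EF {f1, f2}) (rtorus t) x y" by (rule hp_mono) (simp add: EF_def)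
  then show ?case by simp
qed

end

text \<open>With \<open>x\<close> as base point, a chain from \<open>x\<close> to \<open>y\<close>
  begins with the relative colour 1, which requires \<open>avail t 1\<close> for the parameter
  \<open>t\<close> of the torus of \<open>y\<close>. Otherwise the sign -1 is available, and that is
  what the chain from \<open>y\<close> to \<open>x\<close> requires.\<close>

lemma block_path:
  assumes x: "x \<in> block P" "y \<in> block P" "line (fst x) \<noteq> line (fst y)" "\<kappa> y = - \<kappa> x"
  shows "hp (EF {f1, f2}) (block P) x y"
proof -
  obtain v u where vu: "x = (v, u)" by (rule prod.exhaust)
  have G: "(v, u) \<in> GL2" "P = line u" using x(1) vu by (auto simp: block_def)
  have r0: "ray v u 0 = v" by (simp add: ray_def[OF G(1)] prod_eq_iff)
  have x0: "x \<in> rtorus v u 0" using rtorusI[OF G(1), of 1 1 0] vu r0 by simp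
  obtain t where y: "y \<in> rtorus v u t" using x(2) block_rtorus[OF G(1)] G(2) by auto
  have t: "t \<noteq> 0" using x(3) x0 y by (auto simp: rtorus_def[OF G(1)] torus_def)
  have U: "(\<Union>t\<in>UNIV. rtorus v u t) = block P" using block_rtorus[OF G(1)] G(2) by simp
  show ?thesis
  proof (cases "avail t 1")
    case True
    then obtain ts where ts: "distinct ts" "set ts = UNIV" "ts \<noteq> []" "hd ts = 0" "last ts = t" "alt 1 ts" "odd (length ts)"
      using ex_alternating_order[of 0 t 1] t by auto
    have "hp (EF {f1, f2}) (\<Union>t\<in>set ts. rtorus v u t) x y"
      using ts x x0 y vu by (intro torus_chain[OF G(1), of ts 1]) auto
    then show ?thesis using ts U by simp
  next
    case False
    then have "avail (0 - t) (-1)" using avail_cases[OF t] by simp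
    then obtain ts where ts: "distinct ts" "set ts = UNIV" "ts \<noteq> []" "hd ts = t" "last ts = 0" "alt (-1) ts" "odd (length ts)"
      using ex_alternating_order[of t 0 "-1"] t by auto
    have "hp (EF {f1, f2}) (\<Union>t\<in>set ts. rtorus v u t) y x"
      using ts x x0 y vu by (intro torus_chain[OF G(1), of ts "-1"]) auto
    then show ?thesis using ts U hp_rev[OF symp_EF] by simp
  qed
qed

end

section \<open>The blocks as points of the projective line, and the chains of blocks\<close>

definition lines :: "'a::field vec2 set set" where
  "lines = line ` {u. u \<noteq> zero2}"

lemma lines_fst [simp]: "x \<in> GL2 \<Longrightarrow> line (fst x) \<in> lines"
  and lines_snd [simp]: "x \<in> GL2 \<Longrightarrow> line (snd x) \<in> lines"
  using GL2_D(1,2)[of x] by (auto simp: lines_def)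

lemma block_lines: "x \<in> block P \<Longrightarrow> P \<in> lines"
  unfolding block_def using lines_snd by blast

lemma GL2_blocks: "GL2 = (\<Union>P\<in>lines. block P)"
  unfolding block_def using lines_snd by blast

lemma block_disjoint: "P \<noteq> P' \<Longrightarrow> block P \<inter> block P' = {}"
  by (auto simp: block_def)

text \<open>For the values 1 and -1 of \<open>\<sigma>\<close> these are the two neighbours along
  additions of the top row to the bottom row. They keep the top row and lie in different blocks if 1
  and -1 differ, so the choice of the sign can avoid one given block.\<close>

definition nbB :: "'a::field \<Rightarrow> 'a gl2 \<Rightarrow> 'a gl2" where
  "nbB \<sigma> x = (fst x, add2 (snd x) (scl \<sigma> (fst x)))"

lemma nbB_edge: "\<sigma> = 1 \<or> \<sigma> = -1 \<Longrightarrow> B_edge x (nbB \<sigma> x)"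
  by (auto simp: nbB_def B_edge_def opB_def prod_eq_iff)

lemma nbB_GL2 [simp]: "nbB \<sigma> x \<in> GL2 \<longleftrightarrow> x \<in> GL2"
  by (simp add: nbB_def GL2_def)

lemma fst_nbB [simp]: "fst (nbB \<sigma> x) = fst x"
  by (simp add: nbB_def)

lemma opB_nbB: "opB x = nbB 1 x"
  by (simp add: opB_def nbB_def)

lemma line_nbB:
  assumes x: "x \<in> GL2"
  shows "line (snd (nbB \<sigma> x)) \<noteq> line (fst x)"
    and "\<sigma> \<noteq> 0 \<Longrightarrow> line (snd (nbB \<sigma> x)) \<noteq> line (snd x)"
    and "\<sigma> \<noteq> \<tau> \<Longrightarrow> line (snd (nbB \<sigma> x)) \<noteq> line (snd (nbB \<tau> x))"
proof -
  have nz: "snd (nbB \<sigma> x) \<noteq> zero2" for \<sigma> using GL2_D(2)[of "nbB \<sigma> x"] x by simp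
  have d: "det2 (fst x) (snd x) \<noteq> 0" using x by (simp add: GL2_def)
  have a: "det2 (snd x) (fst x) = - det2 (fst x) (snd x)" by (rule det2_anti)
  show "line (snd (nbB \<sigma> x)) \<noteq> line (fst x)" using GL2_D(3)[of "nbB \<sigma> x"] x by simp
  show "line (snd (nbB \<sigma> x)) \<noteq> line (snd x)" if "\<sigma> \<noteq> 0"
  proof -
    have "det2 (snd (nbB \<sigma> x)) (snd x) = \<sigma> * det2 (fst x) (snd x)" by (simp add: nbB_def)
    then show ?thesis using that d nz GL2_D(2)[OF x] by (simp add: line_eq_iff)
  qed
  show "line (snd (nbB \<sigma> x)) \<noteq> line (snd (nbB \<tau> x))" if "\<sigma> \<noteq> \<tau>"
  proof -
    have "det2 (snd (nbB \<sigma> x)) (snd (nbB \<tau> x)) = (\<sigma> - \<tau>) * det2 (fst x) (snd x)"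
      using a by (simp add: nbB_def algebra_simps)
    then show ?thesis using that d nz by (simp add: line_eq_iff)
  qed
qed

context odd_field
begin

lemma card_lines: "card (lines :: 'a vec2 set set) = Suc (Suc m)"
proof -
  let ?L = "\<lambda>t :: 'a. line (1, t)"
  have "lines = insert (line (0, 1)) (range ?L)"
  proof (intro Set.set_eqI iffI)
    fix P :: "'a vec2 set" assume "P \<in> lines"
    then obtain u where u: "P = line u" "u \<noteq> zero2" by (auto simp: lines_def)
    show "P \<in> insert (line (0, 1)) (range ?L)"
    proof (cases "fst u = 0")
      case True
      then have "line u = line (0, 1)" using u(2) by (simp add: line_eq_iff det2_def)
      then show ?thesis using u by simp
    next
      case False
      then have "line u = ?L (snd u / fst u)" using u(2) by (simp add: line_eq_iff det2_def)
      then show ?thesis unfolding u(1) by blast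
    qed
  next
    fix P :: "'a vec2 set" assume "P \<in> insert (line (0, 1)) (range ?L)"
    moreover have "line (0, 1) \<in> lines" "?L t \<in> lines" for t unfolding lines_def by (rule imageI, simp)+
    ultimately show "P \<in> lines" by blast
  qed
  moreover have "card (insert (line (0, 1)) (range ?L)) = Suc (card (range ?L))"
  proof (rule card_insert_disjoint)
    show "line (0, 1) \<notin> range ?L"
    proof
      assume "line (0, 1) \<in> range ?L"
      then obtain t where "line (0, 1) = ?L t" by blast
      then show False by (simp add: line_eq_iff det2_def)
    qed
  qed simp
  moreover have "card (range ?L) = Suc m"
  proof -
    have "inj ?L" by (rule injI) (simp add: line_eq_iff det2_def)
    then show ?thesis using card_image[of ?L UNIV] card_field by metis
  qed
  ultimately show ?thesis by metis
qed

lemma kappa_nbB [simp]: "\<kappa> (nbB \<sigma> x) = \<kappa> x"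
  by (simp add: \<kappa>_def nbB_def)

lemma nbB_block: "x \<in> GL2 \<Longrightarrow> nbB \<sigma> x \<in> block (line (snd (nbB \<sigma> x)))"
  by (simp add: block_def)

lemma ex_nbB:
  fixes x :: "'a gl2"
  assumes "x \<in> GL2"
  obtains \<sigma> where "\<sigma> = 1 \<or> \<sigma> = -1" "\<sigma> \<noteq> 0" "line (snd (nbB \<sigma> x)) \<noteq> X"
proof -
  have "line (snd (nbB 1 x)) \<noteq> line (snd (nbB (-1) x))" using chi_facts(3) by (intro line_nbB(3)[OF assms])
  then show thesis using that[of 1] that[of "-1"] by auto
qed

text \<open>\<open>l0\<close> sets the colour, and the even powers of \<alpha> vary the line of the
  top row without disturbing it. The two lines \<open>Q1\<close> and \<open>Q2\<close> can be
  avoided because 1, \<open>\<alpha> ^ 2\<close> and \<open>\<alpha> ^ 4\<close> are distinct; this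
  is where q = 5 would fail.\<close>

lemma block_exit:
  assumes P: "P \<in> lines" "P' \<in> lines" "P \<noteq> P'" and \<eta>: "\<eta> = 1 \<or> \<eta> = -1"
  obtains f where "f \<in> block P" "\<kappa> f = \<eta>" "opB f \<in> block P'" "line (fst f) \<noteq> Q1" "line (fst f) \<noteq> Q2"
proof -
  obtain u w where u: "P = line u" "u \<noteq> zero2" "P' = line w" "w \<noteq> zero2" using P by (auto simp: lines_def)
  have d: "det2 w u \<noteq> 0" using P(3) u by (simp add: line_eq_iff) (metis det2_anti neg_equal_0_iff_equal)
  define l0 where "l0 = (if \<chi> (det2 w u) = \<eta> then 1 else \<alpha>)"
  have l0: "l0 \<noteq> 0" "\<chi> l0 * \<chi> (det2 w u) = \<eta>"
    using \<eta> chi_facts(1)[OF d] chi_facts(2) by (auto simp: l0_def)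
  define f where "f k = (add2 (scl (l0 * \<alpha> ^ (2 * k)) w) (scl (- 1) u), u)" for k :: nat
  have fd: "det2 (fst (f k)) (snd (f k)) = l0 * \<alpha> ^ (2 * k) * det2 w u" for k by (simp add: f_def)
  have fG: "f k \<in> GL2" for k using fd l0 d by (simp add: GL2_def)
  have fP: "f k \<in> block P" for k using fG u by (simp add: block_def) (simp add: f_def)
  have fk: "\<kappa> (f k) = \<eta>" for k
    using l0(2) chi_facts(2) by (simp add: \<kappa>_def fd chi_mult chi_power power_mult)
  have "snd (opB (f k)) = scl (l0 * \<alpha> ^ (2 * k)) w" for k by (simp add: opB_def f_def prod_eq_iff)
  then have fP': "opB (f k) \<in> block P'" for k using fG l0 u by (simp add: block_def)
  have ne: "line (fst (f j)) \<noteq> line (fst (f k))" if "\<alpha> ^ (2 * j) \<noteq> \<alpha> ^ (2 * k)" for j k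
  proof -
    have "det2 u w = - det2 w u" by (rule det2_anti)
    then have "det2 (fst (f j)) (fst (f k)) = l0 * (\<alpha> ^ (2 * k) - \<alpha> ^ (2 * j)) * det2 w u"
      by (simp add: f_def algebra_simps)
    then show ?thesis using that d l0 GL2_D(1)[OF fG] by (simp add: line_eq_iff)
  qed
  have a2: "\<alpha> ^ 2 \<noteq> 1" and a4: "\<alpha> ^ 4 \<noteq> 1" using power_neq_1[of 2] power_neq_1[of 4] m6 by simp_all
  have a24: "\<alpha> ^ 2 \<noteq> \<alpha> ^ 4"
  proof
    have "\<alpha> ^ 4 = \<alpha> ^ 2 * \<alpha> ^ 2" by (simp flip: power_add)
    moreover assume "\<alpha> ^ 2 = \<alpha> ^ 4"
    ultimately have "\<alpha> ^ 2 * 1 = \<alpha> ^ 2 * \<alpha> ^ 2" by (simp only: mult_1_right)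
    then show False using a2 by (simp only: mult_cancel_left) simp
  qed
  have "line (fst (f 0)) \<noteq> line (fst (f 1))" by (rule ne) (use a2 in simp)
  moreover have "line (fst (f 0)) \<noteq> line (fst (f 2))" by (rule ne) (use a4 in simp)
  moreover have "line (fst (f 1)) \<noteq> line (fst (f 2))" by (rule ne) (use a24 in simp)
  ultimately have "\<exists>k. line (fst (f k)) \<noteq> Q1 \<and> line (fst (f k)) \<noteq> Q2" by metis
  then show thesis using that fP fk fP' by blast
qed

lemma block_path_E2:
  assumes "x \<in> block P" "y \<in> block P" "line (fst x) \<noteq> line (fst y)" "\<kappa> y = - \<kappa> x"
  shows "hp (E2 \<alpha>) (block P) x y"
  using block_path[OF assms, of x x] EF_E2 by (rule hp_mono)

text \<open>A block changes the colour and \<open>opB\<close> keeps it. The exit \<open>f\<close>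
  avoids the line of \<open>x\<close>, because the ends of \<open>block_path\<close> need different
  lines, and also that of \<open>y\<close>: \<open>opB\<close> keeps the top row, so the entry into
  a final block is fit for \<open>block_path\<close> as well.\<close>

lemma block_chain:
  assumes "distinct (P # Ps)" "set (P # Ps) \<subseteq> lines" "x \<in> block P" "y \<in> block (last (P # Ps))"
    "\<kappa> y = (- 1) ^ length (P # Ps) * \<kappa> x" "Ps = [] \<Longrightarrow> line (fst x) \<noteq> line (fst y)"
  shows "hp (E2 \<alpha>) (\<Union>P\<in>set (P # Ps). block P) x y"
  using assms
proof (induction Ps arbitrary: P x)
  case Nil
  then show ?case using block_path_E2[of x P y] by simp
next
  case (Cons P' Ps)
  have xG: "x \<in> GL2" using Cons.prems by (simp add: block_def)
  obtain f where f: "f \<in> block P" "\<kappa> f = - \<kappa> x" "opB f \<in> block P'"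
    "line (fst f) \<noteq> line (fst x)" "line (fst f) \<noteq> line (fst y)"
    by (rule block_exit[of P P' "- \<kappa> x" "line (fst x)" "line (fst y)"])
      (use Cons.prems kappa_cases[OF xG] in auto)
  have 1: "hp (E2 \<alpha>) (block P) x f"
    by (rule block_path_E2[OF Cons.prems(3) f(1) f(4)[symmetric] f(2)])
  have 2: "hp (E2 \<alpha>) (\<Union>P\<in>set (P' # Ps). block P) (opB f) y"
  proof (rule Cons.IH)
    show "y \<in> block (last (P' # Ps))" using Cons.prems(4) by simp
    show "\<kappa> y = (- 1) ^ length (P' # Ps) * \<kappa> (opB f)" using Cons.prems(5) f(2) by (simp add: opB_nbB)
    show "line (fst (opB f)) \<noteq> line (fst y)" using f(5) by (simp add: opB_nbB)
  qed (use Cons.prems(1,2) f(3) in auto)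
  have "block P \<inter> (\<Union>P\<in>set (P' # Ps). block P) = {}" using Cons.prems(1) block_disjoint[of P] by fastforce
  then have "hp (E2 \<alpha>) (block P \<union> (\<Union>P\<in>set (P' # Ps). block P)) x y"
    by (rule hp_append[OF 1 E2_intros(2) 2])
  then show ?case by simp
qed

lemma block_chain_set:
  assumes I: "I \<subseteq> lines" "P \<in> I" "P' \<in> I" "P \<noteq> P'" and x: "x \<in> block P" "y \<in> block P'"
    and k: "\<kappa> y = (- 1) ^ card I * \<kappa> x"
  shows "hp (E2 \<alpha>) (\<Union>P\<in>I. block P) x y"
proof -
  obtain xs where xs: "distinct xs" "set xs = I - {P, P'}" using finite_distinct_list[of "I - {P, P'}"] by auto
  have s: "set (P # xs @ [P']) = I" using xs I by auto
  have d: "distinct (P # xs @ [P'])" using xs I by auto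
  have "length (P # xs @ [P']) = card I" using distinct_card[OF d] s by simp
  then have "\<kappa> y = (- 1) ^ length (P # xs @ [P']) * \<kappa> x" using k by simp
  then have "hp (E2 \<alpha>) (\<Union>P\<in>set (P # xs @ [P']). block P) x y"
    using x I by (intro block_chain d) (simp_all only: s, simp_all)
  then show ?thesis by (simp only: s)
qed

end

section \<open>The detours that correct the parity\<close>

context odd_field
begin

lemma blockD: "x \<in> block P \<Longrightarrow> x \<in> GL2" "x \<in> block P \<Longrightarrow> line (snd x) = P"
  by (simp_all add: block_def)

lemma E2_nbB: "\<sigma> = 1 \<or> \<sigma> = -1 \<Longrightarrow> E2 \<alpha> x (nbB \<sigma> x)" "\<sigma> = 1 \<or> \<sigma> = -1 \<Longrightarrow> E2 \<alpha> (nbB \<sigma> x) x"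
  using nbB_edge[of \<sigma> x] symp_edges(2) E2_intros(5) by (blast dest: sympD)+

lemma blocks_Un:
  assumes "I \<union> J = K"
  shows "(\<Union>P\<in>I. block P) \<union> (\<Union>P\<in>J. block P) = (\<Union>P\<in>K. block P)"
  using assms by blast

lemma blocks_Int:
  assumes "I \<inter> J = {}"
  shows "(\<Union>P\<in>I. block P) \<inter> (\<Union>P\<in>J. block P) = {}"
proof -
  have "P \<noteq> P'" if "P \<in> I" "P' \<in> J" for P P' using assms that by blast
  then show ?thesis using block_disjoint by blast
qed

lemma blocks_complement:
  "J \<subseteq> lines \<Longrightarrow> (\<Union>P\<in>J. block P) \<union> (\<Union>P\<in>lines - J. block P) = GL2"
  unfolding GL2_blocks by blast

lemma EF_pathE:
  assumes "hp (EF F) S x y" "b \<in> S" "b \<noteq> x" "b \<in> F" "S \<subseteq> block P"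
  obtains S1 S2 w where "hp (E2 \<alpha>) S1 x w" "w \<in> S1" "hp (E2 \<alpha>) S2 b y" "S = S1 \<union> S2" "S1 \<inter> S2 = {}"
    "w \<in> GL2" "line (snd w) = P" "line (fst w) = line (fst b)" "\<kappa> w = - \<kappa> b"
proof -
  obtain S1 S2 w where s: "hp (EF F) S1 x w" "EF F w b" "hp (EF F) S2 b y" "S = S1 \<union> S2" "S1 \<inter> S2 = {}"
    using hp_split_pred[OF assms(1-3)] by metis
  have w: "w \<in> S1" using hp_end[OF s(1)] .
  then have wP: "w \<in> GL2" "line (snd w) = P" using s(4) assms(5) blockD by blast+
  have M: "M_edge \<alpha> w b" using s(2) assms(4) by (auto simp: EF_def)
  have "\<kappa> b = - \<kappa> w" by (rule kappa_M_edge[OF wP(1) M])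
  then show thesis using that[of S1 w S2] s w wP line_M_edge[OF M] hp_mono[OF s(1) EF_E2] hp_mono[OF s(3) EF_E2]
    by simp
qed

text \<open>The number q + 1 of all blocks is even, so the chain through the blocks outside
  \<open>J\<close> has the parity of \<open>j\<close>.\<close>

lemma other_blocks_path:
  assumes "x \<in> block P1" "y \<in> block P2" "P1 \<noteq> P2" "P1 \<notin> J" "P2 \<notin> J" "J \<subseteq> lines" "card J = j"
    "\<kappa> y = (- 1) ^ j * \<kappa> x"
  shows "hp (E2 \<alpha>) (\<Union>P\<in>lines - J. block P) x y"
proof (rule block_chain_set[OF _ _ _ assms(3) assms(1,2)])
  show "P1 \<in> lines - J" "P2 \<in> lines - J" using assms block_lines by blast+
  have "card (lines - J) + j = m + 2"
    using card_Diff_subset[of J lines] assms(6,7) card_lines card_mono[of "lines :: 'a vec2 set set" J]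
    by simp
  then have "even (card (lines - J)) \<longleftrightarrow> even j" using even_m by (metis even_add odd_two_times_div_two_nat even_numeral)
  then show "\<kappa> y = (- 1) ^ card (lines - J) * \<kappa> x" using assms(8) by (cases "even j") simp_all
qed blast

text \<open>\<open>P\<close> is left at \<open>w\<close>, just before \<open>b\<close>, and entered
  again at \<open>Y\<close>, from where the rest of its path leads backwards to \<open>b\<close>. In
  between come the q other blocks, an odd number, which agrees with the opposite colours of
  \<open>w\<close> and \<open>Y\<close>.\<close>

lemma path_same_block_opposite:
  assumes a: "a \<in> block P" "b \<in> block P" "\<kappa> b = - \<kappa> a"
  shows "hp (E2 \<alpha>) GL2 a b"
proof -
  note aG = blockD[OF a(1)] and bG = blockD[OF a(2)]
  have ab: "b \<noteq> a" using kappa_neq[OF aG(1)] a(3) by metis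
  have P: "P \<in> lines" by (rule block_lines[OF a(1)])
  have ne: "P \<noteq> line (fst a)" using GL2_D(3)[OF aG(1)] aG(2) by metis
  obtain Y where Y: "Y \<in> block P" "\<kappa> Y = - \<kappa> a" "line (fst Y) \<noteq> line (fst a)"
    by (rule block_exit[of P "line (fst a)" "- \<kappa> a" "line (fst a)"])
      (use P ne aG kappa_cases[OF aG(1)] in auto)
  note YG = blockD[OF Y(1)]
  have J: "hp (EF {b, b}) (block P) a Y" by (rule block_path[OF a(1) Y(1) Y(3)[symmetric] Y(2)])
  obtain S1 S2 w where s: "hp (E2 \<alpha>) S1 a w" "w \<in> S1" "hp (E2 \<alpha>) S2 b Y" "block P = S1 \<union> S2" "S1 \<inter> S2 = {}"
    "w \<in> GL2" "line (snd w) = P" "line (fst w) = line (fst b)" "\<kappa> w = - \<kappa> b"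
    by (rule EF_pathE[OF J a(2) ab]) auto
  obtain \<sigma> where \<sigma>: "\<sigma> = 1 \<or> \<sigma> = -1" "\<sigma> \<noteq> 0" "line (snd (nbB \<sigma> w)) \<noteq> line (snd (nbB 1 Y))"
    by (rule ex_nbB[OF s(6)])
  let ?C = "\<Union>P\<in>lines - {P}. block P"
  have C: "hp (E2 \<alpha>) ?C (nbB \<sigma> w) (nbB 1 Y)"
  proof (rule other_blocks_path[OF nbB_block nbB_block \<sigma>(3)])
    show "w \<in> GL2" "Y \<in> GL2" using s YG by auto
    show "line (snd (nbB \<sigma> w)) \<notin> {P}" using line_nbB(2)[OF s(6) \<sigma>(2)] s(7) by simp
    show "line (snd (nbB 1 Y)) \<notin> {P}" using line_nbB(2)[OF YG(1), of 1] YG(2) by simp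
    show "\<kappa> (nbB 1 Y) = (- 1) ^ 1 * \<kappa> (nbB \<sigma> w)" using s(9) Y(2) a(3) by simp
  qed (use P in auto)
  have d: "S1 \<inter> (?C \<union> S2) = {}" "?C \<inter> S2 = {}"
  proof -
    have "block P \<inter> ?C = {}" using blocks_Int[of "{P}" "lines - {P}"] by simp
    then show "S1 \<inter> (?C \<union> S2) = {}" "?C \<inter> S2 = {}" using s(4,5) by blast+
  qed
  have "hp (E2 \<alpha>) (?C \<union> S2) (nbB \<sigma> w) b"
    by (rule hp_append[OF C E2_nbB(2) hp_rev[OF symp_edges(4) s(3)] d(2)]) simp
  then have "hp (E2 \<alpha>) (S1 \<union> (?C \<union> S2)) a b"
    by (rule hp_append[OF s(1) E2_nbB(1)[OF \<sigma>(1)] _ d(1)])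
  moreover have "S1 \<union> (?C \<union> S2) = GL2"
  proof -
    have "block P \<union> ?C = GL2" using blocks_complement[of "{P}"] P by simp
    then show ?thesis using s(4) by blast
  qed
  ultimately show ?thesis by simp
qed

text \<open>A single excursion as in \<open>path_same_block_opposite\<close> would need an even
  number of blocks, but q are left. Hence \<open>P\<close> is passed in three portions:
  \<open>a\<close> alone, then from \<open>y\<close> to \<open>w\<close>, then from \<open>f\<close>
  back to \<open>b\<close>. The excursion \<open>C\<close> after \<open>a\<close> takes q - 2 blocks
  and changes the colour; the excursion \<open>D\<close> after \<open>w\<close> takes two blocks and
  keeps it.\<close>

lemma path_same_block_equal:
  assumes a: "a \<in> block P" "b \<in> block P" "\<kappa> b = \<kappa> a" and ab: "a \<noteq> b"
  shows "hp (E2 \<alpha>) GL2 a b"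
proof -
  note aG = blockD[OF a(1)] and bG = blockD[OF a(2)]
  have P: "P \<in> lines" by (rule block_lines[OF a(1)])
  let ?Q = "line (fst a)"
  have Q: "?Q \<in> lines" using aG by simp
  have ne: "P \<noteq> ?Q" using GL2_D(3)[OF aG(1)] aG(2) by metis
  obtain f where f: "f \<in> block P" "\<kappa> f = - \<kappa> a" "opB f \<in> block ?Q" "line (fst f) \<noteq> ?Q"
    by (rule block_exit[of P ?Q "- \<kappa> a" ?Q])
      (use P ne aG kappa_cases[OF aG(1)] in auto)
  note fG = blockD[OF f(1)]
  have J: "hp (EF {a, b}) (block P) a f" by (rule block_path[OF a(1) f(1) f(4)[symmetric] f(2)])
  have af: "a \<noteq> f" using f(4) by auto
  obtain y where y: "EF {a, b} a y" "hp (EF {a, b}) (block P - {a}) y f"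
    using hp_split_first[OF J af] by blast
  have yP: "y \<in> block P" using hp_start[OF y(2)] by blast
  note yG = blockD[OF yP]
  have M: "M_edge \<alpha> a y" using y(1) by (simp add: EF_def)
  have ky: "\<kappa> y = - \<kappa> a" by (rule kappa_M_edge[OF aG(1) M])
  have yb: "b \<noteq> y" using ky a(3) kappa_neq[OF aG(1)] by metis
  have bS: "b \<in> block P - {a}" using a(2) ab by blast
  obtain S1 S2 w where s: "hp (E2 \<alpha>) S1 y w" "w \<in> S1" "hp (E2 \<alpha>) S2 b f" "block P - {a} = S1 \<union> S2" "S1 \<inter> S2 = {}"
    "w \<in> GL2" "line (snd w) = P" "line (fst w) = line (fst b)" "\<kappa> w = - \<kappa> b"
    by (rule EF_pathE[OF y(2) bS yb]) auto
  obtain \<rho> where \<rho>: "\<rho> = 1 \<or> \<rho> = -1" "\<rho> \<noteq> 0" "line (snd (nbB \<rho> w)) \<noteq> ?Q" by (rule ex_nbB[OF s(6)])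
  let ?W = "line (snd (nbB \<rho> w))"
  \<comment> \<open>The neighbours of \<open>a\<close> and \<open>y\<close> never lie in the block
    \<open>?Q\<close> of their common top line, so the choice of the signs has to avoid only
    \<open>?W\<close>.\<close>
  obtain \<sigma> where \<sigma>: "\<sigma> = 1 \<or> \<sigma> = -1" "\<sigma> \<noteq> 0" "line (snd (nbB \<sigma> y)) \<noteq> ?W" by (rule ex_nbB[OF yG(1)])
  obtain \<tau> where \<tau>: "\<tau> = 1 \<or> \<tau> = -1" "\<tau> \<noteq> 0" "line (snd (nbB \<tau> a)) \<noteq> ?W" by (rule ex_nbB[OF aG(1)])
  \<comment> \<open>\<open>y\<close> arises from \<open>a\<close> by scaling one row by \<alpha> or
    its inverse. The two neighbours could share a block only if this scalar were 1 or -1, which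
    \<open>m6\<close> excludes.\<close>
  have ay: "line (snd (nbB \<tau> a)) \<noteq> line (snd (nbB \<sigma> y))"
  proof -
    have d: "det2 (fst a) (snd a) \<noteq> 0" using aG by (simp add: GL2_def)
    have an: "det2 (snd a) (fst a) = - det2 (fst a) (snd a)" by (rule det2_anti)
    have "\<alpha> \<noteq> 1" "\<alpha> ^ 2 \<noteq> 1" using power_neq_1[of 1] power_neq_1[of 2] m6 by simp_all
    then have al: "\<alpha> \<noteq> 1" "\<alpha> \<noteq> -1" by auto
    have *: "\<exists>p r. fst y = scl p (fst a) \<and> snd y = scl r (snd a) \<and> p \<noteq> r \<and> p \<noteq> - r"
    proof -
      have "fst y = scl \<alpha> (fst a) \<and> snd y = scl 1 (snd a) \<or> fst y = scl 1 (fst a) \<and> snd y = scl \<alpha> (snd a) \<or>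
        fst y = scl (inverse \<alpha>) (fst a) \<and> snd y = scl 1 (snd a) \<or> fst y = scl 1 (fst a) \<and> snd y = scl (inverse \<alpha>) (snd a)"
        using M by (auto simp: M_edge_def)
      moreover have "\<alpha> \<noteq> 1" "\<alpha> \<noteq> - 1" "1 \<noteq> \<alpha>" "1 \<noteq> - \<alpha>" "inverse \<alpha> \<noteq> 1" "inverse \<alpha> \<noteq> - 1" "1 \<noteq> inverse \<alpha>" "1 \<noteq> - inverse \<alpha>"
        using al by (auto simp: minus_equation_iff[of 1] inverse_eq_iff_eq field_simps) (metis inverse_eq_1_iff inverse_minus_eq minus_minus)+
      ultimately show ?thesis by metis
    qed
    then obtain p r where pr: "fst y = scl p (fst a)" "snd y = scl r (snd a)" "p \<noteq> r" "p \<noteq> - r" by blast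
    have "det2 (snd (nbB \<tau> a)) (snd (nbB \<sigma> y)) = (\<tau> * r - \<sigma> * p) * det2 (fst a) (snd a)"
      using an by (simp add: nbB_def pr algebra_simps)
    moreover have "\<tau> * r - \<sigma> * p \<noteq> 0"
    proof
      assume "\<tau> * r - \<sigma> * p = 0"
      then have "\<tau> * r = \<sigma> * p" by simp
      then have "p = r \<or> p = - r" using \<sigma>(1) \<tau>(1) by (metis mult_1 mult_minus1 minus_minus)
      then show False using pr(3,4) by blast
    qed
    ultimately have "det2 (snd (nbB \<tau> a)) (snd (nbB \<sigma> y)) \<noteq> 0" using d by simp
    moreover have "snd (nbB \<tau> a) \<noteq> zero2" "snd (nbB \<sigma> y) \<noteq> zero2"
      using GL2_D(2)[of "nbB \<tau> a"] GL2_D(2)[of "nbB \<sigma> y"] aG yG by simp_all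
    ultimately show ?thesis by (simp add: line_eq_iff)
  qed
  have yQ: "line (fst y) = ?Q" using line_M_edge[OF M] by simp
  have WP: "?W \<noteq> P" using line_nbB(2)[OF s(6) \<rho>(2)] s(7) by simp
  have W: "?W \<in> lines" using s(6) by simp
  define C where "C = (\<Union>P\<in>lines - {P, ?W, ?Q}. block P)"
  define D where "D = (\<Union>P\<in>{?W, ?Q}. block P)"
  have pC: "hp (E2 \<alpha>) C (nbB \<tau> a) (nbB \<sigma> y)"
    unfolding C_def
  proof (rule other_blocks_path[OF nbB_block nbB_block ay])
    show "a \<in> GL2" "y \<in> GL2" using aG yG by auto
    show "line (snd (nbB \<tau> a)) \<notin> {P, ?W, ?Q}"
      using line_nbB(1)[OF aG(1), of \<tau>] line_nbB(2)[OF aG(1) \<tau>(2)] \<tau>(3) aG(2) by simp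
    show "line (snd (nbB \<sigma> y)) \<notin> {P, ?W, ?Q}"
      using line_nbB(1)[OF yG(1), of \<sigma>] line_nbB(2)[OF yG(1) \<sigma>(2)] \<sigma>(3) yG(2) yQ by simp
    show "card {P, ?W, ?Q} = 3" using ne WP \<rho>(3) by auto
    show "\<kappa> (nbB \<sigma> y) = (- 1) ^ 3 * \<kappa> (nbB \<tau> a)" using ky by simp
  qed (use P W Q in auto)
  have pD: "hp (E2 \<alpha>) D (nbB \<rho> w) (opB f)"
    unfolding D_def
  proof (rule block_chain_set[OF _ _ _ \<rho>(3) nbB_block[OF s(6)] f(3)])
    have "card {?W, ?Q} = 2" using \<rho>(3) by simp
    then show "\<kappa> (opB f) = (- 1) ^ card {?W, ?Q} * \<kappa> (nbB \<rho> w)"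
      using f(2) s(9) a(3) by (simp add: opB_nbB)
  qed (use W Q in auto)
  have CD: "C \<inter> D = {}" unfolding C_def D_def by (rule blocks_Int) blast
  have PC: "block P \<inter> C = {}" "block P \<inter> D = {}"
    using blocks_Int[of "{P}" "lines - {P, ?W, ?Q}"] blocks_Int[of "{P}" "{?W, ?Q}"] WP ne
    unfolding C_def D_def by simp_all
  have aS: "a \<notin> S1 \<union> S2" using s(4) by blast
  have d: "D \<inter> S2 = {}" "S1 \<inter> (D \<union> S2) = {}" using PC s(4,5) by blast+
  have "hp (E2 \<alpha>) (D \<union> S2) (nbB \<rho> w) b"
    by (rule hp_append[OF pD _ hp_rev[OF symp_edges(4) s(3)] d(1)]) (simp only: opB_nbB, rule E2_nbB(2), simp)
  then have "hp (E2 \<alpha>) (S1 \<union> (D \<union> S2)) y b"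
    by (rule hp_append[OF s(1) E2_nbB(1)[OF \<rho>(1)] _ d(2)])
  moreover have "C \<inter> (S1 \<union> (D \<union> S2)) = {}" using PC CD s(4) by blast
  ultimately have "hp (E2 \<alpha>) (C \<union> (S1 \<union> (D \<union> S2))) (nbB \<tau> a) b"
    by (intro hp_append[OF pC E2_nbB(2)[OF \<sigma>(1)]])
  moreover have "a \<notin> C \<union> (S1 \<union> (D \<union> S2))" using PC aS a(1) by blast
  ultimately have "hp (E2 \<alpha>) (insert a (C \<union> (S1 \<union> (D \<union> S2)))) a b"
    by (intro hp_step[of "E2 \<alpha>" a, OF E2_nbB(1)[OF \<tau>(1)]])
  moreover have "insert a (C \<union> (S1 \<union> (D \<union> S2))) = GL2"
  proof -
    have "C \<union> D = (\<Union>P\<in>lines - {P}. block P)" unfolding C_def D_def using W Q ne WP by (intro blocks_Un) auto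
    moreover have "block P \<union> (\<Union>P\<in>lines - {P}. block P) = GL2"
      using blocks_complement[of "{P}"] P by simp
    moreover have "block P = insert a (S1 \<union> S2)" using s(4) a(1) by blast
    ultimately show ?thesis by blast
  qed
  ultimately show ?thesis by simp
qed

text \<open>Here \<open>P'\<close> is the divided block: after the whole of \<open>P\<close> comes
  its part up to \<open>w\<close>, then the q - 1 blocks besides \<open>P\<close> and
  \<open>P'\<close>, then its part from \<open>g\<close> back to \<open>b\<close>. Both
  \<open>w\<close> and \<open>g\<close> have the colour of \<open>a\<close>, as the even number q -
  1 requires.\<close>

lemma path_different_block_opposite:
  assumes a: "a \<in> block P" "b \<in> block P'" "P \<noteq> P'" "\<kappa> b = - \<kappa> a"
  shows "hp (E2 \<alpha>) GL2 a b"
proof -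
  note aG = blockD[OF a(1)] and bG = blockD[OF a(2)]
  have P: "P \<in> lines" "P' \<in> lines" using block_lines a by blast+
  let ?Q = "line (fst b)"
  have Q: "?Q \<in> lines" using bG by simp
  have QP': "?Q \<noteq> P'" using GL2_D(3)[OF bG(1)] bG(2) by metis
  obtain f where f: "f \<in> block P" "\<kappa> f = - \<kappa> a" "opB f \<in> block P'" "line (fst f) \<noteq> line (fst a)" "line (fst f) \<noteq> ?Q"
    by (rule block_exit[of P P' "- \<kappa> a" "line (fst a)" ?Q])
      (use P a(3) aG kappa_cases[OF aG(1)] in auto)
  have eb: "b \<noteq> opB f" using f(5) by (auto simp: opB_def)
  have ke: "\<kappa> (opB f) = - \<kappa> a" using f(2) by (simp add: opB_nbB)
  \<comment> \<open>\<open>w\<close> will have the top line \<open>?Q\<close> of \<open>b\<close>,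
    so that its neighbours never lie in the block of \<open>?Q\<close>. Taking \<open>?Q\<close>
    itself for \<open>X\<close> unless it is \<open>P\<close> leaves a single block for the sign
    \<open>\<sigma>\<close> to avoid.\<close>
  obtain X where X: "X \<in> lines" "X \<noteq> P" "X \<noteq> P'" "?Q \<noteq> P \<Longrightarrow> X = ?Q"
  proof (cases "?Q = P")
    case True
    have "card {P, P'} < card (lines :: 'a vec2 set set)"
      using card_lines m6 by (simp add: card_insert_if)
    then obtain X where "X \<in> lines" "X \<notin> {P, P'}" by (meson card_mono finite leD subsetI)
    then show ?thesis using that True by blast
  next
    case False
    then show ?thesis using that Q QP' by blast
  qed
  obtain g where g: "g \<in> block P'" "\<kappa> g = \<kappa> a" "opB g \<in> block X" "line (fst g) \<noteq> line (fst f)"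
    by (rule block_exit[of P' X "\<kappa> a" "line (fst f)"])
      (use P X aG kappa_cases[OF aG(1)] in auto)
  have fg: "line (fst (opB f)) \<noteq> line (fst g)" "\<kappa> g = - \<kappa> (opB f)" using g ke by (simp_all add: opB_nbB)
  have J: "hp (EF {b, b}) (block P') (opB f) g" by (rule block_path[OF f(3) g(1) fg])
  obtain S1 S2 w where s: "hp (E2 \<alpha>) S1 (opB f) w" "w \<in> S1" "hp (E2 \<alpha>) S2 b g" "block P' = S1 \<union> S2" "S1 \<inter> S2 = {}"
    "w \<in> GL2" "line (snd w) = P'" "line (fst w) = line (fst b)" "\<kappa> w = - \<kappa> b"
    by (rule EF_pathE[OF J a(2) eb]) auto
  obtain \<sigma> where \<sigma>: "\<sigma> = 1 \<or> \<sigma> = -1" "\<sigma> \<noteq> 0" "line (snd (nbB \<sigma> w)) \<noteq> (if ?Q = P then X else P)"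
    by (rule ex_nbB[OF s(6)])
  have W: "line (snd (nbB \<sigma> w)) \<noteq> X" "line (snd (nbB \<sigma> w)) \<noteq> P" "line (snd (nbB \<sigma> w)) \<noteq> P'"
    using \<sigma>(3) X(4) line_nbB(1)[OF s(6), of \<sigma>] s(7,8) line_nbB(2)[OF s(6) \<sigma>(2)]
    by (auto split: if_splits)
  define C where "C = (\<Union>P\<in>lines - {P, P'}. block P)"
  have pC: "hp (E2 \<alpha>) C (nbB \<sigma> w) (opB g)"
    unfolding C_def
  proof (rule other_blocks_path[OF nbB_block[OF s(6)] g(3) W(1)])
    show "card {P, P'} = 2" using a(3) by simp
    show "\<kappa> (opB g) = (- 1) ^ 2 * \<kappa> (nbB \<sigma> w)" using g(2) s(9) a(4) by (simp add: opB_nbB)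
  qed (use W X P in auto)
  have d: "block P \<inter> block P' = {}" "block P \<inter> C = {}" "block P' \<inter> C = {}"
    using block_disjoint[OF a(3)] blocks_Int[of "{P}" "lines - {P, P'}"] blocks_Int[of "{P'}" "lines - {P, P'}"]
    unfolding C_def by simp_all
  have 1: "hp (E2 \<alpha>) (block P) a f" by (rule block_path_E2[OF a(1) f(1) f(4)[symmetric] f(2)])
  have e: "C \<inter> S2 = {}" "S1 \<inter> (C \<union> S2) = {}" "block P \<inter> (S1 \<union> (C \<union> S2)) = {}"
    using d s(4,5) by blast+
  have "hp (E2 \<alpha>) (C \<union> S2) (nbB \<sigma> w) b"
    by (rule hp_append[OF pC _ hp_rev[OF symp_edges(4) s(3)] e(1)]) (simp only: opB_nbB, rule E2_nbB(2), simp)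
  then have "hp (E2 \<alpha>) (S1 \<union> (C \<union> S2)) (opB f) b"
    by (rule hp_append[OF s(1) E2_nbB(1)[OF \<sigma>(1)] _ e(2)])
  then have "hp (E2 \<alpha>) (block P \<union> (S1 \<union> (C \<union> S2))) a b"
    by (rule hp_append[OF 1 E2_intros(2) _ e(3)])
  moreover have "block P \<union> (S1 \<union> (C \<union> S2)) = GL2"
  proof -
    have "block P \<union> block P' \<union> C = GL2" using blocks_complement[of "{P, P'}"] P unfolding C_def by simp
    then show ?thesis using s(4) by blast
  qed
  ultimately show ?thesis by simp
qed

theorem HC_GL2_odd: "HC (E2 \<alpha>) (GL2 :: 'a gl2 set)"
  unfolding HC_def
proof (intro ballI impI)
  fix a b :: "'a gl2" assume a: "a \<in> GL2" "b \<in> GL2" "a \<noteq> b"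
  let ?P = "line (snd a)" and ?P' = "line (snd b)"
  have bl: "a \<in> block ?P" "b \<in> block ?P'" using a by (simp_all add: block_def)
  show "hp (E2 \<alpha>) GL2 a b"
  proof (cases "?P = ?P'")
    case True
    then have b: "b \<in> block ?P" using bl by simp
    show ?thesis using kappa_eq_or[OF a(1,2)] path_same_block_opposite[OF bl(1) b]
        path_same_block_equal[OF bl(1) b _ a(3)] by blast
  next
    case False
    show ?thesis
    proof (cases "\<kappa> b = \<kappa> a")
      case True
      have "hp (E2 \<alpha>) (\<Union>P\<in>lines. block P) a b"
        by (rule block_chain_set[OF _ _ _ False bl]) (use a True card_lines even_m in auto)
      then show ?thesis using GL2_blocks by metis
    next
      case F: False
      then have "\<kappa> b = - \<kappa> a" using kappa_eq_or[OF a(1,2)] by blast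
      then show ?thesis by (rule path_different_block_opposite[OF bl False])
    qed
  qed
qed

end

subsection \<open>Orders 3 and 5\<close>

primrec walk :: "('l \<Rightarrow> 'v \<Rightarrow> 'v) \<Rightarrow> 'v \<Rightarrow> 'l list \<Rightarrow> 'v list" where
  "walk f x [] = [x]"
| "walk f x (l # ls) = x # walk f (f l x) ls"

lemma hp_walk:
  "distinct (walk f x ls) \<Longrightarrow> hp (\<lambda>x y. \<exists>l. y = f l x) (set (walk f x ls)) x (last (walk f x ls))"
proof (induction ls arbitrary: x)
  case Nil
  then show ?case by (simp add: hp_single)
next
  case (Cons l ls)
  have "walk f (f l x) ls \<noteq> []" by (cases ls) simp_all
  then show ?case using Cons by (auto intro!: hp_step)
qed

text \<open>Affine maps over \<open>\<int>/p\<close>: a pair \<open>(r, s)\<close> stands for the row \<open>(r, s)\<close> above the row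
  \<open>(0, 1)\<close>; the letters 0 and 1 add and subtract the lower row, 2 and 3 multiply the upper row
  by 2 and by 1/2.\<close>

definition aff_step :: "nat \<Rightarrow> nat \<Rightarrow> nat \<times> nat \<Rightarrow> nat \<times> nat" where
  "aff_step p l x = (if l = 0 then (fst x, (snd x + 1) mod p) else
     if l = 1 then (fst x, (snd x + (p - 1)) mod p) else
     if l = 2 then ((2 * fst x) mod p, (2 * snd x) mod p) else
     ((Suc p div 2 * fst x) mod p, (Suc p div 2 * snd x) mod p))"

definition aff_verts :: "nat \<Rightarrow> (nat \<times> nat) list" where
  "aff_verts p = List.product [1..<p] [0..<p]"

text \<open>A walk without repetition, of the right length and inside the vertex set, visits every
  vertex; so this is all that has to be tested for each word.\<close>

definition aff_ok :: "nat \<Rightarrow> nat list list \<Rightarrow> bool" where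
  "aff_ok p ws \<longleftrightarrow>
     list_all (\<lambda>w. distinct (walk (aff_step p) (1, 0) w) \<and> length w + 1 = length (aff_verts p) \<and>
       list_all (\<lambda>x. 1 \<le> fst x \<and> fst x < p \<and> snd x < p) (walk (aff_step p) (1, 0) w)) ws \<and>
     list_all (\<lambda>x. x = (1, 0) \<or> list_ex (\<lambda>w. x = last (walk (aff_step p) (1, 0) w)) ws) (aff_verts p)"

text \<open>Five words, one for each end other than the start \<open>(1, 0)\<close>. A fixed start
  suffices, because by \<open>aff_move\<close> every matrix of \<open>aff v u\<close> can serve as
  the origin.\<close>

definition words3 :: "nat list list" where
  "words3 = [[1,2,1,1,2],
    [0,2,0,0,2],
    [0,0,2,0,0],
    [0,0,2,1,1],
    [1,1,2,0,0]]"

text \<open>Nineteen words, one for each of the 4 * 5 - 1 possible ends.\<close>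

definition words5 :: "nat list list" where
  "words5 = [[1,1,1,2,0,0,0,0,2,0,2,0,3,1,1,2,0,0,2],
    [0,0,0,2,0,0,0,0,2,0,0,0,0,2,0,0,0,0,2],
    [0,0,0,0,2,0,2,1,3,0,2,2,0,0,0,0,3,1,3],
    [0,0,0,0,2,0,0,0,0,2,0,0,0,0,2,0,0,0,0],
    [0,2,0,0,0,0,2,0,0,2,0,2,0,3,3,1,2,0,2],
    [0,0,0,0,2,0,0,0,2,0,2,0,3,1,2,1,1,3,3],
    [0,0,0,0,2,0,2,0,3,1,1,2,0,0,2,0,0,0,0],
    [0,0,2,0,0,0,0,3,3,0,3,0,0,0,0,2,1,1,2],
    [0,0,0,0,3,0,0,0,0,3,0,3,1,2,1,1,3,1,1],
    [0,0,0,0,2,0,0,0,0,2,0,0,0,0,2,1,1,1,1],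
    [0,0,0,0,2,1,2,0,3,1,2,2,1,1,1,1,3,0,3],
    [0,0,0,0,2,1,1,1,2,0,0,2,0,0,0,0,3,1,3],
    [0,0,0,0,2,0,2,1,1,2,1,1,1,1,3,3,1,1,2],
    [0,0,0,0,2,0,0,0,0,2,0,2,1,1,1,3,0,0,2],
    [0,0,0,0,2,0,0,0,0,2,0,2,0,3,1,1,2,0,0],
    [0,0,0,0,2,0,0,2,0,2,0,0,0,0,3,1,3,0,2],
    [0,0,0,0,2,0,0,0,0,2,0,2,0,3,1,2,1,1,3],
    [0,0,0,0,2,0,0,0,0,2,0,0,2,0,0,0,0,3,1],
    [0,0,0,0,2,0,0,2,0,2,0,3,3,1,2,2,0,0,3]]"

lemma aff_ok_3: "aff_ok 3 words3"
  by code_simp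

lemma aff_ok_5: "aff_ok 5 words5"
  by code_simp

lemma length_walk [simp]: "length (walk f x ls) = Suc (length ls)"
  by (induction ls arbitrary: x) simp_all

lemma aff_hp:
  assumes ok: "aff_ok p ws" and x: "x \<in> {1..<p} \<times> {..<p}" "x \<noteq> (1, 0)"
  shows "hp (\<lambda>x y. \<exists>l. y = aff_step p l x) ({1..<p} \<times> {..<p}) (1, 0) x"
proof -
  have V: "set (aff_verts p) = {1..<p} \<times> {..<p}" by (auto simp: aff_verts_def)
  have "x \<in> set (aff_verts p)" using x V by simp
  then obtain w where w: "w \<in> set ws" "x = last (walk (aff_step p) (1, 0) w)"
    using ok x(2) unfolding aff_ok_def list_all_iff list_ex_iff by blast
  let ?l = "walk (aff_step p) (1, 0) w"
  have l: "distinct ?l" "length w + 1 = length (aff_verts p)"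
    and "\<forall>x\<in>set ?l. 1 \<le> fst x \<and> fst x < p \<and> snd x < p"
    using ok w(1) unfolding aff_ok_def list_all_iff by blast+
  then have l3: "set ?l \<subseteq> {1..<p} \<times> {..<p}" by auto
  have "card (set ?l) = card ({1..<p} \<times> {..<p})"
    using distinct_card[OF l(1)] l(2) by (simp add: aff_verts_def length_product card_cartesian_product)
  then have "set ?l = {1..<p} \<times> {..<p}" using l3 by (intro card_subset_eq) simp_all
  then show ?thesis using hp_walk[OF l(1)] w(2) by simp
qed

section \<open>Blocks over the fields with 3 and 5 elements, from explicit paths in the affine
  group\<close>

lemma of_nat_card_field: "of_nat CARD('a) = (0 :: 'a::{finite,field})"
proof -
  have "bij_betw (\<lambda>y. 1 + y) (UNIV :: 'a set) UNIV"
    by (rule bij_betw_byWitness[where f' = "\<lambda>y. y - 1"]) auto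
  then have "(\<Sum>y\<in>UNIV. y) = (\<Sum>y\<in>(UNIV :: 'a set). 1 + y)"
    by (rule sum.reindex_bij_betw[symmetric])
  also have "\<dots> = of_nat CARD('a) + (\<Sum>y\<in>UNIV. y)" by (simp add: sum.distrib)
  finally show ?thesis by simp
qed

locale small_field = finite_field_generator \<alpha> m for \<alpha> :: "'a::{finite,field}" and m +
  assumes q: "CARD('a) = 3 \<or> CARD('a) = 5"
begin

lemma m_eq: "m = CARD('a) - 1" "even m" "m \<ge> 2"
proof -
  have "m = 2 \<or> m = 4" using q card_field by auto
  then show "even m" "m \<ge> 2" by auto
qed (rule m_def)

lemma of_nat_mod: "(of_nat (k mod CARD('a)) :: 'a) = of_nat k"
proof -
  have "(of_nat k :: 'a) = of_nat (CARD('a) * (k div CARD('a)) + k mod CARD('a))" by simp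
  also have "\<dots> = of_nat (k mod CARD('a))" by (simp only: of_nat_add of_nat_mult of_nat_card_field) simp
  finally show ?thesis by simp
qed

lemma of_nat_nz: "0 < k \<Longrightarrow> k < CARD('a) \<Longrightarrow> (of_nat k :: 'a) \<noteq> 0"
proof -
  assume k: "0 < k" "k < CARD('a)"
  have two: "(2 :: 'a) \<noteq> 0" by (rule two_nz[OF m_eq(2)])
  show ?thesis
  proof (cases "CARD('a) = 3")
    case True
    then have "k = 1 \<or> k = 2" using k by auto
    then show ?thesis using two by auto
  next
    case False
    then have p5: "CARD('a) = 5" using q by simp
    then have "k = 1 \<or> k = 2 \<or> k = 3 \<or> k = 4" using k by auto
    moreover have "(4 :: 'a) \<noteq> 0" using two by (metis mult_2_right no_zero_divisors numeral_Bit0)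
    moreover have "(3 :: 'a) \<noteq> 0"
    proof
      assume "(3 :: 'a) = 0"
      moreover have "(2::'a) + 3 = 0" using of_nat_card_field[where ?'a = 'a] p5 by simp
      ultimately show False using two by simp
    qed
    ultimately show ?thesis using two by auto
  qed
qed

lemma inj_of_nat: "inj_on (of_nat :: nat \<Rightarrow> 'a) {..<CARD('a)}"
proof (rule linorder_inj_onI)
  fix i j assume ij: "i < j" "i \<in> {..<CARD('a)}" "j \<in> {..<CARD('a)}"
  then have "(of_nat (j - i) :: 'a) \<noteq> 0" by (intro of_nat_nz) auto
  then show "(of_nat i :: 'a) \<noteq> of_nat j" using ij(1) by (auto simp: of_nat_diff)
qed auto

lemma surj_of_nat: "(of_nat :: nat \<Rightarrow> 'a) ` {..<CARD('a)} = UNIV"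
  using card_image[OF inj_of_nat] by (intro card_eq_UNIV_imp_eq_UNIV) simp_all

text \<open>Modulo 3 the only generator is 2, modulo 5 the generators are 2 and 3 = 1/2. So \<alpha>
  and its inverse are, in some order, the factors 2 and 1/2 of the letters in the words.\<close>

lemma alpha_double: "\<alpha> = 2 \<or> \<alpha> * 2 = 1"
proof -
  have "\<alpha> \<in> (of_nat :: nat \<Rightarrow> 'a) ` {..<CARD('a)}" using surj_of_nat by simp
  then obtain k where k: "\<alpha> = of_nat k" "k < CARD('a)" by blast
  have a1: "\<alpha> \<noteq> 1" by (rule alpha_neq_1[OF m_eq(3)])
  show ?thesis
  proof (cases "CARD('a) = 3")
    case True
    then have "k = 0 \<or> k = 1 \<or> k = 2" using k by auto
    then show ?thesis using k(1) a1 alpha_nz by (elim disjE) simp_all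
  next
    case False
    then have p5: "CARD('a) = 5" using q by simp
    have five: "(5 :: 'a) = 0" using of_nat_card_field[where ?'a = 'a] p5 by simp
    have a2: "\<alpha> ^ 2 \<noteq> 1" using power_neq_1[of 2] p5 m_eq by simp
    have "k = 0 \<or> k = 1 \<or> k = 2 \<or> k = 3 \<or> k = 4" using k p5 by auto
    moreover have "k \<noteq> 4"
    proof
      assume "k = 4"
      then have "\<alpha> ^ 2 = 5 * 3 + 1" using k by simp
      then show False using a2 five by simp
    qed
    moreover have "\<alpha> * 2 = 1" if "k = 3"
    proof -
      have "\<alpha> * 2 = 5 + 1" using k that by simp
      then show ?thesis using five by simp
    qed
    ultimately show ?thesis using k(1) a1 alpha_nz by (elim disjE) simp_all
  qed
qed

text \<open>For independent \<open>v\<close> and \<open>u\<close> these are all invertible matrices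
  with bottom row \<open>u\<close>, a right coset of the affine group, described with
  \<open>(v, u)\<close> as origin.\<close>

definition aff :: "'a vec2 \<Rightarrow> 'a vec2 \<Rightarrow> 'a gl2 set" where
  "aff v u = {(add2 (scl r v) (scl s u), u) | r s. r \<noteq> 0}"

lemma HC_aff_from:
  assumes d: "det2 v u \<noteq> 0" and y: "y \<in> aff v u" "y \<noteq> (v, u)"
  shows "hp (\<lambda>x y. A_edge x y \<or> (\<exists>c. c \<in> {\<alpha>, inverse \<alpha>} \<and> y = (scl c (fst x), snd x))) (aff v u) (v, u) y"
proof -
  let ?E = "\<lambda>x y. A_edge x y \<or> (\<exists>c. c \<in> {\<alpha>, inverse \<alpha>} \<and> y = (scl c (fst x), snd x))"
  define \<phi> :: "nat \<times> nat \<Rightarrow> 'a gl2" where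
    "\<phi> x = (add2 (scl (of_nat (fst x)) v) (scl (of_nat (snd x)) u), u)" for x
  have inv2: "(of_nat (Suc CARD('a) div 2) :: 'a) * 2 = 1"
  proof -
    have "(of_nat (Suc CARD('a) div 2) :: 'a) * 2 = of_nat (Suc CARD('a) div 2 * 2)" by simp
    also have "Suc CARD('a) div 2 * 2 = CARD('a) + 1" using q by auto
    finally show ?thesis by (simp add: of_nat_card_field)
  qed
  have eq: "add2 (scl a v) (scl b u) = add2 (scl a' v) (scl b' u) \<longleftrightarrow> a = a' \<and> b = b'" for a b a' b'
  proof
    assume *: "add2 (scl a v) (scl b u) = add2 (scl a' v) (scl b' u)"
    have "det2 (add2 (scl a v) (scl b u)) u = det2 (add2 (scl a' v) (scl b' u)) u"
      "det2 v (add2 (scl a v) (scl b u)) = det2 v (add2 (scl a' v) (scl b' u))" using * by simp_all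
    then show "a = a' \<and> b = b'" using d by simp
  qed simp
  let ?S = "{1..<CARD('a)} \<times> {..<CARD('a)}"
  have inj: "inj_on \<phi> ?S"
    using inj_of_nat by (auto simp: inj_on_def \<phi>_def eq)
  have img: "\<phi> ` ?S = aff v u"
  proof (intro Set.set_eqI iffI)
    fix z assume "z \<in> \<phi> ` ?S"
    then show "z \<in> aff v u" using of_nat_nz by (force simp: \<phi>_def aff_def)
  next
    fix z assume "z \<in> aff v u"
    then obtain r s where z: "z = (add2 (scl r v) (scl s u), u)" "r \<noteq> 0" by (auto simp: aff_def)
    have "r \<in> (of_nat :: nat \<Rightarrow> 'a) ` {..<CARD('a)}" "s \<in> (of_nat :: nat \<Rightarrow> 'a) ` {..<CARD('a)}"
      using surj_of_nat by simp_all
    then obtain i j where ij: "r = of_nat i" "i < CARD('a)" "s = of_nat j" "j < CARD('a)" by auto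
    have "0 < i" using z ij by (intro gr0I) auto
    then show "z \<in> \<phi> ` ?S" using z ij by (intro image_eqI[of _ _ "(i, j)"]) (auto simp: \<phi>_def)
  qed
  have step: "?E (\<phi> x) (\<phi> (aff_step CARD('a) l x))" for l x
  proof -
    have half: "inverse 2 = (of_nat (Suc CARD('a) div 2) :: 'a)" using inv2 inverse_unique by (metis mult.commute)
    have al: "\<alpha> = 2 \<and> inverse \<alpha> = of_nat (Suc CARD('a) div 2) \<or> inverse \<alpha> = 2 \<and> \<alpha> = of_nat (Suc CARD('a) div 2)"
      using alpha_double half inverse_unique[of \<alpha> 2] by (metis inverse_inverse_eq)
    have mem: "2 \<in> {\<alpha>, inverse \<alpha>}" "(of_nat (Suc CARD('a) div 2) :: 'a) \<in> {\<alpha>, inverse \<alpha>}"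
      using al unfolding insert_iff by metis+
    have pm: "(of_nat (CARD('a) - 1) :: 'a) = - 1"
    proof -
      have "(of_nat (CARD('a) - 1) :: 'a) + 1 = of_nat CARD('a)" using q by auto
      then show ?thesis by (simp add: of_nat_card_field eq_neg_iff_add_eq_0)
    qed
    consider "l = 0" | "l = 1" | "l = 2" | "l > 2" by linarith
    then show ?thesis
    proof cases
      case 1
      then have "\<phi> (aff_step CARD('a) l x) = opA (\<phi> x)"
        by (simp add: \<phi>_def aff_step_def opA_def of_nat_mod prod_eq_iff algebra_simps del: of_nat_Suc)
          (simp add: algebra_simps)
      then show ?thesis by (simp add: A_edge_def)
    next
      case 2
      have "(of_nat ((snd x + (CARD('a) - 1)) mod CARD('a)) :: 'a) = of_nat (snd x) - 1"
        by (simp only: of_nat_mod of_nat_add pm) simp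
      then have "(of_nat (snd (aff_step CARD('a) l x)) :: 'a) = of_nat (snd x) - 1"
        and f: "fst (aff_step CARD('a) l x) = fst x" using 2 by (simp_all add: aff_step_def)
      then have s: "(of_nat (snd (aff_step CARD('a) l x)) :: 'a) + 1 = of_nat (snd x)" by simp
      have o: "opA (\<phi> y) = (add2 (scl (of_nat (fst y)) v) (scl (of_nat (snd y) + 1) u), u)" for y
        by (simp add: \<phi>_def opA_def prod_eq_iff algebra_simps)
      have "opA (\<phi> (aff_step CARD('a) l x)) = \<phi> x" by (simp only: o s f) (simp only: \<phi>_def)
      then show ?thesis by (simp add: A_edge_def)
    next
      case 3
      then have "\<phi> (aff_step CARD('a) l x) = (scl 2 (fst (\<phi> x)), snd (\<phi> x))"
        by (simp add: \<phi>_def aff_step_def of_nat_mod prod_eq_iff algebra_simps)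
      then show ?thesis using mem by blast
    next
      case 4
      then have "\<phi> (aff_step CARD('a) l x) = (scl (of_nat (Suc CARD('a) div 2)) (fst (\<phi> x)), snd (\<phi> x))"
        by (simp add: \<phi>_def aff_step_def of_nat_mod prod_eq_iff algebra_simps)
      then show ?thesis using mem by blast
    qed
  qed
  obtain x where x: "x \<in> ?S" "y = \<phi> x" using y(1) img by blast
  have o: "\<phi> (1, 0) = (v, u)" by (simp add: \<phi>_def prod_eq_iff)
  then have "x \<noteq> (1, 0)" using x y(2) by auto
  moreover have "aff_ok CARD('a) words3 \<or> aff_ok CARD('a) words5" using q aff_ok_3 aff_ok_5 by auto
  ultimately have "hp (\<lambda>x y. \<exists>l. y = aff_step CARD('a) l x) ?S (1, 0) x" using aff_hp x(1) by blast
  then have "hp ?E (\<phi> ` ?S) (\<phi> (1, 0)) (\<phi> x)" by (rule hp_image[OF _ inj]) (use step in blast)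
  then show ?thesis using img o x by simp
qed

lemma aff_move:
  assumes d: "det2 v u \<noteq> 0" and x: "x \<in> aff v u"
  shows "snd x = u" "det2 (fst x) u \<noteq> 0" "aff (fst x) u = aff v u"
proof -
  obtain r s where rs: "x = (add2 (scl r v) (scl s u), u)" "r \<noteq> 0" using x by (auto simp: aff_def)
  show "snd x = u" using rs by simp
  show "det2 (fst x) u \<noteq> 0" using rs d by simp
  show "aff (fst x) u = aff v u"
  proof (intro Set.set_eqI iffI)
    fix z assume "z \<in> aff (fst x) u"
    then obtain a b where z: "z = (add2 (scl a (fst x)) (scl b u), u)" "a \<noteq> 0" by (auto simp: aff_def)
    then have "z = (add2 (scl (a * r) v) (scl (a * s + b) u), u)"
      using rs by (simp add: prod_eq_iff algebra_simps)
    then show "z \<in> aff v u" using z(2) rs(2) by (auto simp: aff_def)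
  next
    fix z assume "z \<in> aff v u"
    then obtain a b where z: "z = (add2 (scl a v) (scl b u), u)" "a \<noteq> 0" by (auto simp: aff_def)
    then have "z = (add2 (scl (a / r) (fst x)) (scl (b - a / r * s) u), u)"
      using rs by (simp add: prod_eq_iff algebra_simps)
    then show "z \<in> aff (fst x) u" using z(2) rs(2) by (auto simp: aff_def)
  qed
qed

text \<open>Only edges that stay inside a block. Among them only scalings change the bottom row, so
  that the sets of equal bottom row can be the layers in \<open>HC_layers\<close>.\<close>

definition R1 :: "'a gl2 \<Rightarrow> 'a gl2 \<Rightarrow> bool" where
  "R1 x y \<longleftrightarrow> A_edge x y \<or> (\<exists>c. c \<in> {\<alpha>, inverse \<alpha>} \<and> y = (scl c (fst x), snd x)) \<or>
    y = (fst x, scl \<alpha> (snd x)) \<or> x = (fst y, scl \<alpha> (snd y))"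

lemma symp_R1: "symp R1"
proof (rule sympI)
  fix x y assume "R1 x y"
  moreover have "x = (scl (inverse c) (fst y), snd y) \<and> inverse c \<in> {\<alpha>, inverse \<alpha>}"
    if "c \<in> {\<alpha>, inverse \<alpha>}" "y = (scl c (fst x), snd x)" for c using that by (auto simp: prod_eq_iff)
  ultimately show "R1 y x" unfolding R1_def A_edge_def by metis
qed

lemma R1_E2: "R1 x y \<Longrightarrow> E2 \<alpha> x y"
  unfolding R1_def E2_def M_edge_def by (auto simp: prod_eq_iff)

text \<open>The layer \<open>L i\<close> has bottom row \<open>\<alpha> ^ i\<close> times
  \<open>u\<close>. It is Hamilton connected by the explicit paths, and scaling the bottom row
  matches it with the next layer.\<close>

lemma HC_block_small: "HC (E2 \<alpha>) (block P)"
proof (cases "block P = {}")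
  case True
  then show ?thesis by (simp add: HC_def)
next
  case False
  then obtain v u where vu: "(v, u) \<in> GL2" "line u = P" by (auto simp: block_def)
  have nz: "u \<noteq> zero2" "v \<noteq> zero2" and d: "det2 v u \<noteq> 0" using GL2_D[OF vu(1)] vu(1) by (auto simp: GL2_def)
  define L where "L i = aff v (scl (\<alpha> ^ i) u)" for i
  have Lu: "det2 v (scl (\<alpha> ^ i) u) \<noteq> 0" for i using d by simp
  have snd_L: "snd x = scl (\<alpha> ^ i) u" if "x \<in> L i" for x i using aff_move(1)[OF Lu] that by (simp add: L_def)
  have pw: "i = j" if "scl (\<alpha> ^ i) u = scl (\<alpha> ^ j) u" "i < m" "j < m" for i j
    using that nz inj_powers by (auto simp: scl_eq_iff inj_on_def)
  have "HC R1 (\<Union>i<m. L i)"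
  proof (rule HC_layers[where s = "\<lambda>x. (fst x, scl \<alpha> (snd x))"])
    show "symp R1" by (rule symp_R1)
    show "m > 0" by (rule m_pos)
    show "HC R1 (L i)" for i
      unfolding HC_def
    proof (intro ballI impI)
      fix x y assume xy: "x \<in> L i" "y \<in> L i" "x \<noteq> y"
      note am = aff_move[OF Lu xy(1)[unfolded L_def]]
      have x: "x = (fst x, scl (\<alpha> ^ i) u)" using am(1) by (simp add: prod_eq_iff)
      have "y \<in> aff (fst x) (scl (\<alpha> ^ i) u)" using xy(2) am(3) by (simp add: L_def)
      moreover have "y \<noteq> (fst x, scl (\<alpha> ^ i) u)" using xy(3) x by metis
      ultimately have "hp R1 (aff (fst x) (scl (\<alpha> ^ i) u)) (fst x, scl (\<alpha> ^ i) u) y"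
        by (intro hp_mono[OF HC_aff_from[OF am(2)]]) (auto simp: R1_def)
      then show "hp R1 (L i) x y" using am(3) x by (simp add: L_def)
    qed
    show "L i \<inter> L j = {}" if "i < m" "j < m" "i \<noteq> j" for i j
      using pw[of i j] that snd_L by (metis disjoint_iff)
    show "bij_betw (\<lambda>x. (fst x, scl \<alpha> (snd x))) (L i) (L (Suc i))" for i
    proof (rule bij_betw_imageI)
      show "inj_on (\<lambda>x. (fst x, scl \<alpha> (snd x))) (L i)"
        by (rule inj_onI) (auto simp: prod_eq_iff)
      show "(\<lambda>x. (fst x, scl \<alpha> (snd x))) ` L i = L (Suc i)"
      proof (intro Set.set_eqI iffI)
        fix z assume "z \<in> (\<lambda>x. (fst x, scl \<alpha> (snd x))) ` L i"
        then obtain r s where "z = (add2 (scl r v) (scl s (scl (\<alpha> ^ i) u)), scl \<alpha> (scl (\<alpha> ^ i) u))" "r \<noteq> 0"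
          by (auto simp: L_def aff_def)
        then have "z = (add2 (scl r v) (scl (s / \<alpha>) (scl (\<alpha> ^ Suc i) u)), scl (\<alpha> ^ Suc i) u)"
          by (simp add: prod_eq_iff)
        then show "z \<in> L (Suc i)" using \<open>r \<noteq> 0\<close> unfolding L_def aff_def by blast
      next
        fix z assume "z \<in> L (Suc i)"
        then obtain r s where z: "z = (add2 (scl r v) (scl s (scl (\<alpha> ^ Suc i) u)), scl (\<alpha> ^ Suc i) u)" "r \<noteq> 0"
          by (auto simp: L_def aff_def)
        let ?x = "(add2 (scl r v) (scl (s * \<alpha>) (scl (\<alpha> ^ i) u)), scl (\<alpha> ^ i) u)"
        have "z = (fst ?x, scl \<alpha> (snd ?x))" using z(1) by (simp add: prod_eq_iff)
        moreover have "?x \<in> L i" using z(2) unfolding L_def aff_def by blast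
        ultimately show "z \<in> (\<lambda>x. (fst x, scl \<alpha> (snd x))) ` L i" by (rule image_eqI)
      qed
    qed
    show "R1 x (fst x, scl \<alpha> (snd x))" for x by (simp add: R1_def)
    show "card (L i) \<ge> 3" for i
    proof -
      let ?f = "\<lambda>s. (add2 (scl 1 v) (scl s (scl (\<alpha> ^ i) u)), scl (\<alpha> ^ i) u)"
      have "inj ?f" using nz by (auto simp: inj_def prod_eq_iff)
      then have "card (range ?f) = CARD('a)" by (simp add: card_image)
      moreover have "?f s \<in> L i" for s
        unfolding L_def aff_def by (intro CollectI exI[of _ 1] exI[of _ s]) simp
      then have "range ?f \<subseteq> L i" by blast
      then have "card (range ?f) \<le> card (L i)" by (intro card_mono) simp_all
      ultimately show ?thesis using q by auto
    qed
    show "y = (fst x, scl \<alpha> (snd x)) \<and> j = Suc i"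
      if ij: "i < j" "j < m" "x \<in> L i" "y \<in> L j" "Suc j < m" "R1 x y" for i j x y
    proof -
      have s: "snd x = scl (\<alpha> ^ i) u" "snd y = scl (\<alpha> ^ j) u" using snd_L ij by blast+
      have ne: "snd x \<noteq> snd y" using pw[of i j] ij s by auto
      then have "y = (fst x, scl \<alpha> (snd x)) \<or> x = (fst y, scl \<alpha> (snd y))"
        using ij(6) by (auto simp: R1_def A_edge_def opA_def)
      moreover have "x \<noteq> (fst y, scl \<alpha> (snd y))"
      proof
        assume "x = (fst y, scl \<alpha> (snd y))"
        then have "scl (\<alpha> ^ i) u = scl (\<alpha> ^ Suc j) u" using s by (metis scl_simps(4) power_Suc snd_conv)
        then show False using pw[of i "Suc j"] ij by auto
      qed
      moreover have "j = Suc i" if "y = (fst x, scl \<alpha> (snd x))"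
      proof -
        have "scl (\<alpha> ^ j) u = scl (\<alpha> ^ Suc i) u" using s that by (metis scl_simps(4) power_Suc snd_conv)
        then show ?thesis using pw[of j "Suc i"] ij by auto
      qed
      ultimately show ?thesis by blast
    qed
  qed
  moreover have "(\<Union>i<m. L i) = block P"
  proof (intro Set.set_eqI iffI)
    fix x assume "x \<in> (\<Union>i<m. L i)"
    then obtain i where i: "x \<in> L i" by blast
    then have "snd x = scl (\<alpha> ^ i) u" "det2 (fst x) (scl (\<alpha> ^ i) u) \<noteq> 0"
      using aff_move(1,2)[OF Lu[of i], of x] by (simp_all add: L_def)
    then show "x \<in> block P" using vu(2) by (simp add: block_def GL2_def)
  next
    fix x assume x: "x \<in> block P"
    then have xG: "x \<in> GL2" "line u = line (snd x)" using vu(2) by (simp_all add: block_def)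
    obtain c where c: "c \<noteq> 0" "snd x = scl c u" by (rule line_eqE[OF xG(2) nz(1) GL2_D(2)[OF xG(1)]])
    obtain i where i: "i < m" "c = \<alpha> ^ i" using ex_power[OF c(1)] by blast
    obtain a b where ab: "fst x = add2 (scl a v) (scl b (snd x))"
    proof -
      have "det2 v (snd x) \<noteq> 0" using c d by simp
      then show ?thesis using basis2[of v "snd x" "fst x"] that by metis
    qed
    have "a \<noteq> 0" using ab xG(1) by (auto simp: GL2_def)
    then have "x \<in> L i" unfolding L_def aff_def using ab c i
      by (intro CollectI exI[of _ a] exI[of _ b]) (simp add: prod_eq_iff)
    then show "x \<in> (\<Union>i<m. L i)" using i by blast
  qed
  ultimately show ?thesis using R1_E2 by (auto intro: HC_mono)
qed

end

theorem (in finite_field_generator) HC_GL2: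
  assumes "m \<ge> 2"
  shows "HC (E2 \<alpha>) (GL2 :: 'a gl2 set)"
proof -
  consider "odd m" "m \<ge> 3" | "even m" "m \<ge> 6" | "CARD('a) = 3 \<or> CARD('a) = 5"
  proof -
    have "odd m \<and> m \<ge> 3 \<or> even m \<and> m \<ge> 6 \<or> m = 2 \<or> m = 4" using assms by presburger
    then show ?thesis using that card_field by auto
  qed
  then show ?thesis
  proof cases
    case 1
    then show ?thesis using HC_GL2_if_HC_blocks HC_block_even by simp
  next
    case 2
    then interpret odd_field by unfold_locales
    show ?thesis by (rule HC_GL2_odd)
  next
    case 3
    then interpret small_field by unfold_locales
    show ?thesis by (rule HC_GL2_if_HC_blocks[OF assms HC_block_small])
  qed
qed

section \<open>Matrix groups\<close>

lemma GL_iff: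
  fixes X :: "'a::field mat"
  shows "X \<in> carrier (GL n) \<longleftrightarrow> X \<in> carrier_mat n n \<and> det X \<noteq> 0"
proof
  assume "X \<in> carrier (GL n)"
  then have U: "X \<in> Units (ring_mat TYPE('a) n ())" by (simp add: GL_def units_of_def)
  then show "X \<in> carrier_mat n n \<and> det X \<noteq> 0"
    using unit_imp_det_non_zero[OF U] by (auto simp: Units_def ring_mat_def)
next
  assume "X \<in> carrier_mat n n \<and> det X \<noteq> 0"
  then show "X \<in> carrier (GL n)"
    using det_non_zero_imp_unit[of X n "()"] by (simp add: GL_def units_of_def)
qed

lemma GL_carrier_mat: "X \<in> carrier (GL n) \<Longrightarrow> X \<in> carrier_mat n n"
  by (simp add: carrier_GL)

lemma GL_mult: "X \<in> carrier (GL n) \<Longrightarrow> Y \<in> carrier (GL n) \<Longrightarrow> X * Y \<in> carrier (GL n :: 'a::field mat monoid)"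
  by (auto simp: GL_iff det_mult)

lemma GL_assoc:
  "X \<in> carrier (GL n) \<Longrightarrow> Y \<in> carrier (GL n) \<Longrightarrow> Z \<in> carrier (GL n) \<Longrightarrow> X * Y * Z = X * (Y * Z)"
  by (auto simp: carrier_GL intro: assoc_mult_mat)

lemma GL_one: "1\<^sub>m n \<in> carrier (GL n :: 'a::field mat monoid)"
  by (simp add: GL_iff)

lemma GL_one_mult [simp]: "X \<in> carrier (GL n) \<Longrightarrow> 1\<^sub>m n * X = X" "X \<in> carrier (GL n) \<Longrightarrow> X * 1\<^sub>m n = X"
  by (auto simp: carrier_GL)

lemma GL_inverse:
  assumes "X \<in> carrier (GL n :: 'a::field mat monoid)"
  obtains Y where "Y \<in> carrier (GL n)" "X * Y = 1\<^sub>m n" "Y * X = 1\<^sub>m n"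
proof -
  interpret group "GL n :: 'a mat monoid" by (rule group_GL)
  show thesis using that[of "inv\<^bsub>GL n\<^esub> X"] assms r_inv[of X] l_inv[of X] by simp
qed

lemma GL_right_cancel:
  assumes "X \<in> carrier (GL n)" "Y \<in> carrier (GL n)" "Z \<in> carrier (GL n :: 'a::field mat monoid)" "X * Z = Y * Z"
  shows "X = Y"
proof -
  interpret group "GL n :: 'a mat monoid" by (rule group_GL)
  show ?thesis using right_cancel[of Z X Y] assms by simp
qed

lemma GL_left_cancel:
  assumes "X \<in> carrier (GL n)" "Y \<in> carrier (GL n)" "Z \<in> carrier (GL n :: 'a::field mat monoid)" "Z * X = Z * Y"
  shows "X = Y"
proof -
  obtain W where W: "W \<in> carrier (GL n)" "W * Z = 1\<^sub>m n" using GL_inverse[OF assms(3)] by blast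
  have "W * (Z * X) = W * (Z * Y)" using assms(4) by simp
  then show ?thesis using W assms(1-3) by (simp flip: GL_assoc[of _ n])
qed

text \<open>\<open>B\<close> need not contain inverses: an edge for the inverse of a generator is an
  edge for the generator read backwards.\<close>

definition cay :: "'a::field mat set \<Rightarrow> 'a mat \<Rightarrow> 'a mat \<Rightarrow> bool" where
  "cay B X Y \<longleftrightarrow> (\<exists>S\<in>B. Y = S * X \<or> X = S * Y)"

lemma symp_cay: "symp (cay B)"
  unfolding symp_def cay_def by blast

lemma cay_right_mult:
  assumes "cay B X Y" "B \<subseteq> carrier (GL n)" "X \<in> carrier (GL n)" "Y \<in> carrier (GL n)" "g \<in> carrier (GL n)"
  shows "cay B (X * g) (Y * g)"
proof -
  obtain S where S: "S \<in> B" "Y = S * X \<or> X = S * Y" using assms(1) by (auto simp: cay_def)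
  then have "S \<in> carrier (GL n)" using assms(2) by blast
  then have "S * X * g = S * (X * g)" "S * Y * g = S * (Y * g)" using assms(3-5) GL_assoc by blast+
  then show ?thesis using S by (auto simp: cay_def)
qed

lemma basic_ops_GL:
  assumes "transition_graph n T" "\<alpha> \<noteq> 0"
  shows "basic_ops \<alpha> n T \<subseteq> carrier (GL n)"
proof
  fix S assume "S \<in> basic_ops \<alpha> n T"
  then consider x y where "S = addrow_mat n 1 y x" "(x, y) \<in> T" | x where "S = multrow_mat n x \<alpha>" "x < n"
    by (auto simp: basic_ops_def split: if_splits)
  then show "S \<in> carrier (GL n)"
  proof cases
    case 1
    then have "x < n" "y < n" "x \<noteq> y" using assms(1) by (auto simp: transition_graph_def irrefl_def)
    then show ?thesis using 1 addrow_mat_in_GL by blast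
  next
    case 2
    then show ?thesis using assms(2) multrow_mat_in_GL by blast
  qed
qed

lemma finite_carrier_mat: "finite (carrier_mat n m :: 'a::finite mat set)"
proof (rule finite_subset)
  let ?F = "({..<n} \<times> {..<m}) \<rightarrow>\<^sub>E (UNIV :: 'a set)"
  show "finite (mat n m ` ?F)" by (intro finite_imageI finite_PiE) simp_all
  show "carrier_mat n m \<subseteq> mat n m ` ?F"
  proof
    fix A :: "'a mat" assume A: "A \<in> carrier_mat n m"
    then have "A = mat n m (restrict (($$) A) ({..<n} \<times> {..<m}))" by (intro eq_matI) auto
    moreover have "mat n m (restrict (($$) A) ({..<n} \<times> {..<m})) \<in> mat n m ` ?F"
      by (rule imageI) (simp only: restrict_PiE_iff, simp)
    ultimately show "A \<in> mat n m ` ?F" by metis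
  qed
qed

lemma hamilton_connected_if_HC:
  assumes T: "transition_graph n T" "\<alpha> \<noteq> (0::'a::{finite,field})"
    and HC: "HC (cay (basic_ops \<alpha> n T)) (carrier (GL n))"
  shows "hamilton_connected (carrier (GL n)) (left_cayley_edges (GL n) (ops \<alpha> n T))"
  unfolding hamilton_connected_def
proof (intro ballI impI)
  fix u v :: "'a mat" assume uv: "u \<in> carrier (GL n)" "v \<in> carrier (GL n)" "u \<noteq> v"
  show "\<exists>p. hamilton_path (carrier (GL n)) (left_cayley_edges (GL n) (ops \<alpha> n T)) u v p"
  proof (rule hp_imp_hamilton_path)
    show "hp (cay (basic_ops \<alpha> n T)) (carrier (GL n)) u v" using HC uv by (simp add: HC_def)
    fix x y assume xy: "x \<in> carrier (GL n)" "y \<in> carrier (GL n)" "cay (basic_ops \<alpha> n T) x y" "x \<noteq> y"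
    have e: "{a, S * a} \<in> left_cayley_edges (GL n) (ops \<alpha> n T)"
      if "a \<in> carrier (GL n)" "S \<in> basic_ops \<alpha> n T" "S * a \<noteq> a" for a S
      using that unfolding left_cayley_edges_def ops_def mult_GL by blast
    obtain S where S: "S \<in> basic_ops \<alpha> n T" "y = S * x \<or> x = S * y" using xy(3) by (auto simp: cay_def)
    then show "{x, y} \<in> left_cayley_edges (GL n) (ops \<alpha> n T)"
      using e[OF xy(1) S(1)] e[OF xy(2) S(1)] xy(4) by (auto simp: insert_commute)
  qed
qed

subsection \<open>Quotients by subgroups\<close>

text \<open>Put h = g g'^-1. Then s k g lies in K g' if and only if s k h lies in K, so
  \<open>exits\<close> speaks about all pairs of different cosets at once, and \<open>third\<close>
  gives a coset besides K and K s. That each h outside K has a solution k means that it lies in K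
  s^-1 K.\<close>

locale coset_quotient =
  fixes n :: nat and K V :: "'a::{finite,field} mat set" and s :: "'a mat" and B :: "'a mat set"
  assumes KV: "K \<subseteq> V" and V: "V \<subseteq> carrier (GL n)" and B: "B \<subseteq> carrier (GL n)"
    and K_one: "1\<^sub>m n \<in> K"
    and K_mult: "\<And>X Y. X \<in> K \<Longrightarrow> Y \<in> K \<Longrightarrow> X * Y \<in> K"
    and K_inv: "\<And>X Y. X \<in> K \<Longrightarrow> Y \<in> carrier (GL n) \<Longrightarrow> X * Y = 1\<^sub>m n \<Longrightarrow> Y \<in> K"
    and V_mult: "\<And>X Y. X \<in> V \<Longrightarrow> Y \<in> V \<Longrightarrow> X * Y \<in> V"
    and V_inv: "\<And>X Y. X \<in> V \<Longrightarrow> Y \<in> carrier (GL n) \<Longrightarrow> X * Y = 1\<^sub>m n \<Longrightarrow> Y \<in> V"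
    and s: "s \<in> V" "s \<notin> K" "s \<in> B"
    and HC_K: "HC (cay B) K"
    and exits: "\<And>h. h \<in> V \<Longrightarrow> h \<notin> K \<Longrightarrow> \<exists>C \<subseteq> {k \<in> K. s * k * h \<in> K}. card C = 3"
    and third: "\<exists>h \<in> V. h \<notin> K \<and> (\<forall>k\<in>K. h \<noteq> k * s)"
begin

definition coset :: "'a mat \<Rightarrow> 'a mat set" where "coset g = (\<lambda>k. k * g) ` K"

lemma VG: "X \<in> V \<Longrightarrow> X \<in> carrier (GL n)" and KG: "X \<in> K \<Longrightarrow> X \<in> carrier (GL n)"
  using V KV by blast+

lemma coset_self: "g \<in> V \<Longrightarrow> g \<in> coset g"
  using K_one VG by (force simp: coset_def image_iff intro!: bexI[of _ "1\<^sub>m n"])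

lemma coset_eq_iff:
  assumes g: "g \<in> V" "h \<in> V"
  shows "coset g = coset h \<longleftrightarrow> h \<in> coset g"
proof
  show "coset g = coset h \<Longrightarrow> h \<in> coset g" using coset_self[OF g(2)] by simp
next
  assume "h \<in> coset g"
  then obtain k where k: "k \<in> K" "h = k * g" by (auto simp: coset_def)
  obtain k' where k': "k' \<in> carrier (GL n)" "k * k' = 1\<^sub>m n" "k' * k = 1\<^sub>m n"
    using GL_inverse[OF KG[OF k(1)]] by blast
  have k'K: "k' \<in> K" using K_inv k k' by blast
  have gh: "g = k' * h" using k k' KG[OF k(1)] VG[OF g(1)] by (simp flip: GL_assoc[of _ n])
  show "coset g = coset h"
  proof (intro Set.set_eqI iffI)
    fix x assume "x \<in> coset g"
    then obtain a where a: "a \<in> K" "x = a * g" by (auto simp: coset_def)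
    then have "x = (a * k') * h" using gh KG[OF a(1)] k'(1) VG[OF g(2)] by (simp add: GL_assoc[of _ n])
    then show "x \<in> coset h" using K_mult[OF a(1) k'K] by (auto simp: coset_def)
  next
    fix x assume "x \<in> coset h"
    then obtain a where a: "a \<in> K" "x = a * h" by (auto simp: coset_def)
    then have "x = (a * k) * g" using k KG[OF a(1)] KG[OF k(1)] VG[OF g(1)] by (simp add: GL_assoc[of _ n])
    then show "x \<in> coset g" using K_mult[OF a(1) k(1)] by (auto simp: coset_def)
  qed
qed

lemma block_coset: "g \<in> V \<Longrightarrow> {x \<in> V. coset x = coset g} = coset g"
proof -
  assume g: "g \<in> V"
  have "coset g \<subseteq> V" using V_mult KV g by (auto simp: coset_def)
  then show ?thesis using coset_eq_iff[OF g] by auto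
qed

theorem HC_V: "HC (cay B) V"
proof -
  have fin: "finite V"
    using finite_subset[OF _ finite_carrier_mat[of n n]] V GL_carrier_mat by blast
  interpret complete_quotient "cay B" V coset "\<lambda>x. s * x"
  proof
    show "symp (cay B)" by (rule symp_cay)
    show "finite (coset ` V)" using fin by simp
    show "inj_on (\<lambda>x. s * x) V"
      using GL_left_cancel[of _ n _ s] VG s(1) by (auto simp: inj_on_def)
    fix x assume x: "x \<in> V"
    show "cay B x (s * x)" using s(3) by (auto simp: cay_def)
    show "s * x \<in> V" by (rule V_mult[OF s(1) x])
    show "coset (s * x) \<noteq> coset x"
    proof
      assume "coset (s * x) = coset x"
      then have "s * x \<in> coset x" using coset_eq_iff[OF x V_mult[OF s(1) x]] by simp
      then obtain k where "k \<in> K" "s * x = k * x" by (auto simp: coset_def)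
      then have "s = k" using GL_right_cancel[of s n k x] VG s(1) x KG by blast
      then show False using \<open>k \<in> K\<close> s(2) by simp
    qed
  next
    fix i assume "i \<in> coset ` V"
    then obtain g where g: "g \<in> V" "i = coset g" by blast
    have "HC (cay B) ((\<lambda>k. k * g) ` K)"
    proof (rule HC_image[OF HC_K])
      show "inj_on (\<lambda>k. k * g) K"
        using GL_right_cancel[of _ n _ g] KG VG[OF g(1)] by (auto simp: inj_on_def)
      show "cay B (x * g) (y * g)" if "x \<in> K" "y \<in> K" "cay B x y" for x y
        using cay_right_mult[OF that(3) B] that KG VG[OF g(1)] by blast
    qed
    then show "HC (cay B) {x \<in> V. coset x = i}" using block_coset[OF g(1)] g(2) by (simp add: coset_def)
  next
    fix i j assume ij: "i \<in> coset ` V" "j \<in> coset ` V" "i \<noteq> j"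
    then obtain g g' where g: "g \<in> V" "i = coset g" "g' \<in> V" "j = coset g'" by blast
    obtain t where t: "t \<in> carrier (GL n)" "g' * t = 1\<^sub>m n" "t * g' = 1\<^sub>m n"
      using GL_inverse[OF VG[OF g(3)]] by blast
    have tV: "t \<in> V" using V_inv g t by blast
    define h where "h = g * t"
    have hV: "h \<in> V" using V_mult g tV by (simp add: h_def)
    have hg: "h * g' = g" using t VG[OF g(1)] VG[OF g(3)] by (simp add: h_def GL_assoc[of _ n])
    have "h \<notin> K"
    proof
      assume "h \<in> K"
      then have "g \<in> coset g'" using hg by (auto simp: coset_def)
      then show False using coset_eq_iff[OF g(3,1)] ij(3) g by simp
    qed
    then obtain C where C: "C \<subseteq> {k \<in> K. s * k * h \<in> K}" "card C = 3" using exits[OF hV] by blast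
    have inj: "inj_on (\<lambda>k. k * g) C"
      using GL_right_cancel[of _ n _ g] KG VG[OF g(1)] C(1) by (auto simp: inj_on_def)
    have "k * g \<in> {x \<in> V. coset x = i \<and> coset (s * x) = j}" if "k \<in> C" for k
    proof -
      have k: "k \<in> K" "s * k * h \<in> K" using C(1) that by auto
      have kV: "k \<in> V" using k KV by blast
      then have kg: "k * g \<in> V" "s * (k * g) \<in> V" using V_mult g s(1) by blast+
      have "k * g \<in> coset g" using k by (auto simp: coset_def)
      then have 1: "coset (k * g) = i" using coset_eq_iff[OF g(1) kg(1)] g by simp
      have "s * (k * g) = s * (k * (h * g'))" by (simp only: hg)
      also have "\<dots> = s * k * h * g'"
      proof -
        have c: "s \<in> carrier (GL n)" "k \<in> carrier (GL n)" "h \<in> carrier (GL n)" "g' \<in> carrier (GL n)"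
          using VG s(1) kV hV g(3) by blast+
        then show ?thesis using GL_assoc[of s n k "h * g'"] GL_assoc[of "s * k" n h g'] by (simp add: GL_mult)
      qed
      finally have "s * (k * g) \<in> coset g'" using k by (auto simp: coset_def)
      then have 2: "coset (s * (k * g)) = j" using coset_eq_iff[OF g(3) kg(2)] g by simp
      show ?thesis using 1 2 kg by simp
    qed
    then show "\<exists>C \<subseteq> {x \<in> V. coset x = i \<and> coset (s * x) = j}. card C = 3"
      using card_image[OF inj] C(2) by (intro exI[of _ "(\<lambda>k. k * g) ` C"]) auto
  qed
  show ?thesis
  proof (rule HC)
    obtain h where h: "h \<in> V" "h \<notin> K" "\<And>k. k \<in> K \<Longrightarrow> h \<noteq> k * s" using third by blast
    have one: "1\<^sub>m n \<in> V" using K_one KV by blast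
    have c1: "coset (1\<^sub>m n) = K" using KG by (force simp: coset_def image_iff)
    have "coset (1\<^sub>m n) \<noteq> coset s" using coset_eq_iff[OF one s(1)] c1 s(2) by simp
    moreover have "coset (1\<^sub>m n) \<noteq> coset h" using coset_eq_iff[OF one h(1)] c1 h(2) by simp
    moreover have "coset s \<noteq> coset h" using coset_eq_iff[OF s(1) h(1)] h(3) by (auto simp: coset_def)
    ultimately show "\<exists>C \<subseteq> coset ` V. card C = 3"
      using one s(1) h(1) by (intro card_3_distinct[of "coset (1\<^sub>m n)" _ "coset s" "coset h"]) auto
  qed
qed

end

section \<open>The subgroups \<open>K1\<close> and \<open>K2\<close>, and the exits from their
  cosets\<close>

declare index_mult_mat(1) [simp del]

definition K1 :: "nat \<Rightarrow> 'a::field mat set" where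
  "K1 n = {X \<in> carrier (GL (Suc n)). \<forall>j<n. X $$ (n, j) = 0 \<and> X $$ (j, n) = 0}"

definition K2 :: "nat \<Rightarrow> 'a::field mat set" where
  "K2 n = {X \<in> carrier (GL (Suc n)). \<forall>j<n. X $$ (n, j) = 0}"

lemma K1_K2: "K1 n \<subseteq> K2 n"
  by (auto simp: K1_def K2_def)

lemma mult_entry:
  "X \<in> carrier_mat n n \<Longrightarrow> Y \<in> carrier_mat n n \<Longrightarrow> i < n \<Longrightarrow> j < n \<Longrightarrow>
    (X * Y) $$ (i, j) = (\<Sum>k<n. X $$ (i, k) * Y $$ (k, j))"
  by (simp add: index_mult_mat(1) scalar_prod_def atLeast0LessThan)

lemma addrow_mat_GL: "k \<noteq> l \<Longrightarrow> addrow_mat n a k l \<in> carrier (GL n :: 'a::field mat monoid)"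
  by (simp add: GL_iff det_addrow_mat)

lemma addrow_mat_mult_entry:
  assumes "X \<in> carrier_mat n n" "l < n" "i < n" "j < n"
  shows "(addrow_mat n a k l * X) $$ (i, j) = (if i = k then a * X $$ (l, j) + X $$ (i, j) else X $$ (i, j))"
  using assms addrow_mat[OF assms(1,2), of a k, symmetric] by auto

lemma multrow_mat_GL: "k < n \<Longrightarrow> a \<noteq> 0 \<Longrightarrow> multrow_mat n k a \<in> carrier (GL n :: 'a::field mat monoid)"
  by (simp add: GL_iff det_multrow_mat)

lemma multrow_mat_mult_entry:
  assumes "X \<in> carrier_mat n n" "i < n" "j < n"
  shows "(multrow_mat n k a * X) $$ (i, j) = (if i = k then a * X $$ (i, j) else X $$ (i, j))"
  using assms multrow_mat[OF assms(1), of k a, symmetric] by auto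

lemma GL_left_inverse:
  "X \<in> carrier (GL n) \<Longrightarrow> Y \<in> carrier (GL n) \<Longrightarrow> X * Y = 1\<^sub>m n \<Longrightarrow> Y * X = 1\<^sub>m n"
  by (simp add: carrier_GL mat_mult_left_right_inverse)

lemma K2_mult_entry:
  assumes "X \<in> K2 n" "Y \<in> carrier (GL (Suc n))" "j < Suc n"
  shows "(X * Y) $$ (n, j) = X $$ (n, n) * Y $$ (n, j)"
proof -
  have "X \<in> carrier_mat (Suc n) (Suc n)" "Y \<in> carrier_mat (Suc n) (Suc n)"
    using assms GL_carrier_mat by (auto simp: K2_def)
  then have "(X * Y) $$ (n, j) = (\<Sum>k<Suc n. X $$ (n, k) * Y $$ (k, j))" using assms(3) by (intro mult_entry) auto
  also have "\<dots> = X $$ (n, n) * Y $$ (n, j)" using assms(1) by (simp add: K2_def)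
  finally show ?thesis .
qed

lemma K1_mult_entry:
  assumes "X \<in> K1 n" "Y \<in> carrier (GL (Suc n))" "i < Suc n"
  shows "(Y * X) $$ (i, n) = Y $$ (i, n) * X $$ (n, n)"
proof -
  have "X \<in> carrier_mat (Suc n) (Suc n)" "Y \<in> carrier_mat (Suc n) (Suc n)"
    using assms GL_carrier_mat by (auto simp: K1_def)
  then have "(Y * X) $$ (i, n) = (\<Sum>k<Suc n. Y $$ (i, k) * X $$ (k, n))" using assms(3) by (intro mult_entry) auto
  also have "\<dots> = Y $$ (i, n) * X $$ (n, n)" using assms(1) by (simp add: K1_def)
  finally show ?thesis .
qed

lemma K2_corner:
  assumes "X \<in> K2 n"
  shows "X $$ (n, n) \<noteq> 0"
proof -
  have X: "X \<in> carrier (GL (Suc n))" using assms by (simp add: K2_def)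
  obtain Y where Y: "Y \<in> carrier (GL (Suc n))" "X * Y = 1\<^sub>m (Suc n)" using GL_inverse[OF X] by blast
  have "X $$ (n, n) * Y $$ (n, n) = 1" using K2_mult_entry[OF assms Y(1), of n] Y(2) by simp
  then show ?thesis by auto
qed

lemma K2_one: "1\<^sub>m (Suc n) \<in> K2 n" and K1_one: "1\<^sub>m (Suc n) \<in> K1 n"
  by (auto simp: K2_def K1_def GL_one)

lemma K2_mult: "X \<in> K2 n \<Longrightarrow> Y \<in> K2 n \<Longrightarrow> X * Y \<in> K2 n"
  using K2_mult_entry[of X n Y] GL_mult by (auto simp: K2_def)

lemma K1_mult: "X \<in> K1 n \<Longrightarrow> Y \<in> K1 n \<Longrightarrow> X * Y \<in> K1 n"
  using K2_mult[of X n Y] K1_K2 K1_mult_entry[of Y n X] by (auto simp: K1_def K2_def)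

lemma K2_inverse:
  assumes "X \<in> K2 n" "Y \<in> carrier (GL (Suc n))" "X * Y = 1\<^sub>m (Suc n)"
  shows "Y \<in> K2 n"
proof -
  have "X $$ (n, n) * Y $$ (n, j) = 0" if "j < n" for j
    using K2_mult_entry[OF assms(1,2), of j] assms(3) that by simp
  then show ?thesis using K2_corner[OF assms(1)] assms(2) by (simp add: K2_def)
qed

lemma K1_inverse:
  assumes "X \<in> K1 n" "Y \<in> carrier (GL (Suc n))" "X * Y = 1\<^sub>m (Suc n)"
  shows "Y \<in> K1 n"
proof -
  have X: "X \<in> K2 n" "X \<in> carrier (GL (Suc n))" using assms(1) K1_K2 by (auto simp: K1_def)
  have "Y $$ (j, n) * X $$ (n, n) = 0" if "j < n" for j
    using K1_mult_entry[OF assms(1,2), of j] GL_left_inverse[OF X(2) assms(2,3)] that by simp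
  then show ?thesis
    using K2_corner[OF X(1)] K2_inverse[OF X(1) assms(2,3)] by (simp add: K1_def K2_def)
qed

text \<open>One scaling of row \<open>i\<close>, which needs \<open>b i\<close> to be nonzero,
  followed by one row addition for each element of \<open>S\<close>.\<close>

lemma row_combination:
  fixes X :: "'a::field mat"
  assumes X: "X \<in> carrier (GL n)" and i: "i < n" "b i \<noteq> 0" and S: "finite S" "S \<subseteq> {..<n} - {i}"
  shows "\<exists>Y \<in> carrier (GL n). (\<forall>r<n. r \<noteq> i \<longrightarrow> (\<forall>c<n. Y $$ (r, c) = X $$ (r, c))) \<and>
    (\<forall>c<n. Y $$ (i, c) = b i * X $$ (i, c) + (\<Sum>k\<in>S. b k * X $$ (k, c)))"
  using S
proof (induction S rule: finite_induct)
  case empty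
  show ?case
    using GL_mult[OF multrow_mat_GL[OF i] X] multrow_mat_mult_entry[OF GL_carrier_mat[OF X]] i
    by (intro bexI[of _ "multrow_mat n i (b i) * X"]) auto
next
  case (insert k S)
  then obtain Y where Y: "Y \<in> carrier (GL n)" "\<forall>r<n. r \<noteq> i \<longrightarrow> (\<forall>c<n. Y $$ (r, c) = X $$ (r, c))"
    "\<forall>c<n. Y $$ (i, c) = b i * X $$ (i, c) + (\<Sum>k\<in>S. b k * X $$ (k, c))" by auto
  have k: "k < n" "k \<noteq> i" using insert by auto
  show ?case
    using GL_mult[OF addrow_mat_GL[of i k n "b k"] Y(1)] addrow_mat_mult_entry[OF GL_carrier_mat[OF Y(1)] k(1)] i k Y insert
    by (intro bexI[of _ "addrow_mat n (b k) i k * Y"]) auto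
qed

text \<open>Start from the identity with the rows \<open>i\<close> and \<open>p\<close> exchanged,
  where \<open>p\<close> is below \<open>n\<close> and \<open>b p\<close> is nonzero, and replace
  row \<open>i\<close> by the combination that equals \<open>b\<close>. The entry at the pivot keeps
  the matrix invertible; the last row keeps its form, and so does the last column if
  \<open>b n\<close> vanishes.\<close>

lemma ex_GL_row:
  fixes b :: "nat \<Rightarrow> 'a::field"
  assumes i: "i < n" and k: "k < n" "b k \<noteq> 0"
  obtains Z where "Z \<in> carrier (GL (Suc n))" "\<forall>c<Suc n. Z $$ (n, c) = (if c = n then 1 else 0)"
    "\<forall>c<Suc n. Z $$ (i, c) = b c" "b n = 0 \<longrightarrow> (\<forall>r<n. Z $$ (r, n) = 0)"
proof -
  define p where "p = (if b i \<noteq> 0 then i else k)"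
  have p: "p < n" "b p \<noteq> 0" using i k by (auto simp: p_def)
  define \<tau> where "\<tau> r = (if r = i then p else if r = p then i else r)" for r
  have \<tau>: "\<tau> (\<tau> r) = r" "\<tau> n = n" "r < Suc n \<Longrightarrow> \<tau> r < Suc n" "r < n \<Longrightarrow> \<tau> r < n" for r
    using i p by (auto simp: \<tau>_def)
  define X :: "'a mat" where "X = mat (Suc n) (Suc n) (\<lambda>(r, c). if \<tau> r = c then 1 else 0)"
  have X: "X \<in> carrier (GL (Suc n))"
  proof (cases "p = i")
    case True
    then have "X = 1\<^sub>m (Suc n)" by (intro eq_matI) (auto simp: X_def \<tau>_def)
    then show ?thesis by (simp add: GL_one)
  next
    case False
    have "X = swaprows_mat (Suc n) i p" by (intro eq_matI) (use False in \<open>auto simp: X_def \<tau>_def\<close>)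
    moreover have "det (swaprows_mat (Suc n) i p :: 'a mat) = - 1" using i p False by (intro det_swaprows_mat) auto
    ultimately show ?thesis by (simp add: GL_iff)
  qed
  have "b (\<tau> i) \<noteq> 0" using p by (simp add: \<tau>_def)
  then obtain Z where Z: "Z \<in> carrier (GL (Suc n))"
    "\<forall>r<Suc n. r \<noteq> i \<longrightarrow> (\<forall>c<Suc n. Z $$ (r, c) = X $$ (r, c))"
    "\<forall>c<Suc n. Z $$ (i, c) = b (\<tau> i) * X $$ (i, c) + (\<Sum>k\<in>{..<Suc n} - {i}. b (\<tau> k) * X $$ (k, c))"
    using row_combination[OF X, of i "\<lambda>r. b (\<tau> r)" "{..<Suc n} - {i}"] i by auto
  have zi: "Z $$ (i, c) = b c" if c: "c < Suc n" for c
  proof -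
    have "Z $$ (i, c) = (\<Sum>k<Suc n. b (\<tau> k) * X $$ (k, c))"
      using Z(3) c i sum.remove[of "{..<Suc n}" i "\<lambda>k. b (\<tau> k) * X $$ (k, c)"] by simp
    also have "\<dots> = (\<Sum>k<Suc n. if k = \<tau> c then b (\<tau> k) else 0)"
      using c \<tau>(1) by (intro sum.cong refl) (auto simp: X_def)
    also have "\<dots> = b c" using \<tau>(1,3) c by (subst sum.delta) auto
    finally show ?thesis .
  qed
  have zn: "Z $$ (n, c) = (if c = n then 1 else 0)" if "c < Suc n" for c
    using Z(2) i that \<tau>(2) by (auto simp: X_def)
  have "Z $$ (r, n) = 0" if "b n = 0" "r < n" for r
  proof (cases "r = i")
    case True
    then show ?thesis using zi[of n] that by simp
  next
    case False
    then show ?thesis using Z(2) that \<tau>(4)[of r] by (auto simp: X_def)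
  qed
  then show thesis using that[OF Z(1)] zi zn by blast
qed

text \<open>Let g be the inverse of h. The product s k h lies in \<open>K2\<close> as soon as s k
  has the last row of g, that is, if the rows \<open>i\<close> and \<open>n\<close> of k add up to
  it. With the unit vector as row \<open>n\<close> of k, row \<open>i\<close> is determined, and it
  can be completed to an invertible matrix because g is not in \<open>K2\<close>. Adding row
  \<open>i\<close> or row \<open>n\<close> to a further row \<open>l\<close> gives two more
  solutions.\<close>

theorem HC_GL_if_HC_K2:
  fixes B :: "'a::{finite,field} mat set"
  assumes n: "n \<ge> 2" and B: "B \<subseteq> carrier (GL (Suc n))" and i: "i < n"
    and s: "addrow_mat (Suc n) 1 n i \<in> B" and HC: "HC (cay B) (K2 n)"
  shows "HC (cay B) (carrier (GL (Suc n)))"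
proof -
  let ?s = "addrow_mat (Suc n) 1 n i :: 'a mat"
  have sG: "?s \<in> carrier (GL (Suc n))" using s B by blast
  obtain l where l: "l < n" "l \<noteq> i" using n i that[of 0] that[of 1] by (cases "i = 0") auto
  interpret coset_quotient "Suc n" "K2 n" "carrier (GL (Suc n))" ?s B
  proof
    show "K2 n \<subseteq> carrier (GL (Suc n))" by (auto simp: K2_def)
    show "?s \<notin> K2 n" using i by (auto simp: K2_def)
    show "\<exists>h\<in>carrier (GL (Suc n)). h \<notin> K2 n \<and> (\<forall>k\<in>K2 n. h \<noteq> k * ?s)"
    proof (rule bexI[of _ "addrow_mat (Suc n) 1 n l"], intro conjI ballI)
      let ?h = "addrow_mat (Suc n) 1 n l :: 'a mat"
      show "?h \<in> carrier (GL (Suc n))" using l by (intro addrow_mat_GL) auto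
      have hl: "?h $$ (n, l) = 1" using l by simp
      then show "?h \<notin> K2 n" using l by (auto simp: K2_def)
      show "?h \<noteq> k * ?s" if k: "k \<in> K2 n" for k
      proof
        assume "?h = k * ?s"
        then have "?h $$ (n, l) = 0" using K2_mult_entry[OF k sG, of l] l by simp
        then show False using hl by simp
      qed
    qed
    fix h :: "'a mat" assume h: "h \<in> carrier (GL (Suc n))" "h \<notin> K2 n"
    obtain g where g: "g \<in> carrier (GL (Suc n))" "h * g = 1\<^sub>m (Suc n)" "g * h = 1\<^sub>m (Suc n)"
      using GL_inverse[OF h(1)] by blast
    have "g \<notin> K2 n" using K2_inverse[OF _ h(1) g(3)] h(2) by blast
    then obtain k where k: "k < n" "g $$ (n, k) \<noteq> 0" using g(1) by (auto simp: K2_def)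
    define b where "b c = g $$ (n, c) - (if c = n then 1 else 0)" for c
    have bk: "b k \<noteq> 0" using k by (simp add: b_def)
    obtain Z where Z0: "Z \<in> carrier (GL (Suc n))" "\<forall>c<Suc n. Z $$ (n, c) = (if c = n then 1 else 0)"
      "\<forall>c<Suc n. Z $$ (i, c) = b c" "b n = 0 \<longrightarrow> (\<forall>r<n. Z $$ (r, n) = 0)"
      by (rule ex_GL_row[of i n k b, OF i k(1) bk])
    have Z: "Z \<in> carrier (GL (Suc n))" "\<And>c. c < Suc n \<Longrightarrow> Z $$ (n, c) = (if c = n then 1 else 0)"
      "\<And>c. c < Suc n \<Longrightarrow> Z $$ (i, c) = b c" "\<And>r. b n = 0 \<Longrightarrow> r < n \<Longrightarrow> Z $$ (r, n) = 0"
      using Z0 by blast+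
    have *: "Y \<in> {k \<in> K2 n. ?s * k * h \<in> K2 n}"
      if Y: "Y \<in> carrier (GL (Suc n))" "\<And>c. c < Suc n \<Longrightarrow> Y $$ (n, c) = Z $$ (n, c)"
        "\<And>c. c < Suc n \<Longrightarrow> Y $$ (i, c) = Z $$ (i, c)" for Y
    proof -
      have sY: "?s * Y \<in> carrier (GL (Suc n))" using GL_mult sG Y(1) by blast
      have r: "(?s * Y) $$ (n, c) = g $$ (n, c)" if "c < Suc n" for c
        using addrow_mat_mult_entry[OF GL_carrier_mat[OF Y(1)], of i n c 1 n] Y(2,3)[OF that] Z(2,3)[OF that] i that
        by (simp add: b_def)
      have "(?s * Y * h) $$ (n, j) = (g * h) $$ (n, j)" if "j < Suc n" for j
        using that r by (simp add: mult_entry[OF GL_carrier_mat[OF sY] GL_carrier_mat[OF h(1)]]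
            mult_entry[OF GL_carrier_mat[OF g(1)] GL_carrier_mat[OF h(1)]])
      then have "?s * Y * h \<in> K2 n" using g(3) GL_mult[OF sY h(1)] by (simp add: K2_def)
      moreover have "Y \<in> K2 n" using Y Z(2) by (simp add: K2_def)
      ultimately show ?thesis by simp
    qed
    let ?Y = "\<lambda>t. addrow_mat (Suc n) 1 l t * Z"
    have e: "?Y t $$ (r, c) = (if r = l then Z $$ (t, c) + Z $$ (r, c) else Z $$ (r, c))"
      if "t < Suc n" "r < Suc n" "c < Suc n" for t r c
      by (simp only: addrow_mat_mult_entry[OF GL_carrier_mat[OF Z(1)] that] mult_1_left)
    have G: "?Y t \<in> carrier (GL (Suc n))" if "t \<noteq> l" for t
      by (rule GL_mult[OF addrow_mat_GL[OF that[symmetric]] Z(1)])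
    show "\<exists>C \<subseteq> {k \<in> K2 n. ?s * k * h \<in> K2 n}. card C = 3"
    proof (rule card_3_distinct)
      show "Z \<in> {k \<in> K2 n. ?s * k * h \<in> K2 n}" by (rule *[OF Z(1) refl refl])
      show "?Y i \<in> {k \<in> K2 n. ?s * k * h \<in> K2 n}"
      proof (rule *)
        show "?Y i \<in> carrier (GL (Suc n))" by (rule G[OF l(2)[symmetric]])
        show "?Y i $$ (n, c) = Z $$ (n, c)" "?Y i $$ (i, c) = Z $$ (i, c)" if "c < Suc n" for c
          using e[of i n c] e[of i i c] that i l by simp_all
      qed
      show "?Y n \<in> {k \<in> K2 n. ?s * k * h \<in> K2 n}"
      proof (rule *)
        show "?Y n \<in> carrier (GL (Suc n))" using l(1) by (intro G) simp
        show "?Y n $$ (n, c) = Z $$ (n, c)" "?Y n $$ (i, c) = Z $$ (i, c)" if "c < Suc n" for c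
          using e[of n n c] e[of n i c] that i l by simp_all
      qed
      show "Z \<noteq> ?Y i"
      proof
        assume "Z = ?Y i"
        then have "Z $$ (l, k) = b k + Z $$ (l, k)" using e[of i l k] l i k Z(3)[of k] by simp
        then show False using bk by simp
      qed
      show "Z \<noteq> ?Y n"
      proof
        assume "Z = ?Y n"
        then have "Z $$ (l, n) = 1 + Z $$ (l, n)" using e[of n l n] l Z(2)[of n] by simp
        then show False by simp
      qed
      show "?Y i \<noteq> ?Y n"
      proof
        assume "?Y i = ?Y n"
        then have "?Y i $$ (l, k) = ?Y n $$ (l, k)" by simp
        then have "b k + Z $$ (l, k) = Z $$ (l, k)" using e[of i l k] e[of n l k] l i k Z(2,3)[of k] by simp
        then show False using bk by simp
      qed
    qed
  qed (use B s sG HC K2_one K2_mult K2_inverse GL_mult in auto)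
  show ?thesis by (rule HC_V)
qed

text \<open>The last column of k h shall be c (e_n - e_j); adding the last row to row
  \<open>j\<close> then clears it above the corner. So k^-1 must have e_n as column \<open>n\<close>
  and \<open>b\<close> as column \<open>j\<close>, and k is the inverse of a transposed matrix from
  \<open>ex_GL_row\<close>. Further solutions are D k, where D adds a multiple of another row below
  \<open>n\<close> to row \<open>j\<close> and so fixes that column. Two such D besides the identity
  exist if there is a third row index or a scalar other than 0 and 1.\<close>

theorem HC_K2_if_HC_K1:
  fixes B :: "'a::{finite,field} mat set"
  assumes n: "n \<ge> 2" "n \<ge> 3 \<or> CARD('a) \<ge> 3" and B: "B \<subseteq> carrier (GL (Suc n))" and j: "j < n"
    and s: "addrow_mat (Suc n) 1 j n \<in> B" and HC: "HC (cay B) (K1 n)"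
  shows "HC (cay B) (K2 n)"
proof -
  let ?s = "addrow_mat (Suc n) 1 j n :: 'a mat"
  have sG: "?s \<in> carrier (GL (Suc n))" using s B by blast
  obtain l where l: "l < n" "l \<noteq> j" using n(1) j that[of 0] that[of 1] by (cases "j = 0") auto
  have addK1: "addrow_mat (Suc n) a r t \<in> K1 n" if "r < n" "t < n" "r \<noteq> t" for a r t
    using addrow_mat_GL[of r t "Suc n" a] that by (auto simp: K1_def)
  interpret coset_quotient "Suc n" "K1 n" "K2 n" ?s B
  proof
    show "K1 n \<subseteq> K2 n" by (rule K1_K2)
    show "K2 n \<subseteq> carrier (GL (Suc n))" by (auto simp: K2_def)
    show "?s \<in> K2 n" using j sG by (auto simp: K2_def)
    have "?s $$ (j, n) = 1" using j by simp
    then show "?s \<notin> K1 n" using j by (auto simp: K1_def)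
    show "\<exists>h\<in>K2 n. h \<notin> K1 n \<and> (\<forall>k\<in>K1 n. h \<noteq> k * ?s)"
    proof (rule bexI[of _ "addrow_mat (Suc n) 1 l n"], intro conjI ballI)
      let ?h = "addrow_mat (Suc n) 1 l n :: 'a mat"
      show "?h \<in> K2 n" using l addrow_mat_GL[of l n "Suc n" "1 :: 'a"] by (auto simp: K2_def)
      have hl: "?h $$ (l, n) = 1" using l by simp
      then show "?h \<notin> K1 n" using l by (auto simp: K1_def)
      show "?h \<noteq> k * ?s" if k: "k \<in> K1 n" for k
      proof
        assume h: "?h = k * ?s"
        have kG: "k \<in> carrier (GL (Suc n))" "k $$ (l, n) = 0" using k l by (auto simp: K1_def)
        have e: "(k * ?s) $$ (l, c) = (\<Sum>t<Suc n. k $$ (l, t) * ?s $$ (t, c))" if "c < Suc n" for c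
          using that l by (intro mult_entry GL_carrier_mat kG sG) auto
        have "(k * ?s) $$ (l, j) = (\<Sum>t<Suc n. if t = j then k $$ (l, j) else 0)"
          unfolding e[OF less_SucI[OF j]] using j by (intro sum.cong) auto
        then have "k $$ (l, j) = ?h $$ (l, j)" using h j by simp
        then have kj: "k $$ (l, j) = 0" using l j by simp
        have "(k * ?s) $$ (l, n) = (\<Sum>t<Suc n. 0)"
          unfolding e[OF lessI] using j kj kG(2) by (intro sum.cong) auto
        then show False using h hl by simp
      qed
    qed
    fix h :: "'a mat" assume h: "h \<in> K2 n" "h \<notin> K1 n"
    then have hG: "h \<in> carrier (GL (Suc n))" by (simp add: K2_def)
    obtain p where p: "p < n" "h $$ (p, n) \<noteq> 0" using h by (auto simp: K1_def K2_def)
    define c where "c = h $$ (n, n)"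
    have c: "c \<noteq> 0" using K2_corner[OF h(1)] by (simp add: c_def)
    \<comment> \<open>Solves the equation h_n = c (e_n - b) for the last column of
      \<open>h\<close>.\<close>
    define b where "b r = (if r < n then - h $$ (r, n) / c else 0)" for r
    have bp: "b p \<noteq> 0" and bn: "b n = 0" using p c by (auto simp: b_def)
    obtain Z where Z0: "Z \<in> carrier (GL (Suc n))" "\<forall>c<Suc n. Z $$ (n, c) = (if c = n then 1 else 0)"
      "\<forall>c<Suc n. Z $$ (j, c) = b c" "b n = 0 \<longrightarrow> (\<forall>r<n. Z $$ (r, n) = 0)"
      by (rule ex_GL_row[of j n p b, OF j p(1) bp])
    have Z: "Z \<in> carrier (GL (Suc n))" "\<And>c. c < Suc n \<Longrightarrow> Z $$ (n, c) = (if c = n then 1 else 0)"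
      "\<And>c. c < Suc n \<Longrightarrow> Z $$ (j, c) = b c" "\<And>r. b n = 0 \<Longrightarrow> r < n \<Longrightarrow> Z $$ (r, n) = 0"
      using Z0 by blast+
    let ?Zt = "transpose_mat Z"
    have Zc: "Z \<in> carrier_mat (Suc n) (Suc n)" by (rule GL_carrier_mat[OF Z(1)])
    have ZtG: "?Zt \<in> carrier (GL (Suc n))" using Z(1) det_transpose[OF Zc] by (simp add: GL_iff)
    have Zt: "?Zt $$ (r, n) = (if r = n then 1 else 0)" "?Zt $$ (r, j) = b r" if "r < Suc n" for r
      using that Zc Z(2,3)[OF that] j by auto
    have ZtK: "?Zt \<in> K1 n" using ZtG Zc Z(2) Z(4)[OF bn] by (auto simp: K1_def)
    obtain k where k: "k \<in> carrier (GL (Suc n))" "?Zt * k = 1\<^sub>m (Suc n)" "k * ?Zt = 1\<^sub>m (Suc n)"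
      using GL_inverse[OF ZtG] by blast
    have kK: "k \<in> K1 n" by (rule K1_inverse[OF ZtK k(1,2)])
    define y where "y r = c * ((if r = n then 1 else 0) - (if r = j then 1 else 0))" for r
    have kh: "(k * h) $$ (r, n) = y r" if r: "r < Suc n" for r
    proof -
      have hu: "h $$ (u, n) = c * (?Zt $$ (u, n) - ?Zt $$ (u, j))" if "u < Suc n" for u
        using Zt[OF that] that c by (cases "u = n") (auto simp: b_def c_def)
      have "(k * h) $$ (r, n) = (\<Sum>u<Suc n. k $$ (r, u) * h $$ (u, n))"
        using r by (intro mult_entry GL_carrier_mat k hG) auto
      also have "\<dots> = (\<Sum>u<Suc n. c * (k $$ (r, u) * ?Zt $$ (u, n)) - c * (k $$ (r, u) * ?Zt $$ (u, j)))"
      proof (rule sum.cong[OF refl])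
        fix u assume "u \<in> {..<Suc n}"
        then have "h $$ (u, n) = c * (?Zt $$ (u, n) - ?Zt $$ (u, j))" using hu by blast
        then show "k $$ (r, u) * h $$ (u, n) = c * (k $$ (r, u) * ?Zt $$ (u, n)) - c * (k $$ (r, u) * ?Zt $$ (u, j))"
          by (simp only: right_diff_distrib mult.left_commute)
      qed
      also have "\<dots> = c * (\<Sum>u<Suc n. k $$ (r, u) * ?Zt $$ (u, n)) - c * (\<Sum>u<Suc n. k $$ (r, u) * ?Zt $$ (u, j))"
        by (simp only: sum_subtractf sum_distrib_left)
      also have "\<dots> = c * (k * ?Zt) $$ (r, n) - c * (k * ?Zt) $$ (r, j)"
        using r j by (simp add: mult_entry[OF GL_carrier_mat[OF k(1)] GL_carrier_mat[OF ZtG]] del: index_transpose_mat)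
      also have "\<dots> = y r" using r j by (simp add: k(3) y_def algebra_simps)
      finally show ?thesis .
    qed
    have *: "D * k \<in> {k \<in> K1 n. ?s * k * h \<in> K1 n}"
      if D: "D \<in> K1 n" "\<And>r. r < Suc n \<Longrightarrow> (D * (k * h)) $$ (r, n) = y r" for D
    proof -
      have DG: "D \<in> carrier (GL (Suc n))" using D(1) by (simp add: K1_def)
      have Dk: "D * k \<in> K1 n" by (rule K1_mult[OF D(1) kK])
      have khG: "k * h \<in> carrier (GL (Suc n))" "D * (k * h) \<in> carrier (GL (Suc n))"
        using GL_mult k(1) hG DG by blast+
      have a: "?s * (D * k) * h = ?s * (D * (k * h))"
        using GL_assoc[OF sG GL_mult[OF DG k(1)] hG] GL_assoc[OF DG k(1) hG] by simp
      have "?s * (D * k) * h \<in> K2 n"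
        using K2_mult K1_K2 Dk h(1) \<open>?s \<in> K2 n\<close> by blast
      moreover have "(?s * (D * k) * h) $$ (r, n) = 0" if "r < n" for r
      proof -
        have r: "r < Suc n" using that by simp
        show ?thesis
          unfolding a addrow_mat_mult_entry[OF GL_carrier_mat[OF khG(2)] lessI r lessI] D(2)[OF r] D(2)[OF lessI]
          using that j by (auto simp: y_def)
      qed
      ultimately have "?s * (D * k) * h \<in> K1 n" by (simp add: K1_def K2_def)
      then show ?thesis using Dk by simp
    qed
    have khc: "k * h \<in> carrier_mat (Suc n) (Suc n)" using GL_mult[OF k(1) hG] GL_carrier_mat by blast
    have add: "addrow_mat (Suc n) a r t * k \<in> {k \<in> K1 n. ?s * k * h \<in> K1 n}"
      if "r < n" "t < n" "r \<noteq> t" "t \<noteq> j" for a r t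
    proof (rule *)
      show "addrow_mat (Suc n) a r t \<in> K1 n" by (rule addK1[OF that(1-3)])
      show "(addrow_mat (Suc n) a r t * (k * h)) $$ (u, n) = y u" if u: "u < Suc n" for u
      proof -
        have t: "t < Suc n" using \<open>t < n\<close> by simp
        show ?thesis
          unfolding addrow_mat_mult_entry[OF khc t u lessI] kh[OF t] kh[OF u]
          using \<open>t < n\<close> \<open>t \<noteq> j\<close> by (simp add: y_def)
      qed
    qed
    have one: "1\<^sub>m (Suc n) * k \<in> {k \<in> K1 n. ?s * k * h \<in> K1 n}"
    proof (rule *[OF K1_one])
      show "(1\<^sub>m (Suc n) * (k * h)) $$ (r, n) = y r" if "r < Suc n" for r
        using kh[OF that] left_mult_one_mat[OF khc] by simp
    qed
    have ne: "D * k \<noteq> D' * k" if "D \<in> K1 n" "D' \<in> K1 n" "D \<noteq> D'" for D D'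
      using GL_right_cancel[of D "Suc n" D' k] that k(1) by (auto simp: K1_def)
    obtain a :: 'a and r where ar: "a \<noteq> 0" "r < n" "r \<noteq> j" "r \<noteq> l \<or> a \<noteq> 1"
    proof (cases "n \<ge> 3")
      case True
      have "\<not> {..<n} \<subseteq> {j, l}"
      proof
        assume "{..<n} \<subseteq> {j, l}"
        then have "card {..<n} \<le> card {j, l}" by (intro card_mono) simp_all
        moreover have "card {j, l} \<le> 2" by (simp add: card_insert_if)
        ultimately show False using True by simp
      qed
      then obtain r where "r < n" "r \<noteq> j" "r \<noteq> l" by blast
      then show ?thesis using that[of 1 r] by simp
    next
      case False
      have "\<not> (UNIV :: 'a set) \<subseteq> {0, 1}"
      proof
        assume "(UNIV :: 'a set) \<subseteq> {0, 1}"
        then have "CARD('a) \<le> card {0, 1 :: 'a}" by (intro card_mono) auto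
        then show False using n(2) False by simp
      qed
      then obtain a :: 'a where "a \<noteq> 0" "a \<noteq> 1" by blast
      then show ?thesis using that[of a l] l by simp
    qed
    let ?D1 = "addrow_mat (Suc n) 1 j l :: 'a mat" and ?D2 = "addrow_mat (Suc n) a j r :: 'a mat"
    have E: "?D1 $$ (j, l) = 1" "?D2 $$ (j, l) = (if r = l then a else 0)" "?D2 $$ (j, r) = a"
      "(1\<^sub>m (Suc n) :: 'a mat) $$ (j, l) = 0" "(1\<^sub>m (Suc n) :: 'a mat) $$ (j, r) = 0"
      using j l ar by auto
    have "1\<^sub>m (Suc n) \<noteq> ?D1" using E by (metis zero_neq_one)
    moreover have "1\<^sub>m (Suc n) \<noteq> ?D2" using E ar(1) by metis
    moreover have "?D1 \<noteq> ?D2" using E ar(4) by (metis zero_neq_one)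
    moreover have "?D1 \<in> K1 n" "?D2 \<in> K1 n" "1\<^sub>m (Suc n) \<in> K1 n" using addK1 K1_one j l ar by auto
    ultimately show "\<exists>C \<subseteq> {k \<in> K1 n. ?s * k * h \<in> K1 n}. card C = 3"
      using j l ar by (intro card_3_distinct[OF one add[of j l 1] add[of j r a]] ne) auto
  qed (use B s sG HC K1_one K1_mult K1_inverse K2_mult K2_inverse in auto)
  show ?thesis by (rule HC_V)
qed

subsection \<open>Block diagonal matrices\<close>

definition emb :: "nat \<Rightarrow> 'a::field \<Rightarrow> 'a mat \<Rightarrow> 'a mat" where
  "emb n c A = mat (Suc n) (Suc n)
     (\<lambda>(r, s). if r < n \<and> s < n then A $$ (r, s) else if r = n \<and> s = n then c else 0)"

lemma emb_carrier [simp]: "emb n c A \<in> carrier_mat (Suc n) (Suc n)"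
  by (simp add: emb_def)

lemma emb_entry:
  "r < Suc n \<Longrightarrow> s < Suc n \<Longrightarrow>
    emb n c A $$ (r, s) = (if r < n \<and> s < n then A $$ (r, s) else if r = n \<and> s = n then c else 0)"
  by (simp add: emb_def)

lemma emb_mult:
  assumes "A \<in> carrier_mat n n" "B \<in> carrier_mat n n"
  shows "emb n c A * emb n d B = emb n (c * d) (A * B)"
proof (rule eq_matI)
  fix r s assume "r < dim_row (emb n (c * d) (A * B))" "s < dim_col (emb n (c * d) (A * B))"
  then have rs: "r < Suc n" "s < Suc n" by (simp_all add: emb_def)
  have "(emb n c A * emb n d B) $$ (r, s) = (\<Sum>k<Suc n. emb n c A $$ (r, k) * emb n d B $$ (k, s))"
    using rs by (intro mult_entry) auto
  also have "\<dots> = (\<Sum>k<n. emb n c A $$ (r, k) * emb n d B $$ (k, s)) + emb n c A $$ (r, n) * emb n d B $$ (n, s)"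
    by simp
  also have "\<dots> = emb n (c * d) (A * B) $$ (r, s)"
  proof (cases "r < n \<and> s < n")
    case True
    then have "(\<Sum>k<n. emb n c A $$ (r, k) * emb n d B $$ (k, s)) = (A * B) $$ (r, s)"
      using mult_entry[OF assms] by (simp add: emb_entry)
    then show ?thesis using True by (simp add: emb_entry)
  next
    case False
    then have "(\<Sum>k<n. emb n c A $$ (r, k) * emb n d B $$ (k, s)) = 0"
      using rs by (intro sum.neutral) (auto simp: emb_entry)
    then show ?thesis using False rs by (auto simp: emb_entry)
  qed
  finally show "(emb n c A * emb n d B) $$ (r, s) = emb n (c * d) (A * B) $$ (r, s)" .
qed (simp_all add: emb_def)

lemma det_emb:
  assumes "A \<in> carrier_mat n n"
  shows "det (emb n c A) = det A * c"
proof -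
  let ?C = "mat 1 1 (\<lambda>_. c)"
  have "emb n c A = four_block_mat A (0\<^sub>m n 1) (0\<^sub>m 1 n) ?C"
    using assms by (intro eq_matI) (auto simp: emb_def)
  also have "det \<dots> = det A * det ?C"
    by (rule det_four_block_mat_upper_right_zero) (use assms in auto)
  also have "det ?C = c" by (subst det_single) auto
  finally show ?thesis .
qed

lemma emb_inj:
  assumes "A \<in> carrier_mat n n" "B \<in> carrier_mat n n" "emb n c A = emb n d B"
  shows "A = B"
proof (rule eq_matI)
  fix r s assume "r < dim_row B" "s < dim_col B"
  then have rs: "r < n" "s < n" using assms(2) by auto
  then have "A $$ (r, s) = emb n c A $$ (r, s)" "B $$ (r, s) = emb n d B $$ (r, s)"
    by (simp_all add: emb_entry)
  then show "A $$ (r, s) = B $$ (r, s)" using assms(3) by simp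
qed (use assms in auto)

lemma emb_GL: "A \<in> carrier (GL n) \<Longrightarrow> c \<noteq> 0 \<Longrightarrow> emb n c A \<in> carrier (GL (Suc n) :: 'a::field mat monoid)"
  by (simp add: GL_iff det_emb)

lemma K1_emb:
  assumes "X \<in> K1 n"
  obtains A where "A \<in> carrier (GL n)" "X = emb n (X $$ (n, n)) A"
proof -
  let ?A = "mat n n (\<lambda>p. X $$ p)"
  have X: "X \<in> carrier_mat (Suc n) (Suc n)" "det X \<noteq> 0" using assms by (auto simp: K1_def GL_iff)
  have e: "X = emb n (X $$ (n, n)) ?A"
    using assms X(1) by (intro eq_matI) (auto simp: emb_def K1_def less_Suc_eq)
  have "det X = det ?A * X $$ (n, n)" using arg_cong[OF e, of det] det_emb[of ?A n "X $$ (n, n)"] by simp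
  then have "det ?A \<noteq> 0" using X(2) by auto
  then show thesis using that[of ?A] e by (simp add: GL_iff)
qed

lemma emb_K1: "A \<in> carrier (GL n) \<Longrightarrow> c \<noteq> 0 \<Longrightarrow> emb n c A \<in> K1 n"
  using emb_GL[of A n c] by (simp add: K1_def emb_entry)

lemma emb_addrow_mat: "k < n \<Longrightarrow> l < n \<Longrightarrow> emb n 1 (addrow_mat n a k l) = addrow_mat (Suc n) a k l"
  by (intro eq_matI) (auto simp: emb_def less_Suc_eq)

lemma emb_multrow_mat: "k < n \<Longrightarrow> emb n 1 (multrow_mat n k a) = multrow_mat (Suc n) k a"
  by (intro eq_matI) (auto simp: emb_def less_Suc_eq)

lemma multrow_mat_emb: "A \<in> carrier_mat n n \<Longrightarrow> multrow_mat (Suc n) n a * emb n c A = emb n (a * c) A"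
proof -
  assume A: "A \<in> carrier_mat n n"
  have "multrow_mat (Suc n) n a = emb n a (1\<^sub>m n)"
    by (intro eq_matI) (auto simp: emb_def less_Suc_eq)
  then show ?thesis using emb_mult[OF one_carrier_mat A, of a c] A by simp
qed

lemma card_GL:
  assumes "n \<ge> 2"
  shows "card (carrier (GL n :: 'a::{finite,field} mat monoid)) \<ge> 3"
proof -
  let ?D = "addrow_mat n (1::'a) 0 1" and ?E = "addrow_mat n (1::'a) 1 0"
  have G: "?D \<in> carrier (GL n)" "?E \<in> carrier (GL n)" "1\<^sub>m n \<in> carrier (GL n :: 'a mat monoid)"
    using addrow_mat_GL[of 0 1 n "1::'a"] addrow_mat_GL[of 1 0 n "1::'a"] GL_one by simp_all
  have e: "?D $$ (0, 1) = 1" "?E $$ (0, 1) = 0" "?E $$ (1, 0) = 1" "(1\<^sub>m n :: 'a mat) $$ (0, 1) = 0"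
    "(1\<^sub>m n :: 'a mat) $$ (1, 0) = 0" using assms by auto
  have "\<exists>C \<subseteq> carrier (GL n :: 'a mat monoid). card C = 3"
    by (rule card_3_distinct[OF G]) (use e in \<open>metis zero_neq_one\<close>)+
  moreover have "finite (carrier (GL n :: 'a mat monoid))"
    using finite_subset[OF _ finite_carrier_mat[of n n]] GL_carrier_mat by blast
  ultimately show ?thesis using card_mono by metis
qed

lemma basic_ops_cases:
  fixes \<alpha> :: "'a::{finite,field}"
  assumes "S \<in> basic_ops \<alpha> n T"
  obtains x y where "S = addrow_mat n 1 y x" "(x, y) \<in> T"
  | x where "S = multrow_mat n x \<alpha>" "x < n" "CARD('a) > 2"
  using assms by (auto simp: basic_ops_def split: if_splits)

text \<open>The layers are the copies of \<open>GL n\<close> with corner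
  \<open>\<alpha> ^ i\<close>, matched by scaling the last row. If q = 2, there is a single layer
  and no scaling among the generators.\<close>

theorem (in finite_field_generator) HC_K1_if_HC_GL:
  assumes n: "n \<ge> 2" and T: "transition_graph (Suc n) T"
    and HC: "HC (cay (basic_ops \<alpha> n (Restr T {..<n}))) (carrier (GL n))"
  shows "HC (cay (basic_ops \<alpha> (Suc n) T)) (K1 n)"
proof -
  let ?B = "basic_ops \<alpha> n (Restr T {..<n})" and ?D = "multrow_mat (Suc n) n \<alpha>"
  \<comment> \<open>Only generators inside \<open>K1 n\<close>: those of the smaller group and, for
    q > 2, the scaling of the last row. A generator that adds the last row to another row, or
    another row to it, leads out of \<open>K1 n\<close>.\<close>
  let ?R = "\<lambda>X Y. cay (emb n 1 ` ?B) X Y \<or> CARD('a) > 2 \<and> cay {?D} X Y"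
  define L where "L i = emb n (\<alpha> ^ i) ` carrier (GL n)" for i :: nat
  have T': "transition_graph n (Restr T {..<n})" using T by (auto simp: transition_graph_def irrefl_def)
  have BG: "?B \<subseteq> carrier (GL n)" by (rule basic_ops_GL[OF T' alpha_nz])
  have corner: "x $$ (n, n) = \<alpha> ^ i" if x: "x \<in> L i" for x i
  proof -
    obtain A where "x = emb n (\<alpha> ^ i) A" using x unfolding L_def by blast
    then show ?thesis by (simp add: emb_entry)
  qed
  have pw: "i = j" if "\<alpha> ^ i = \<alpha> ^ j" "i < m" "j < m" for i j using inj_powers that by (auto simp: inj_on_def)
  have DL: "?D * emb n c A = emb n (\<alpha> * c) A" if "A \<in> carrier (GL n)" for c A
    using multrow_mat_emb GL_carrier_mat[OF that] by blast
  have Dx: "(?D * x) $$ (n, n) = \<alpha> * x $$ (n, n)" if x: "x \<in> L i" for x i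
  proof -
    obtain A where "A \<in> carrier (GL n)" "x = emb n (\<alpha> ^ i) A" using x unfolding L_def by blast
    then show ?thesis using DL by (simp add: emb_entry)
  qed
  have Sx: "(S * x) $$ (n, n) = x $$ (n, n)" if S: "S \<in> emb n 1 ` ?B" and x: "x \<in> L i" for S x i
  proof -
    obtain A where A: "A \<in> ?B" "S = emb n 1 A" using S by blast
    obtain X where X: "X \<in> carrier (GL n)" "x = emb n (\<alpha> ^ i) X" using x unfolding L_def by blast
    have "A \<in> carrier_mat n n" "X \<in> carrier_mat n n" using A(1) BG X(1) GL_carrier_mat by blast+
    then show ?thesis using emb_mult[of A n X 1 "\<alpha> ^ i"] A X by (simp add: emb_entry)
  qed
  have "HC ?R (\<Union>i<m. L i)"
  proof (rule HC_layers[where s = "\<lambda>X. ?D * X"])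
    show "symp ?R" using symp_cay unfolding symp_def by blast
    show "m > 0" by (rule m_pos)
    show "HC ?R (L i)" for i unfolding L_def
    proof (rule HC_image[OF HC])
      show "inj_on (emb n (\<alpha> ^ i)) (carrier (GL n))"
        using emb_inj[of _ n _ "\<alpha> ^ i" "\<alpha> ^ i"] GL_carrier_mat by (auto simp: inj_on_def)
      fix X Y assume X: "X \<in> carrier (GL n)" "Y \<in> carrier (GL n)" "cay ?B X Y"
      then obtain S where S: "S \<in> ?B" "Y = S * X \<or> X = S * Y" by (auto simp: cay_def)
      have c: "S \<in> carrier_mat n n" "X \<in> carrier_mat n n" "Y \<in> carrier_mat n n"
        using S BG X GL_carrier_mat by blast+
      have "emb n (\<alpha> ^ i) (S * Z) = emb n 1 S * emb n (\<alpha> ^ i) Z" if "Z \<in> carrier_mat n n" for Z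
        using emb_mult[OF c(1) that, of 1 "\<alpha> ^ i"] by simp
      then have "emb n (\<alpha> ^ i) Y = emb n 1 S * emb n (\<alpha> ^ i) X \<or> emb n (\<alpha> ^ i) X = emb n 1 S * emb n (\<alpha> ^ i) Y"
        using S(2) c by auto
      then have "cay (emb n 1 ` ?B) (emb n (\<alpha> ^ i) X) (emb n (\<alpha> ^ i) Y)" using S(1) unfolding cay_def by blast
      then show "?R (emb n (\<alpha> ^ i) X) (emb n (\<alpha> ^ i) Y)" by blast
    qed
    show "L i \<inter> L j = {}" if "i < m" "j < m" "i \<noteq> j" for i j
      using corner pw[of i j] that by (metis disjoint_iff)
    show "bij_betw (\<lambda>X. ?D * X) (L i) (L (Suc i))" for i
    proof (rule bij_betw_imageI)
      have LG: "x \<in> carrier (GL (Suc n))" if x: "x \<in> L i" for x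
      proof -
        obtain A where "A \<in> carrier (GL n)" "x = emb n (\<alpha> ^ i) A" using x unfolding L_def by blast
        then show ?thesis using emb_GL[of A n "\<alpha> ^ i"] by simp
      qed
      have "?D \<in> carrier (GL (Suc n))" by (intro multrow_mat_GL) simp_all
      then show "inj_on (\<lambda>X. ?D * X) (L i)" using GL_left_cancel LG by (intro inj_onI) blast
      show "(\<lambda>X. ?D * X) ` L i = L (Suc i)"
        unfolding L_def image_image using DL by (intro image_cong refl) (simp add: power_Suc)
    qed
    show "?R x (?D * x)" if "Suc i < m" for i x
      using that card_field by (auto simp: cay_def)
    show "card (L i) \<ge> 3" for i
    proof -
      have "inj_on (emb n (\<alpha> ^ i)) (carrier (GL n))"
        using emb_inj[of _ n _ "\<alpha> ^ i" "\<alpha> ^ i"] GL_carrier_mat by (auto simp: inj_on_def)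
      then show ?thesis using card_GL[OF n] by (simp add: L_def card_image)
    qed
    show "y = ?D * x \<and> j = Suc i"
      if ij: "i < j" "j < m" "x \<in> L i" "y \<in> L j" "Suc j < m" "?R x y" for i j x y
    proof -
      have ne: "x $$ (n, n) \<noteq> y $$ (n, n)" using corner[OF ij(3)] corner[OF ij(4)] pw[of i j] ij by auto
      have "\<not> cay (emb n 1 ` ?B) x y"
      proof
        assume "cay (emb n 1 ` ?B) x y"
        then obtain S where "S \<in> emb n 1 ` ?B" "y = S * x \<or> x = S * y" unfolding cay_def by blast
        then show False using Sx[of S] ij(3,4) ne by metis
      qed
      then have "y = ?D * x \<or> x = ?D * y" using ij(6) by (auto simp: cay_def)
      moreover have "x \<noteq> ?D * y"
      proof
        assume "x = ?D * y"
        then have "\<alpha> ^ i = \<alpha> ^ Suc j" using Dx[OF ij(4)] corner[OF ij(3)] corner[OF ij(4)] by simp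
        then show False using pw[of i "Suc j"] ij by auto
      qed
      moreover have "j = Suc i" if "y = ?D * x"
      proof -
        have "\<alpha> ^ j = \<alpha> ^ Suc i" using Dx[OF ij(3)] corner[OF ij(3)] corner[OF ij(4)] that by simp
        then show ?thesis using pw[of j "Suc i"] ij by auto
      qed
      ultimately show ?thesis by blast
    qed
  qed
  moreover have "(\<Union>i<m. L i) = K1 n"
  proof (intro Set.set_eqI iffI)
    fix X assume "X \<in> (\<Union>i<m. L i)"
    then obtain i A where "A \<in> carrier (GL n)" "X = emb n (\<alpha> ^ i) A" unfolding L_def by blast
    then show "X \<in> K1 n" using emb_K1[of A n "\<alpha> ^ i"] by simp
  next
    fix X :: "'a mat" assume X: "X \<in> K1 n"
    obtain A where A: "A \<in> carrier (GL n)" "X = emb n (X $$ (n, n)) A" by (rule K1_emb[OF X])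
    have "X $$ (n, n) \<noteq> 0" using K2_corner X K1_K2 by blast
    then obtain i where i: "i < m" "X $$ (n, n) = \<alpha> ^ i" using ex_power by blast
    then have "X \<in> L i" using A unfolding L_def by (metis imageI)
    then show "X \<in> (\<Union>i<m. L i)" using i by blast
  qed
  moreover have "cay (basic_ops \<alpha> (Suc n) T) X Y" if "?R X Y" for X Y
  proof -
    have "emb n 1 S \<in> basic_ops \<alpha> (Suc n) T" if "S \<in> ?B" for S
      using that
    proof (cases rule: basic_ops_cases)
      case (1 x y)
      then have "emb n 1 S = addrow_mat (Suc n) 1 y x" "(x, y) \<in> T" using emb_addrow_mat[of y n x 1] by auto
      then show ?thesis unfolding basic_ops_def by blast
    next
      case (2 x)
      then have "emb n 1 S = multrow_mat (Suc n) x \<alpha>" "x < Suc n" using emb_multrow_mat by auto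
      then show ?thesis using 2 by (auto simp: basic_ops_def)
    qed
    moreover have "?D \<in> basic_ops \<alpha> (Suc n) T" if "CARD('a) > 2" using that by (auto simp: basic_ops_def)
    ultimately show ?thesis using that unfolding cay_def by blast
  qed
  ultimately show ?thesis by (auto intro: HC_mono)
qed

subsection \<open>Transfer of the two-dimensional case\<close>

definition mat2 :: "'a::field gl2 \<Rightarrow> 'a mat" where
  "mat2 x = mat 2 2 (\<lambda>(r, s). let w = (if r = 0 then fst x else snd x) in if s = 0 then fst w else snd w)"

lemma mat2_entry:
  "mat2 x $$ (0, 0) = fst (fst x)" "mat2 x $$ (0, 1) = snd (fst x)"
  "mat2 x $$ (1, 0) = fst (snd x)" "mat2 x $$ (1, 1) = snd (snd x)"
  by (simp_all add: mat2_def)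

lemma mat2_carrier [simp]: "mat2 x \<in> carrier_mat 2 2"
  by (simp add: mat2_def)

lemma mat2_eqI:
  assumes "X \<in> carrier_mat 2 2" "Y \<in> carrier_mat 2 2" "X $$ (0, 0) = Y $$ (0, 0)" "X $$ (0, 1) = Y $$ (0, 1)"
    "X $$ (1, 0) = Y $$ (1, 0)" "X $$ (1, 1) = Y $$ (1, 1)"
  shows "X = Y"
proof (rule eq_matI)
  fix r s assume "r < dim_row Y" "s < dim_col Y"
  then have "r = 0 \<or> r = 1" "s = 0 \<or> s = 1" using assms(2) by auto
  then show "X $$ (r, s) = Y $$ (r, s)" using assms by auto
qed (use assms in auto)

lemma det_mat2: "det (mat2 x) = det2 (fst x) (snd x)"
proof -
  have "det (mat2 x) = (\<Sum>j<2. mat2 x $$ (0, j) * cofactor (mat2 x) 0 j)"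
    by (rule laplace_expansion_row) simp_all
  also have "\<dots> = mat2 x $$ (0, 0) * cofactor (mat2 x) 0 0 + mat2 x $$ (0, 1) * cofactor (mat2 x) 0 1"
    by (simp add: numeral_2_eq_2)
  also have "cofactor (mat2 x) 0 0 = mat2 x $$ (1, 1)"
    unfolding cofactor_def by (subst det_single) (auto simp: mat_delete_def mat2_def)
  also have "cofactor (mat2 x) 0 1 = - mat2 x $$ (1, 0)"
    unfolding cofactor_def by (subst det_single) (auto simp: mat_delete_def mat2_def)
  finally show ?thesis by (simp add: mat2_entry det2_def del: One_nat_def)
qed

lemma mat2_image: "mat2 ` GL2 = carrier (GL 2)"
proof (intro Set.set_eqI iffI)
  fix X :: "'a mat" assume "X \<in> mat2 ` GL2"
  then show "X \<in> carrier (GL 2)" by (auto simp: GL_iff det_mat2 GL2_def)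
next
  fix X :: "'a mat" assume X: "X \<in> carrier (GL 2)"
  let ?x = "((X $$ (0, 0), X $$ (0, 1)), (X $$ (1, 0), X $$ (1, 1)))"
  have e: "mat2 ?x = X"
    by (rule mat2_eqI[OF mat2_carrier GL_carrier_mat[OF X]]) (simp_all add: mat2_entry del: One_nat_def)
  then have "?x \<in> GL2" using X det_mat2[of ?x] by (simp add: GL_iff GL2_def)
  then show "X \<in> mat2 ` GL2" using e by (metis imageI)
qed

theorem (in finite_field_generator) HC_GL_2:
  assumes m: "m \<ge> 2" and T: "(0, 1) \<in> T" "(1, 0) \<in> T"
  shows "HC (cay (basic_ops \<alpha> 2 T)) (carrier (GL 2))"
proof -
  have "HC (cay (basic_ops \<alpha> 2 T)) (mat2 ` GL2)"
  proof (rule HC_image[OF HC_GL2[OF m]])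
    show "inj_on mat2 GL2"
      by (rule inj_onI) (metis mat2_entry prod_eqI)
    fix x y :: "'a gl2"
    have ops: "addrow_mat 2 1 0 1 \<in> basic_ops \<alpha> 2 T" "addrow_mat 2 1 1 0 \<in> basic_ops \<alpha> 2 T"
      "multrow_mat 2 0 \<alpha> \<in> basic_ops \<alpha> 2 T" "multrow_mat 2 1 \<alpha> \<in> basic_ops \<alpha> 2 T"
      using T m card_field by (auto simp: basic_ops_def)
    have carr: "addrow_mat 2 a k l * mat2 z \<in> carrier_mat 2 2" "multrow_mat 2 k a * mat2 z \<in> carrier_mat 2 2"
      for a :: 'a and k l z by (rule mult_carrier_mat[of _ 2 2], simp, simp)+
    note entries = carr mat2_entry addrow_mat_mult_entry multrow_mat_mult_entry opA_def opB_def add.commute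
    have addA: "mat2 (opA z) = addrow_mat 2 1 0 1 * mat2 z" for z :: "'a gl2"
      by (rule mat2_eqI) (simp_all add: entries del: One_nat_def)
    have addB: "mat2 (opB z) = addrow_mat 2 1 1 0 * mat2 z" for z :: "'a gl2"
      by (rule mat2_eqI) (simp_all add: entries del: One_nat_def)
    have mul0: "mat2 (scl \<alpha> (fst z), snd z) = multrow_mat 2 0 \<alpha> * mat2 z" for z :: "'a gl2"
      by (rule mat2_eqI) (simp_all add: entries del: One_nat_def)
    have mul1: "mat2 (fst z, scl \<alpha> (snd z)) = multrow_mat 2 1 \<alpha> * mat2 z" for z :: "'a gl2"
      by (rule mat2_eqI) (simp_all add: entries del: One_nat_def)
    assume "E2 \<alpha> x y"
    then show "cay (basic_ops \<alpha> 2 T) (mat2 x) (mat2 y)"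
      using ops addA addB mul0 mul1 unfolding E2_def A_edge_def B_edge_def M_edge_def cay_def by metis
  qed
  then show ?thesis by (simp add: mat2_image)
qed

subsection \<open>Dimension three over the field with two elements\<close>

text \<open>Two rows over the field with two elements stand for the first two rows of a matrix with last
  row \<open>(0, 0, 1)\<close>. The letters 0 and 1 add one of the two rows to the other, and every other letter
  adds the last row to row \<open>j\<close>.\<close>

definition row_step :: "nat \<Rightarrow> nat \<Rightarrow> bool list \<times> bool list \<Rightarrow> bool list \<times> bool list" where
  "row_step j l x = (if l = 0 then (fst x, map2 (\<noteq>) (fst x) (snd x)) else
     if l = 1 then (map2 (\<noteq>) (fst x) (snd x), snd x) else
     if j = 0 then ((fst x)[2 := \<not> fst x ! 2], snd x) else (fst x, (snd x)[2 := \<not> snd x ! 2]))"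

definition row_start :: "bool list \<times> bool list" where
  "row_start = ([True, False, False], [False, True, False])"

text \<open>The filter is the condition that the left 2 by 2 block is invertible: over the field
  with two elements the determinant ad - bc is nonzero if and only if the Booleans for ad and bc
  differ.\<close>

definition row_verts :: "(bool list \<times> bool list) list" where
  "row_verts = filter (\<lambda>x. (fst x ! 0 \<and> snd x ! 1) \<noteq> (fst x ! 1 \<and> snd x ! 0))
     (List.product (List.n_lists 3 [False, True]) (List.n_lists 3 [False, True]))"

definition row_ok :: "nat \<Rightarrow> nat list list \<Rightarrow> bool" where
  "row_ok j ws \<longleftrightarrow>
     list_all (\<lambda>w. distinct (walk (row_step j) row_start w) \<and> length w + 1 = length row_verts \<and>
       list_all (\<lambda>x. length (fst x) = 3 \<and> length (snd x) = 3 \<and>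
         (fst x ! 0 \<and> snd x ! 1) \<noteq> (fst x ! 1 \<and> snd x ! 0)) (walk (row_step j) row_start w)) ws \<and>
     list_all (\<lambda>x. x = row_start \<or> list_ex (\<lambda>w. x = last (walk (row_step j) row_start w)) ws) row_verts"

text \<open>The group has 6 * 4 = 24 elements: 6 upper left blocks and 4 choices for the last column
  above the corner. There is one word for each of the 23 ends other than the identity.\<close>

definition row_words0 :: "nat list list" where
  "row_words0 = [[1,0,1,0,2,0,1,0,2,0,1,0,2,0,1,0,1,0,2,0,2,0,2],
    [0,1,0,1,2,1,0,1,0,1,2,1,0,1,0,1,2,1,0,1,0,1,2],
    [0,1,0,1,0,2,0,1,0,2,0,1,0,2,0,1,0,1,0,2,0,2,0],
    [0,2,0,2,0,1,2,1,0,1,2,0,1,2,1,0,2,0,2,1,2,0,2],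
    [0,1,0,1,0,2,1,0,2,0,2,1,2,0,1,0,2,0,1,2,1,0,1],
    [0,1,0,2,1,0,2,0,2,1,2,0,1,0,2,0,1,2,1,0,1,2,0],
    [1,0,1,0,1,2,1,0,1,2,1,0,2,0,1,0,2,1,2,0,2,0,1],
    [0,2,0,1,2,1,0,1,2,0,1,2,1,0,2,0,2,1,2,0,2,1,0],
    [0,2,0,1,2,1,0,1,0,1,2,0,2,1,0,1,0,1,2,1,0,2,0],
    [1,0,1,0,1,2,0,1,0,2,0,1,0,2,0,1,0,1,0,2,0,2,0],
    [0,1,0,2,1,2,0,2,1,0,1,2,1,0,1,2,0,2,1,2,0,1,0],
    [0,1,0,1,0,2,1,0,1,0,1,2,1,0,1,0,1,2,1,0,1,0,1],
    [0,1,0,1,0,2,1,0,1,0,2,0,1,0,2,0,1,0,1,0,2,0,2],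
    [0,1,0,1,0,2,1,0,2,0,2,0,1,0,2,1,2,0,2,0,1,0,2],
    [0,1,0,1,0,2,1,0,1,2,0,1,0,2,0,2,1,2,0,1,0,2,0],
    [0,1,0,1,0,2,1,0,1,2,1,0,2,0,1,0,2,1,2,0,2,0,1],
    [0,1,0,1,0,2,1,0,1,0,1,2,0,2,0,1,0,1,0,2,0,1,0],
    [0,1,0,1,0,2,1,0,1,0,1,2,1,0,1,0,2,0,1,0,1,0,2],
    [0,1,0,1,0,2,1,0,1,0,1,2,1,0,1,0,1,2,0,1,0,1,0],
    [0,1,0,2,1,2,0,2,1,0,1,2,1,0,2,0,1,0,2,1,2,0,2],
    [0,1,0,2,1,2,0,2,1,0,1,2,1,0,1,2,1,0,1,0,1,2,1],
    [0,1,0,2,1,2,0,2,1,0,1,2,1,0,1,2,1,0,1,0,2,1,2],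
    [0,1,0,2,1,2,0,2,1,0,1,0,1,2,1,0,1,0,1,2,1,0,1]]"

text \<open>The same if the last row is added to the second row instead of the first.\<close>

definition row_words1 :: "nat list list" where
  "row_words1 = [[1,0,1,0,2,0,1,0,1,0,2,0,1,0,1,0,2,0,1,0,1,0,2],
    [0,1,0,1,2,1,0,1,2,1,0,1,2,1,0,1,0,1,2,1,2,1,2],
    [0,1,0,1,0,2,0,1,0,1,0,2,0,1,0,1,0,2,0,1,0,1,0],
    [0,2,0,1,0,1,0,2,0,1,0,2,0,1,2,1,0,1,2,0,2,1,2],
    [0,1,0,1,0,2,0,1,0,2,0,1,2,1,0,1,2,0,2,1,2,1,0],
    [0,1,0,2,0,1,0,2,0,1,2,1,0,1,2,0,2,1,2,1,0,2,0],
    [0,1,0,2,0,1,0,2,0,1,2,1,0,1,2,0,2,1,2,1,2,0,2],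
    [0,1,0,2,0,1,0,1,0,2,1,2,1,2,0,2,1,0,1,2,1,0,1],
    [0,1,2,1,0,1,2,1,0,1,2,1,0,1,2,0,2,1,2,1,2,1,2],
    [0,1,0,2,1,0,1,2,1,2,0,2,1,2,1,0,1,0,1,2,1,2,1],
    [0,2,0,1,0,1,2,1,2,0,2,1,2,1,0,1,2,0,2,1,2,1,2],
    [0,1,0,1,0,2,1,0,1,2,1,0,1,2,1,0,1,0,1,2,1,2,1],
    [0,1,0,1,0,2,0,1,0,1,2,1,0,1,2,1,0,1,0,1,2,1,2],
    [0,1,0,1,0,2,0,1,0,1,0,2,0,1,0,1,0,2,1,0,1,0,1],
    [0,1,0,1,0,2,0,1,0,1,0,2,0,1,0,1,2,1,0,1,0,1,2],
    [0,1,0,1,0,2,0,1,2,1,2,0,2,1,0,1,2,1,0,2,0,1,0],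
    [0,1,0,1,0,2,0,1,0,1,0,2,1,2,1,0,1,0,1,2,1,0,1],
    [0,1,0,1,0,2,0,1,0,2,1,0,1,2,1,2,0,2,1,0,1,2,1],
    [0,1,0,1,0,2,0,1,2,1,2,1,0,1,2,0,2,1,2,1,0,1,2],
    [0,2,0,1,0,1,0,2,1,2,1,2,0,2,1,0,1,2,1,2,0,2,1],
    [0,1,0,2,0,1,0,2,1,2,0,2,1,2,1,2,0,2,1,0,1,2,1],
    [0,1,0,2,0,1,2,1,2,1,0,1,2,0,2,1,2,1,2,0,2,1,2],
    [0,1,0,2,0,1,0,1,2,1,0,1,2,1,0,1,2,0,2,1,2,1,2]]"

lemma row_ok_0: "row_ok 0 row_words0"
  by code_simp

lemma row_ok_1: "row_ok 1 row_words1"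
  by code_simp

lemma set_row_verts: "set row_verts =
    {x. length (fst x) = 3 \<and> length (snd x) = 3 \<and> (fst x ! 0 \<and> snd x ! 1) \<noteq> (fst x ! 1 \<and> snd x ! 0)}"
proof -
  have "set xs \<subseteq> {False, True}" for xs :: "bool list" by auto
  then have n: "set (List.n_lists 3 [False, True]) = {xs. length xs = 3}" unfolding set_n_lists by auto
  show ?thesis unfolding row_verts_def set_filter set_product n by auto
qed

lemma distinct_row_verts: "distinct row_verts"
  unfolding row_verts_def by (intro distinct_filter distinct_product distinct_n_lists) simp_all

lemma row_hp:
  assumes ok: "row_ok j ws" and x: "x \<in> set row_verts" "x \<noteq> row_start"
  shows "hp (\<lambda>x y. \<exists>l. y = row_step j l x) (set row_verts) row_start x"
proof -
  obtain w where w: "w \<in> set ws" "x = last (walk (row_step j) row_start w)"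
    using ok x unfolding row_ok_def list_all_iff list_ex_iff by blast
  let ?l = "walk (row_step j) row_start w"
  have l: "distinct ?l" "length w + 1 = length row_verts"
    and "\<forall>x\<in>set ?l. length (fst x) = 3 \<and> length (snd x) = 3 \<and>
         (fst x ! 0 \<and> snd x ! 1) \<noteq> (fst x ! 1 \<and> snd x ! 0)"
    using ok w(1) unfolding row_ok_def list_all_iff by blast+
  then have sub: "set ?l \<subseteq> set row_verts" unfolding set_row_verts by blast
  have "card (set ?l) = card (set row_verts)"
    using distinct_card[OF l(1)] distinct_card[OF distinct_row_verts] l(2) by simp
  then have "set ?l = set row_verts" using sub by (intro card_subset_eq) simp_all
  then show ?thesis using hp_walk[OF l(1)] w(2) by simp
qed

section \<open>From pairs of Boolean rows to matrices over the field with two elements\<close>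

lemma field_2:
  assumes "CARD('a::{finite,field}) = 2"
  shows "(x :: 'a) = of_bool (x \<noteq> 0)" "(1 :: 'a) + 1 = 0"
proof -
  have "card {0, 1 :: 'a} = CARD('a)" using assms by simp
  then have U: "{0, 1 :: 'a} = UNIV" by (intro card_subset_eq) simp_all
  then have "x \<in> {0, 1}" by blast
  then show "x = of_bool (x \<noteq> 0)" by auto
  have "(1 :: 'a) + 1 \<in> {0, 1}" using U by blast
  moreover have "(1 :: 'a) + 1 \<noteq> 1" by (metis add.right_neutral add_left_cancel one_neq_zero)
  ultimately show "(1 :: 'a) + 1 = 0" by blast
qed

definition row_mat :: "bool list \<times> bool list \<Rightarrow> 'a::field mat" where
  "row_mat x = mat 3 3 (\<lambda>(r, s). if r = 2 then of_bool (s = 2) else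
     of_bool ((if r = 0 then fst x else snd x) ! s))"

lemma row_mat_carrier [simp]: "row_mat x \<in> carrier_mat 3 3"
  by (simp add: row_mat_def)

lemma row_mat_entry:
  "r < 3 \<Longrightarrow> s < 3 \<Longrightarrow> row_mat x $$ (r, s) = (if r = 2 then of_bool (s = 2) else
     of_bool ((if r = 0 then fst x else snd x) ! s))"
  by (simp add: row_mat_def)

lemma row_mat_step:
  assumes q: "CARD('a::{finite,field}) = 2" and x: "length (fst x) = 3" "length (snd x) = 3" and j: "j < 2"
  shows "(row_mat (row_step j l x) :: 'a mat) =
    addrow_mat 3 1 (if l = 0 then 1 else if l = 1 then 0 else j) (if l = 0 then 0 else if l = 1 then 1 else 2) * row_mat x"
    (is "_ = addrow_mat 3 1 ?k ?l * _")
proof (rule eq_matI)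
  fix r s assume "r < dim_row (addrow_mat 3 1 ?k ?l * (row_mat x :: 'a mat))"
    "s < dim_col (addrow_mat 3 1 ?k ?l * (row_mat x :: 'a mat))"
  then have rs: "r < 3" "s < 3" by (simp_all add: row_mat_def)
  have two: "(2 :: 'a) = 0" using field_2(2)[OF q] by simp
  have r: "r = 0 \<or> r = 1 \<or> r = 2" and j': "j = 0 \<or> j = 1" using rs j by auto
  have l: "?l < 3" by simp
  have "(addrow_mat 3 1 ?k ?l * (row_mat x :: 'a mat)) $$ (r, s) =
    (if r = ?k then row_mat x $$ (?l, s) + row_mat x $$ (r, s) else row_mat x $$ (r, s))"
    using addrow_mat_mult_entry[OF row_mat_carrier[of x] l rs, where k = ?k and a = 1] by (simp only: mult_1_left)
  also have "\<dots> = row_mat (row_step j l x) $$ (r, s)"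
    using r j' rs x
    by (elim disjE; cases "l = 0"; cases "l = 1"; cases "fst x ! s"; cases "snd x ! s"; cases "s = 2";
        simp add: row_mat_entry row_step_def nth_list_update two)
  finally show "row_mat (row_step j l x) $$ (r, s) = (addrow_mat 3 1 ?k ?l * (row_mat x :: 'a mat)) $$ (r, s)" by simp
qed (simp_all add: row_mat_def)

lemma row_mat_start: "row_mat row_start = 1\<^sub>m 3"
proof (rule eq_matI)
  fix r s assume "r < dim_row (1\<^sub>m 3 :: 'a mat)" "s < dim_col (1\<^sub>m 3 :: 'a mat)"
  then have "r = 0 \<or> r = 1 \<or> r = 2" "s = 0 \<or> s = 1 \<or> s = 2" by auto
  then show "row_mat row_start $$ (r, s) = (1\<^sub>m 3 :: 'a mat) $$ (r, s)"
    by (elim disjE) (simp_all add: row_mat_entry row_start_def)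
qed (simp_all add: row_mat_def)

lemma K2_row_mat:
  assumes q: "CARD('a::{finite,field}) = 2" and X: "(X :: 'a mat) \<in> K2 2"
  shows "X \<in> row_mat ` set row_verts"
proof -
  have XG: "X \<in> carrier (GL 3)" and last: "X $$ (2, 0) = 0" "X $$ (2, 1) = 0"
    using X by (auto simp: K2_def numeral_3_eq_3)
  have XC: "X \<in> carrier_mat 3 3" by (rule GL_carrier_mat[OF XG])
  obtain Y where Y: "Y \<in> carrier (GL 3)" "X * Y = 1\<^sub>m 3" using GL_inverse[OF XG] by blast
  have "Y \<in> K2 2" using K2_inverse[OF X] Y by (simp add: numeral_3_eq_3)
  then have Yl: "Y $$ (2, 0) = 0" "Y $$ (2, 1) = 0" by (auto simp: K2_def)
  have e: "(X * Y) $$ (r, s) = X $$ (r, 0) * Y $$ (0, s) + X $$ (r, 1) * Y $$ (1, s)" if "r < 2" "s < 2" for r s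
  proof -
    have "(X * Y) $$ (r, s) = (\<Sum>k<3. X $$ (r, k) * Y $$ (k, s))"
      using that by (intro mult_entry XC GL_carrier_mat[OF Y(1)]) auto
    moreover have "Y $$ (2, s) = 0" using Yl that by (auto simp: less_2_cases_iff)
    ultimately show ?thesis by (simp add: numeral_3_eq_3 numeral_2_eq_2)
  qed
  \<comment> \<open>The determinants of the upper left blocks of \<open>X\<close> and of its inverse
    multiply to 1.\<close>
  have "(X $$ (0, 0) * X $$ (1, 1) - X $$ (0, 1) * X $$ (1, 0)) * (Y $$ (0, 0) * Y $$ (1, 1) - Y $$ (0, 1) * Y $$ (1, 0))
    = (X * Y) $$ (0, 0) * (X * Y) $$ (1, 1) - (X * Y) $$ (0, 1) * (X * Y) $$ (1, 0)"
    by (simp add: e algebra_simps del: One_nat_def)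
  also have "\<dots> = 1" by (simp add: Y(2))
  finally have d: "X $$ (0, 0) * X $$ (1, 1) \<noteq> X $$ (0, 1) * X $$ (1, 0)" by auto
  define x where "x = (map (\<lambda>s. X $$ (0, s) \<noteq> 0) [0, 1, 2], map (\<lambda>s. X $$ (1, s) \<noteq> 0) [0, 1, 2])"
  have "X = row_mat x"
  proof (rule eq_matI)
    fix r s assume "r < dim_row (row_mat x :: 'a mat)" "s < dim_col (row_mat x :: 'a mat)"
    then have rs: "r < 3" "s < 3" by (simp_all add: row_mat_def)
    have "X $$ (2, 2) = of_bool True" using field_2(1)[OF q, of "X $$ (2, 2)"] K2_corner[OF X] by metis
    then have "X $$ (2, 2) = 1" by simp
    have r: "r = 0 \<or> r = 1 \<or> r = 2" and s: "s = 0 \<or> s = 1 \<or> s = 2" using rs by auto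
    have e: "(row_mat x :: 'a mat) $$ (r, s) = (if r = 2 then of_bool (s = 2) else of_bool (X $$ (r, s) \<noteq> 0))"
      using r s by (elim disjE) (simp_all add: row_mat_entry x_def)
    show "X $$ (r, s) = row_mat x $$ (r, s)"
    proof (cases "r = 2")
      case True
      then show ?thesis using e s last \<open>X $$ (2, 2) = 1\<close> by (elim disjE) simp_all
    next
      case False
      then show ?thesis using e field_2(1)[OF q, of "X $$ (r, s)"] by metis
    qed
  qed (use XC in \<open>simp_all add: row_mat_def\<close>)
  moreover have "x \<in> set row_verts"
  proof -
    have v: "z = 0 \<or> z = 1" for z :: 'a using field_2(1)[OF q, of z] by (cases "z = 0") simp_all
    have "(a \<noteq> 0 \<and> b \<noteq> 0) \<noteq> (a' \<noteq> 0 \<and> b' \<noteq> 0)" if "a * b \<noteq> a' * b'" for a b a' b' :: 'a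
      using that v[of a] v[of b] v[of a'] v[of b'] by (elim disjE) simp_all
    from this[OF d] have "(X $$ (0, 0) \<noteq> 0 \<and> X $$ (1, 1) \<noteq> 0) \<noteq> (X $$ (0, 1) \<noteq> 0 \<and> X $$ (1, 0) \<noteq> 0)" .
    moreover have "fst x ! 0 = (X $$ (0, 0) \<noteq> 0)" "fst x ! 1 = (X $$ (0, 1) \<noteq> 0)"
      "snd x ! 0 = (X $$ (1, 0) \<noteq> 0)" "snd x ! 1 = (X $$ (1, 1) \<noteq> 0)"
      "length (fst x) = 3" "length (snd x) = 3" by (simp_all add: x_def)
    ultimately show ?thesis unfolding set_row_verts by (simp only: mem_Collect_eq) blast
  qed
  ultimately show ?thesis by blast
qed

text \<open>Right translation by the inverse of the start reduces every pair of ends to one that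
  begins at the identity, where the explicit paths start.\<close>

theorem HC_K2_dim_3:
  fixes B :: "'a::{finite,field} mat set"
  assumes q: "CARD('a) = 2" and B: "B \<subseteq> carrier (GL 3)" and j: "j < 2"
    and ops: "addrow_mat 3 1 1 0 \<in> B" "addrow_mat 3 1 0 1 \<in> B" "addrow_mat 3 1 j 2 \<in> B"
  shows "HC (cay B) (K2 2)"
proof -
  have step: "cay B (row_mat x) (row_mat (row_step j l x))" if "x \<in> set row_verts" for x l
    using row_mat_step[OF q, where x = x and j = j and l = l] that j ops unfolding set_row_verts cay_def
    by (auto split: if_splits)
  have ok: "row_ok j row_words0 \<or> row_ok j row_words1" using j row_ok_0 row_ok_1 by (auto simp: less_2_cases_iff)
  have inj: "inj_on (row_mat :: _ \<Rightarrow> 'a mat) (set row_verts)"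
  proof (rule inj_onI)
    fix x y assume xy: "x \<in> set row_verts" "y \<in> set row_verts" "(row_mat x :: 'a mat) = row_mat y"
    have "fst x ! s = fst y ! s" "snd x ! s = snd y ! s" if "s < 3" for s
      using arg_cong[OF xy(3), of "\<lambda>A. A $$ (0, s)"] arg_cong[OF xy(3), of "\<lambda>A. A $$ (1, s)"] that
      by (simp_all add: row_mat_entry of_bool_eq_iff)
    then show "x = y" using xy(1,2) by (auto simp: set_row_verts prod_eq_iff intro!: nth_equalityI)
  qed
  have hp1: "hp (cay B) (row_mat ` set row_verts) (1\<^sub>m 3) X" if X: "X \<in> row_mat ` set row_verts" "X \<noteq> 1\<^sub>m 3" for X
  proof -
    obtain x where x: "x \<in> set row_verts" "X = row_mat x" using X(1) by blast
    then have "x \<noteq> row_start" using X(2) row_mat_start by metis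
    then have "hp (\<lambda>x y. \<exists>l. y = row_step j l x) (set row_verts) row_start x"
      using ok row_hp x(1) by blast
    then have "hp (cay B) (row_mat ` set row_verts) (row_mat row_start) (row_mat x)"
      by (rule hp_image[OF _ inj]) (use step in blast)
    then show ?thesis using x row_mat_start by metis
  qed
  have K: "row_mat ` set row_verts = (K2 2 :: 'a mat set)"
  proof
    show "K2 2 \<subseteq> (row_mat ` set row_verts :: 'a mat set)" using K2_row_mat[OF q] by blast
    have opsK: "addrow_mat 3 1 1 0 \<in> (K2 2 :: 'a mat set)" "addrow_mat 3 1 0 1 \<in> (K2 2 :: 'a mat set)"
      "addrow_mat 3 1 j 2 \<in> (K2 2 :: 'a mat set)"
      using B ops j by (auto simp: K2_def numeral_3_eq_3)
    \<comment> \<open>Membership in \<open>K2\<close> is carried along a path from the identity,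
      each step being multiplication by a generator in \<open>K2\<close>; no determinant has to be
      computed from the Boolean rows.\<close>
    have inv: "row_mat y \<in> (K2 2 :: 'a mat set)"
      if "hp (\<lambda>x y. \<exists>l. y = row_step j l x) S x y" "row_mat x \<in> (K2 2 :: 'a mat set)" "S \<subseteq> set row_verts" for S x y
      using that
    proof (induction rule: hp.induct)
      case (hp_step u v S w)
      then obtain l where l: "v = row_step j l u" by blast
      have u: "length (fst u) = 3" "length (snd u) = 3" using hp_step.prems(2) by (auto simp: set_row_verts)
      have "row_mat v \<in> (K2 2 :: 'a mat set)"
        unfolding l row_mat_step[OF q u j] using opsK hp_step.prems(1) by (auto intro: K2_mult)
      then show ?case using hp_step by blast
    qed
    have start: "row_mat row_start \<in> (K2 2 :: 'a mat set)"
      using K2_one[of 2, where ?'a = 'a] by (simp add: row_mat_start numeral_3_eq_3)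
    have "row_mat x \<in> (K2 2 :: 'a mat set)" if x: "x \<in> set row_verts" for x
    proof (cases "x = row_start")
      case True
      then show ?thesis using start by simp
    next
      case False
      then have "hp (\<lambda>x y. \<exists>l. y = row_step j l x) (set row_verts) row_start x"
        using ok row_hp x by blast
      then show ?thesis using start by (rule inv) simp
    qed
    then show "row_mat ` set row_verts \<subseteq> (K2 2 :: 'a mat set)" by blast
  qed
  show ?thesis
    unfolding HC_def
  proof (intro ballI impI)
    fix u v :: "'a mat" assume uv: "u \<in> K2 2" "v \<in> K2 2" "u \<noteq> v"
    have KG: "x \<in> carrier (GL 3)" if "x \<in> K2 2" for x :: "'a mat" using that by (simp add: K2_def numeral_3_eq_3)
    obtain w where w: "w \<in> carrier (GL 3)" "u * w = 1\<^sub>m 3" "w * u = 1\<^sub>m 3" using GL_inverse[OF KG[OF uv(1)]] by blast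
    have wK: "w \<in> K2 2" using K2_inverse[OF uv(1)] w by (simp add: numeral_3_eq_3)
    have vw: "v * w \<in> K2 2" by (rule K2_mult[OF uv(2) wK])
    have vwu: "v * w * u = v" using GL_assoc[OF KG[OF uv(2)] w(1) KG[OF uv(1)]] w(3) KG[OF uv(2)] by simp
    have "v * w \<noteq> 1\<^sub>m 3" using vwu KG[OF uv(1)] uv(3) by auto
    then have "hp (cay B) (K2 2) (1\<^sub>m 3) (v * w)" using hp1[of "v * w"] vw K by simp
    then have "hp (cay B) ((\<lambda>k. k * u) ` K2 2) (1\<^sub>m 3 * u) (v * w * u)"
    proof (rule hp_image)
      show "inj_on (\<lambda>k. k * u) (K2 2)" using GL_right_cancel KG uv(1) by (intro inj_onI) blast
      show "cay B (x * u) (y * u)" if "x \<in> K2 2" "y \<in> K2 2" "cay B x y" for x y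
        by (rule cay_right_mult[OF that(3) B KG[OF that(1)] KG[OF that(2)] KG[OF uv(1)]])
    qed
    moreover have "(\<lambda>k. k * u) ` K2 2 = K2 2"
    proof
      show "(\<lambda>k. k * u) ` K2 2 \<subseteq> K2 2" using K2_mult uv(1) by blast
      show "K2 2 \<subseteq> (\<lambda>k. k * u) ` K2 2"
      proof
        fix x :: "'a mat" assume x: "x \<in> K2 2"
        have "x = x * w * u" using GL_assoc[OF KG[OF x] w(1) KG[OF uv(1)]] w(3) KG[OF x] by simp
        then show "x \<in> (\<lambda>k. k * u) ` K2 2" by (rule image_eqI) (rule K2_mult[OF x wK])
      qed
    qed
    ultimately show "hp (cay B) (K2 2) u v" using vwu KG[OF uv(1)] by simp
  qed
qed

section \<open>The induction on the dimension\<close>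

theorem (in finite_field_generator) HC_GL:
  assumes "n \<ge> 2" "n = 2 \<Longrightarrow> CARD('a) \<ge> 3" "bypass_transition_graph n T"
  shows "HC (cay (basic_ops \<alpha> n T)) (carrier (GL n :: 'a mat monoid))"
  using assms
proof (induction n arbitrary: T rule: dec_induct)
  case base
  have "bypass_transition_graph (Suc (Suc 0)) T" using base(2) by (simp only: numeral_2_eq_2)
  then have "(0, 1) \<in> T" "(1, 0) \<in> T" by auto
  moreover have "m \<ge> 2" using base(1) card_field by simp
  ultimately show ?case using HC_GL_2 by blast
next
  case (step n)
  let ?B = "basic_ops \<alpha> (Suc n) T" and ?T = "Restr T {..<n}"
  have T: "transition_graph (Suc n) T" "bypass_transition_graph n ?T"
    and ij: "\<exists>i<n. (i, n) \<in> T" "\<exists>j<n. (n, j) \<in> T"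
    using step.prems(2) step.hyps by auto
  obtain i j where i: "i < n" "(i, n) \<in> T" and j: "j < n" "(n, j) \<in> T" using ij by blast
  have BG: "?B \<subseteq> carrier (GL (Suc n))" by (rule basic_ops_GL[OF T(1) alpha_nz])
  have add: "addrow_mat (Suc n) 1 y x \<in> ?B" if "(x, y) \<in> T" for x y
    using that unfolding basic_ops_def by blast
  have "HC (cay ?B) (K2 n)"
  \<comment> \<open>For n = 2 and q = 2 there is no induction hypothesis, and \<open>K2\<close> is
    treated directly. The bypass condition on two vertices forces both edges between 0 and 1, and
    \<open>j\<close> decides which list of words applies.\<close>
  proof (cases "n = 2 \<and> CARD('a) = 2")
    case True
    have "bypass_transition_graph (Suc (Suc 0)) ?T" using T(2) True by (simp add: numeral_2_eq_2)
    then have "(0, 1) \<in> T" "(1, 0) \<in> T" by auto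
    moreover have "Suc n = 3" using True by simp
    ultimately show ?thesis
      using HC_K2_dim_3[of ?B j] True BG j add[of 0 1] add[of 1 0] add[OF j(2)] by simp
  next
    case False
    have c: "n = 2 \<Longrightarrow> CARD('a) \<ge> 3" using False m_pos card_field by (cases "m = 1") auto
    have "HC (cay (basic_ops \<alpha> n ?T)) (carrier (GL n))" using step.IH[OF c T(2)] .
    then have "HC (cay ?B) (K1 n)" by (rule HC_K1_if_HC_GL[OF step.hyps(1) T(1)])
    moreover have "n \<ge> 3 \<or> CARD('a) \<ge> 3" using c step.hyps(1) by linarith
    ultimately show ?thesis using HC_K2_if_HC_K1[OF step.hyps(1) _ BG j(1) add[OF j(2)]] by blast
  qed
  then show ?case using HC_GL_if_HC_K2[OF step.hyps(1) BG i(1) add[OF i(2)]] by blast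
qed

lemma bypass_imp_transition_graph: "bypass_transition_graph n T \<Longrightarrow> transition_graph n T"
  by (cases n) auto

theorem theorem1:
  fixes \<alpha> :: "'a::{finite,field}" and n :: nat and T :: "nat rel"
  assumes "n \<ge> 2"
    and "n = 2 \<Longrightarrow> CARD('a) \<ge> 3"
    and "mult_generator \<alpha>"
    and "bypass_transition_graph n T"
  shows "hamilton_connected (carrier (GL n :: 'a mat monoid))
           (left_cayley_edges (GL n) (ops \<alpha> n T))"
proof -
  interpret finite_field_generator \<alpha> "CARD('a) - 1"
    using assms(3) by unfold_locales simp_all
  show ?thesis
    using hamilton_connected_if_HC[OF bypass_imp_transition_graph[OF assms(4)] alpha_nz HC_GL[OF assms(1,2,4)]] .
qed

end
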